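(* Let $d\in\{2,3\}$, let $s\in(\frac d2,\frac d2+1)$, and let $h^s=(-\Delta)^{-\frac s2}\dot W$ be the fractional Gaussian field on $\mathbb R^d$ with parameter $s$. Then the stochastic process defined by $$\tilde h^s(x)=\langle h^s,\delta_x-\delta_0\rangle,\qquad x\in\mathbb R^d,$$ where $\delta_x\in H^{-s}(\mathbb R^d)$ denotes the Dirac measure centered at $x$, has the same distribution as the fractional Brownian field $B^H$ with Hurst parameter $H=s-\frac d2\in(0,1)$, up to a multiplicative constant.
   Context: White noise: $\dot W$ is the centered Gaussian random distribution on $\mathbb R^d$ with $\mathbb E[\langle\dot W,\varphi\rangle\langle\dot W,\psi\rangle]=(\varphi,\psi)_{L^2(\mathbb R^d)}$ for all $\varphi,\psi\in L^2(\mathbb R^d)$. Fractional Laplacian: $(-\Delta)^{\alpha}u=\mathcal F^{-1}[|\xi|^{2\alpha}\mathcal F[u](\xi)]$ for $\alpha\in\mathbb R$, where $\mathcal F[\psi](\xi)=\int_{\mathbb R^d}e^{-\mathrm i x\cdot\xi}\psi(x)\,dx$. Fractional Gaussian field: for $r\ge 0$ let $\mathcal S_r$ be the set of Schwartz functions $\varphi$ with $\int_{\mathbb R^d}x^\alpha\varphi(x)\,dx=0$ for all multi-indices $|\alpha|\le r$, and for $r<0$ let $\mathcal S_r=\mathcal S$ be the whole Schwartz space. Let $T_s$ be the closure of $\mathcal S_{s-\frac d2}$ with respect to the norm $\varphi\mapsto\big\||\xi|^{-s}\mathcal F[\varphi]\big\|_{L^2}$. The field $h^s$ is the centered Gaussian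 family $\langle h^s,\varphi\rangle:=\langle\dot W,(-\Delta)^{-\frac s2}\varphi\rangle$, $\varphi\in T_s$. In particular $\langle h^s,\delta_x-\delta_0\rangle$ makes sense because $|\xi|^{-s}(e^{-\mathrm i x\cdot\xi}-1)\in L^2(\mathbb R^d)$ for $s\in(\frac d2,\frac d2+1)$. Fractional Brownian field: $B^H$, $H\in(0,1)$, is the centered Gaussian field on $\mathbb R^d$ with $\mathbb E[B^H(x)B^H(y)]=\frac12\left(|x|^{2H}+|y|^{2H}-|x-y|^{2H}\right)$. "Same distribution up to a multiplicative constant" means that there is a constant $c>0$ such that $\tilde h^s$ and $c\,B^H$ have the same finite-dimensional distributions. *)

theory Defs
  imports "HOL-Probability.Probability"
begin

text \<open>
  \<open>\<real>\<^sup>d\<close> is \<open>real ^ 'n\<close> with \<open>d = CARD('n)\<close>.  Partial derivatives are indexed by the list of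
  coordinates to differentiate in, monomials by multi-indices \<open>'n \<Rightarrow> nat\<close>.
\<close>

section \<open>Schwartz functions\<close>

fun iterated_partial ::
  "'n list \<Rightarrow> (real ^ 'n \<Rightarrow> 'b) \<Rightarrow> real ^ 'n \<Rightarrow> 'b::real_normed_vector" where
  "iterated_partial [] f = f"
| "iterated_partial (i # is) f =
     (\<lambda>x. frechet_derivative (iterated_partial is f) (at x) (axis i 1))"

definition schwartz :: "(real ^ 'n \<Rightarrow> 'b::real_normed_vector) set" where
  "schwartz = {f. \<forall>is. (\<forall>x. iterated_partial is f differentiable (at x)) \<and>
     (\<forall>k::nat. bounded (range (\<lambda>x. norm x ^ k *\<^sub>R iterated_partial is f x)))}"

definition schwartz_seminorm ::
  "nat \<Rightarrow> 'n list \<Rightarrow> (real ^ 'n \<Rightarrow> 'b::real_normed_vector) \<Rightarrow> real" where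
  "schwartz_seminorm k is f = (SUP x. norm x ^ k * norm (iterated_partial is f x))"

text \<open>
  The space \<open>\<S>\<^sub>r\<close> of real Schwartz functions with vanishing moments up to order \<open>r\<close>.  For \<open>r < 0\<close>
  the moment condition is empty, so this is the whole Schwartz space.
\<close>

definition schwartz_vanishing :: "real \<Rightarrow> (real ^ 'n \<Rightarrow> real) set" where
  "schwartz_vanishing r = {\<phi> \<in> schwartz. \<forall>\<alpha>::'n \<Rightarrow> nat. real (\<Sum>i\<in>UNIV. \<alpha> i) \<le> r \<longrightarrow>
     (LINT x|lborel. (\<Prod>i\<in>UNIV. (x $ i) ^ \<alpha> i) * \<phi> x) = 0}"

section \<open>Tempered distributions and the Fourier transform\<close>

definition fourier :: "(real ^ 'n \<Rightarrow> complex) \<Rightarrow> real ^ 'n \<Rightarrow> complex" where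
  "fourier \<psi> \<xi> = (LINT x|lborel. exp (- \<i> * complex_of_real (x \<bullet> \<xi>)) * \<psi> x)"

definition inverse_fourier :: "(real ^ 'n \<Rightarrow> complex) \<Rightarrow> real ^ 'n \<Rightarrow> complex" where
  "inverse_fourier \<psi> x =
     (LINT \<xi>|lborel. exp (\<i> * complex_of_real (x \<bullet> \<xi>)) * \<psi> \<xi>) / complex_of_real ((2 * pi) ^ CARD('n))"

text \<open>
  A distribution is a functional of which only the values on \<^const>\<open>schwartz\<close> matter.  The pairing
  of a function with a test function is bilinear (no complex conjugation).
\<close>

type_synonym 'n dist_functional = "(real ^ 'n \<Rightarrow> complex) \<Rightarrow> complex"

definition tempered_distribution :: "'n::finite dist_functional \<Rightarrow> bool" where
  "tempered_distribution u \<longleftrightarrow>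
     (\<forall>\<phi>\<in>schwartz. \<forall>\<psi>\<in>schwartz. u (\<lambda>x. \<phi> x + \<psi> x) = u \<phi> + u \<psi>) \<and>
     (\<forall>a. \<forall>\<phi>\<in>schwartz. u (\<lambda>x. a * \<phi> x) = a * u \<phi>) \<and>
     (\<exists>C N. \<forall>\<phi>\<in>schwartz.
        cmod (u \<phi>) \<le> C * (\<Sum>k\<le>N. \<Sum>is\<in>{is. length is \<le> N}. schwartz_seminorm k is \<phi>))"

definition dist_of_fun :: "(real ^ 'n \<Rightarrow> complex) \<Rightarrow> 'n dist_functional" where
  "dist_of_fun f = (\<lambda>\<psi>. LINT x|lborel. f x * \<psi> x)"

definition represented_by :: "'n::finite dist_functional \<Rightarrow> (real ^ 'n \<Rightarrow> complex) \<Rightarrow> bool" where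
  "represented_by u f \<longleftrightarrow> f \<in> borel_measurable borel \<and>
     (\<forall>\<psi>\<in>schwartz. integrable lborel (\<lambda>x. f x * \<psi> x) \<and> u \<psi> = dist_of_fun f \<psi>)"

definition dirac :: "real ^ 'n \<Rightarrow> 'n dist_functional" where
  "dirac x = (\<lambda>\<psi>. \<psi> x)"

definition fourier_dist :: "'n dist_functional \<Rightarrow> 'n::finite dist_functional" where
  "fourier_dist u = (\<lambda>\<psi>. u (fourier \<psi>))"

definition inverse_fourier_dist :: "'n dist_functional \<Rightarrow> 'n::finite dist_functional" where
  "inverse_fourier_dist u = (\<lambda>\<psi>. u (inverse_fourier \<psi>))"

section \<open>The fractional Laplacian and the test space of the fractional Gaussian field\<close>

text \<open>
  The multiplier \<open>|\<xi>|\<^sup>2\<^sup>a\<close> need not be smooth at \<open>0\<close>, so \<open>(-\<Delta>)\<^sup>a u\<close> is only meaningful for \<open>u\<close> whose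
  Fourier transform is a function; that function is unique up to null sets.
\<close>

definition fourier_density :: "'n::finite dist_functional \<Rightarrow> real ^ 'n \<Rightarrow> complex" where
  "fourier_density u = (SOME f. represented_by (fourier_dist u) f)"

definition frac_laplacian :: "real \<Rightarrow> 'n dist_functional \<Rightarrow> 'n::finite dist_functional" where
  "frac_laplacian a u = inverse_fourier_dist
     (dist_of_fun (\<lambda>\<xi>. complex_of_real (norm \<xi> powr (2 * a)) * fourier_density u \<xi>))"

definition L2 :: "(real ^ 'n \<Rightarrow> real) set" where
  "L2 = {g. g \<in> borel_measurable borel \<and> integrable lborel (\<lambda>x. (g x)\<^sup>2)}"

text \<open>The real \<open>L\<^sup>2\<close> function, unique up to null sets, that a distribution is given by.\<close>

definition L2_representative :: "'n::finite dist_functional \<Rightarrow> real ^ 'n \<Rightarrow> real" where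
  "L2_representative u = (SOME g. g \<in> L2 \<and> represented_by u (\<lambda>x. complex_of_real (g x)))"

text \<open>
  \<open>T\<^sub>s\<close>, the closure of \<open>\<S>\<^bsub>s - d/2\<^esub>\<close> under \<open>\<phi> \<mapsto> \<parallel>|\<xi>|\<^sup>-\<^sup>s \<F>[\<phi>]\<parallel>\<close>, taken among the tempered
  distributions whose Fourier transform is a function.  For \<open>s > -d/2\<close> it is complete, because
  \<open>|\<xi>|\<^sup>s g\<close> is then a tempered distribution for every \<open>g\<close> in \<open>L\<^sup>2\<close>; so it is the abstract completion.
\<close>

definition fgf_test_space :: "real \<Rightarrow> 'n::finite dist_functional set" where
  "fgf_test_space s = {u. tempered_distribution u \<and>
     (\<exists>f. represented_by (fourier_dist u) f \<and>
       (\<forall>\<epsilon>>0. \<exists>\<phi>\<in>schwartz_vanishing (s - real CARD('n) / 2).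
          (\<integral>\<^sup>+ \<xi>. ennreal ((norm \<xi> powr (- s) *
             cmod (fourier (\<lambda>x. complex_of_real (\<phi> x)) \<xi> - f \<xi>))\<^sup>2) \<partial>lborel) < ennreal (\<epsilon>\<^sup>2)))}"

section \<open>Gaussian processes\<close>

text \<open>Gaussian random variables include the degenerate (almost surely constant) ones.\<close>

definition gaussian_rv :: "'w measure \<Rightarrow> ('w \<Rightarrow> real) \<Rightarrow> bool" where
  "gaussian_rv M X \<longleftrightarrow> X \<in> borel_measurable M \<and>
     (\<exists>\<mu> \<sigma>. \<sigma> \<ge> 0 \<and> distr M borel X =
        (if \<sigma> = 0 then return borel \<mu> else density lborel (\<lambda>x. ennreal (normal_density \<mu> \<sigma> x))))"

definition centered_gaussian_process ::
  "'w measure \<Rightarrow> 'i set \<Rightarrow> ('i \<Rightarrow> 'w \<Rightarrow> real) \<Rightarrow> ('i \<Rightarrow> 'i \<Rightarrow> real) \<Rightarrow> bool" where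
  "centered_gaussian_process M I X K \<longleftrightarrow> prob_space M \<and>
     (\<forall>J a. finite J \<longrightarrow> J \<subseteq> I \<longrightarrow> gaussian_rv M (\<lambda>\<omega>. \<Sum>j\<in>J. a j * X j \<omega>)) \<and>
     (\<forall>i\<in>I. (LINT \<omega>|M. X i \<omega>) = 0) \<and>
     (\<forall>i\<in>I. \<forall>j\<in>I. (LINT \<omega>|M. X i \<omega> * X j \<omega>) = K i j)"

definition white_noise :: "'w measure \<Rightarrow> ((real ^ 'n \<Rightarrow> real) \<Rightarrow> 'w \<Rightarrow> real) \<Rightarrow> bool" where
  "white_noise M W \<longleftrightarrow>
     centered_gaussian_process M L2 W (\<lambda>\<phi> \<psi>. LINT x|lborel. \<phi> x * \<psi> x)"

definition fractional_gaussian_field ::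
  "((real ^ 'n \<Rightarrow> real) \<Rightarrow> 'w \<Rightarrow> real) \<Rightarrow> real \<Rightarrow> ('n::finite dist_functional \<Rightarrow> 'w \<Rightarrow> real) \<Rightarrow> bool" where
  "fractional_gaussian_field W s h \<longleftrightarrow>
     (\<forall>u\<in>fgf_test_space s. h u = W (L2_representative (frac_laplacian (- s / 2) u)))"

definition fractional_brownian_field ::
  "'w measure \<Rightarrow> real \<Rightarrow> (real ^ 'n \<Rightarrow> 'w \<Rightarrow> real) \<Rightarrow> bool" where
  "fractional_brownian_field M H B \<longleftrightarrow> centered_gaussian_process M UNIV B
     (\<lambda>x y. (norm x powr (2 * H) + norm y powr (2 * H) - norm (x - y) powr (2 * H)) / 2)"

definition same_fin_dim_distributions ::
  "'v measure \<Rightarrow> ('i \<Rightarrow> 'v \<Rightarrow> real) \<Rightarrow> 'w measure \<Rightarrow> ('i \<Rightarrow> 'w \<Rightarrow> real) \<Rightarrow> bool" where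
  "same_fin_dim_distributions M X N Y \<longleftrightarrow>
     (\<forall>i. X i \<in> borel_measurable M \<and> Y i \<in> borel_measurable N) \<and>
     (\<forall>J. finite J \<longrightarrow>
        distr M (PiM J (\<lambda>_. borel)) (\<lambda>\<omega>. \<lambda>j\<in>J. X j \<omega>) =
        distr N (PiM J (\<lambda>_. borel)) (\<lambda>\<omega>. \<lambda>j\<in>J. Y j \<omega>))"

end

theory Submission
  imports Defs
begin

text \<open>
  On the Fourier side \<open>(-\<Delta>)\<^sup>-\<^sup>s\<^sup>/\<^sup>2\<close> multiplies the transform \<open>e\<^sup>-\<^sup>i\<^sup>x\<^sup>\<xi> - 1\<close> of \<open>\<delta>\<^sub>x - \<delta>\<^sub>0\<close> by \<open>|\<xi>|\<^sup>-\<^sup>s\<close>.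
  Writing \<open>|\<xi>|\<^sup>-\<^sup>s\<close> as a superposition of the Gaussians \<open>exp (-t |\<xi>|\<^sup>2)\<close>, \<open>t > 0\<close>, and transforming each
  of them back, one finds that the result is the function \<open>C (|y - x|\<^sup>s\<^sup>-\<^sup>d - |y|\<^sup>s\<^sup>-\<^sup>d)\<close>, which is in
  \<open>L\<^sup>2\<close> exactly because \<open>d/2 < s < d/2 + 1\<close>.  By translation, rotation and scaling, the \<open>L\<^sup>2\<close> distance of
  two such functions is a constant times \<open>|x - y|\<^sup>s\<^sup>-\<^sup>d\<^sup>/\<^sup>2\<close>, so polarization turns the white noise
  covariance into that of the fractional Brownian field.  A centered
  Gaussian process is determined in law by its covariance, since finite measures on a finite product
  of real lines are determined by their characteristic functions.
\<close>

section \<open>Fourier transform of Gaussians\<close>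

text \<open>Two obstacles shape the argument. First, |\<xi>|^(-s) is not square integrable near 0
  when s > d/2; only the first-order zero of e^(-i x.\<xi>) - 1 repairs this, so on the Fourier side
  the two Dirac masses must be kept together. In position space they separate: d \<ge> 2 gives s <
  d/2 + 1 \<le> d, so each mass has its own kernel |y - x|^(s-d) or |y|^(s-d), locally integrable
  and decaying. Second, the Fourier density and the L2 representative are picked by
  \<open>SOME\<close> and hence known only up to null sets, so the choices must be pinned down by
  injectivity of the Fourier transform. One uniqueness theorem for characteristic functions
  therefore serves three times: for the laws of Gaussian vectors, for the rotation invariance of
  Lebesgue measure, and for the uniqueness of densities. The covariance is evaluated in position
  space, where the inner product of the white noise lives, and of the numerical constants only
  positivity matters.\<close>

lemma gaussian_fourier_real:
  fixes a t :: real
  assumes "a > 0"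
  shows "has_bochner_integral lborel (\<lambda>x. complex_of_real (exp (- a * x\<^sup>2)) * iexp (t * x))
    (complex_of_real (sqrt (pi / a) * exp (- t\<^sup>2 / (4 * a))))"
proof -
  \<comment> \<open>With c^2 = 2a the standard normal density at \<open>c * x\<close> is exp(-a x^2)
    / sqrt(2 pi), so the known characteristic function of the normal law, taken at t/c, yields the
    integral.\<close>
  define c where "c = sqrt (2 * a)"
  have c: "c > 0" "c\<^sup>2 = 2 * a" using assms by (auto simp: c_def)
  have int: "integrable lborel (\<lambda>x. std_normal_density x *\<^sub>R iexp (u * x))" for u
    by (rule Bochner_Integration.integrable_bound[of _ std_normal_density]) auto
  have "(CLINT x|lborel. std_normal_density x *\<^sub>R iexp (u * x)) = complex_of_real (exp (- u\<^sup>2 / 2))" for u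
  proof -
    have "complex_of_real (exp (- u\<^sup>2 / 2)) = char std_normal_distribution u"
      by (simp add: char_std_normal_distribution)
    also have "\<dots> = (CLINT x|lborel. std_normal_density x *\<^sub>R iexp (u * x))"
      unfolding char_def by (subst integral_density) auto
    finally show ?thesis by simp
  qed
  with int have "has_bochner_integral lborel (\<lambda>x. std_normal_density x *\<^sub>R iexp (u * x)) (complex_of_real (exp (- u\<^sup>2 / 2)))" for u
    by (simp add: has_bochner_integral_iff)
  from this[of "t / c"] have "has_bochner_integral lborel (\<lambda>x. std_normal_density (0 + c * x) *\<^sub>R iexp (t / c * (0 + c * x)))
      (complex_of_real (exp (- (t / c)\<^sup>2 / 2)) /\<^sub>R \<bar>c\<bar>)"
    by (subst lborel_has_bochner_integral_real_affine_iff[symmetric]) (use c in auto)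
  then have "has_bochner_integral lborel (\<lambda>x. complex_of_real (sqrt (2 * pi)) * (std_normal_density (0 + c * x) *\<^sub>R iexp (t / c * (0 + c * x))))
      (complex_of_real (sqrt (2 * pi)) * (complex_of_real (exp (- (t / c)\<^sup>2 / 2)) /\<^sub>R \<bar>c\<bar>))"
    by (rule has_bochner_integral_mult_right)
  also have "(\<lambda>x. complex_of_real (sqrt (2 * pi)) * (std_normal_density (0 + c * x) *\<^sub>R iexp (t / c * (0 + c * x))))
     = (\<lambda>x. complex_of_real (exp (- a * x\<^sup>2)) * iexp (t * x))"
    using c by (auto simp: fun_eq_iff std_normal_density_def scaleR_conv_of_real power_mult_distrib)
  also have "complex_of_real (sqrt (2 * pi)) * (complex_of_real (exp (- (t / c)\<^sup>2 / 2)) /\<^sub>R \<bar>c\<bar>)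
     = complex_of_real (sqrt (pi / a) * exp (- t\<^sup>2 / (4 * a)))"
    using c assms by (simp add: scaleR_conv_of_real power_divide c_def real_sqrt_divide real_sqrt_mult field_simps flip: of_real_mult of_real_divide)
  finally show ?thesis .
qed

text \<open>Both the Gaussian and the character factor over the orthonormal basis, so the integral
  over the product measure is a product of one-dimensional ones; \<open>lborel_eq\<close> carries it
  back to Lebesgue measure.\<close>

lemma gaussian_fourier:
  fixes y :: "'a::euclidean_space"
  assumes "a > 0"
  shows "has_bochner_integral lborel (\<lambda>x. complex_of_real (exp (- a * (norm x)\<^sup>2)) * iexp (y \<bullet> x))
    (complex_of_real ((pi / a) powr (DIM('a) / 2) * exp (- (norm y)\<^sup>2 / (4 * a))))"
proof -
  interpret product_sigma_finite "\<lambda>_::'a. lborel :: real measure" ..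
  note g = gaussian_fourier_real[OF assms, unfolded has_bochner_integral_iff]
  let ?f = "\<lambda>b x. complex_of_real (exp (- a * x\<^sup>2)) * iexp (y \<bullet> b * x)"
  have "has_bochner_integral (\<Pi>\<^sub>M b\<in>Basis. lborel) (\<lambda>x. \<Prod>b\<in>Basis. ?f b (x b))
     (\<Prod>b\<in>Basis. complex_of_real (sqrt (pi / a) * exp (- (y \<bullet> b)\<^sup>2 / (4 * a))))"
    unfolding has_bochner_integral_iff using g
    by (intro conjI product_integrable_prod, simp, simp, subst product_integral_prod, simp, simp)
       (simp only: g)
  also have "(\<lambda>x. \<Prod>b\<in>Basis. ?f b (x b)) = (\<lambda>x. complex_of_real (exp (- a * (norm (\<Sum>b\<in>Basis. x b *\<^sub>R b))\<^sup>2)) * iexp (y \<bullet> (\<Sum>b\<in>Basis. x b *\<^sub>R b)))"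
  proof
    fix x :: "'a \<Rightarrow> real"
    let ?v = "\<Sum>b\<in>Basis. x b *\<^sub>R b"
    have "(norm ?v)\<^sup>2 = (\<Sum>b\<in>Basis. (x b)\<^sup>2)"
      unfolding power2_norm_eq_inner euclidean_inner[of ?v ?v] by (simp add: power2_eq_square)
    moreover have "y \<bullet> ?v = (\<Sum>b\<in>Basis. (y \<bullet> b) * x b)"
      by (simp add: inner_sum_right mult.commute)
    ultimately show "(\<Prod>b\<in>Basis. ?f b (x b)) = complex_of_real (exp (- a * (norm ?v)\<^sup>2)) * iexp (y \<bullet> ?v)"
      by (simp add: prod.distrib sum_distrib_left exp_sum sum_negf[symmetric] del: sum_negf flip: of_real_prod)
  qed
  finally have 1: "has_bochner_integral (\<Pi>\<^sub>M b\<in>Basis. lborel) (\<lambda>x. complex_of_real (exp (- a * (norm (\<Sum>b\<in>Basis. x b *\<^sub>R b))\<^sup>2)) * iexp (y \<bullet> (\<Sum>b\<in>Basis. x b *\<^sub>R b)))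
     (\<Prod>b\<in>Basis. complex_of_real (sqrt (pi / a) * exp (- (y \<bullet> b)\<^sup>2 / (4 * a))))" .
  have 2: "(\<Prod>b\<in>Basis. complex_of_real (sqrt (pi / a) * exp (- (y \<bullet> b)\<^sup>2 / (4 * a)))) =
     complex_of_real ((pi / a) powr (DIM('a) / 2) * exp (- (norm y)\<^sup>2 / (4 * a)))"
  proof -
    have "(\<Prod>b\<in>Basis. sqrt (pi / a) * exp (- (y \<bullet> b)\<^sup>2 / (4 * a))) = sqrt (pi / a) ^ DIM('a) * exp (\<Sum>b\<in>Basis. - (y \<bullet> b)\<^sup>2 / (4 * a))"
      by (simp add: prod.distrib exp_sum)
    also have "(\<Sum>b\<in>Basis. - (y \<bullet> b)\<^sup>2 / (4 * a)) = - (norm y)\<^sup>2 / (4 * a)"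
      unfolding power2_norm_eq_inner euclidean_inner[of y y]
      by (simp add: sum_divide_distrib sum_negf power2_eq_square)
    also have "sqrt (pi / a) ^ DIM('a) = (pi / a) powr (DIM('a) / 2)"
      using assms by (simp add: powr_half_sqrt[symmetric] powr_power)
    finally show ?thesis by (simp only: of_real_prod [symmetric])
  qed
  show ?thesis
    unfolding lborel_eq[where 'a='a]
    by (rule has_bochner_integral_distr) (use 1 in \<open>simp_all only: 2\<close>, measurable)
qed

text \<open>Several Fubini exchanges below have a kernel that is such a product times a phase of
  modulus one; this product is then the dominating function.\<close>

lemma integrable_pair_mult:
  fixes f :: "'a \<Rightarrow> 'c::{real_normed_field, banach, second_countable_topology}"
  assumes "sigma_finite_measure M" "sigma_finite_measure N" "integrable M f" "integrable N g"
  shows "integrable (M \<Otimes>\<^sub>M N) (\<lambda>(x, y). f x * g y)"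
proof -
  interpret pair_sigma_finite M N
    using assms by (simp add: pair_sigma_finite_def)
  note [measurable] = borel_measurable_integrable[OF assms(3)] borel_measurable_integrable[OF assms(4)]
  show ?thesis
    by (rule Fubini_integrable) (use assms in \<open>auto simp: norm_mult split_beta' intro!: integrable_norm integrable_mult_left\<close>)
qed

text \<open>An interval indicator has a bounded transform, and Gaussian smoothing multiplies it by a
  Gaussian. The product is integrable, so the smoothed indicator is a superposition of characters
  with an integrable weight. Integrals of it against a measure then depend only on the
  characteristic function of that measure.\<close>

lemma smoothed_indicator_fourier:
  fixes a b \<sigma> :: real
  assumes "\<sigma> > 0"
  shows "\<exists>q. integrable lborel q \<and>
    (\<forall>x. complex_of_real (LINT z|lborel. indicator {a<..<b} (x + \<sigma> * z) * std_normal_density z) = (CLINT t|lborel. q t * iexp (t / \<sigma> * x)))"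
proof -
  \<comment> \<open>The transform of the indicator at frequency t/\<sigma>, weighted by a Gaussian
    in t. The factor 1/(2 pi) comes from the Fourier representation of the normal density, and
    1/\<sigma> from the substitution y = x + \<sigma> z.\<close>
  define q where "q t = (CLINT y|lborel. indicator {a<..<b} y *\<^sub>R iexp (- (t / \<sigma>) * y)) * complex_of_real (exp (- (1/2) * t\<^sup>2) / (2 * pi * \<sigma>))" for t
  have i1: "integrable lborel (\<lambda>t. exp (- (1/2) * t\<^sup>2) :: real)"
    using gaussian_fourier_real[of "1/2" 0] by (simp add: has_bochner_integral_iff complex_of_real_integrable_eq)
  have i2: "integrable lborel (\<lambda>y. indicator {a<..<b} y :: real)"
    by (rule integrable_real_indicator) (use emeasure_bounded_finite[of "{a<..<b}"] in auto)
  have q: "integrable lborel q" unfolding q_def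
  proof (rule Bochner_Integration.integrable_bound)
    show "integrable lborel (\<lambda>t. (LINT y|lborel. indicator {a<..<b} y :: real) * (exp (- (1/2) * t\<^sup>2) / (2 * pi * \<sigma>)))"
      using i1 by auto
    show "(\<lambda>t. (CLINT y|lborel. indicator {a<..<b} y *\<^sub>R iexp (- (t / \<sigma>) * y)) * complex_of_real (exp (- (1/2) * t\<^sup>2) / (2 * pi * \<sigma>))) \<in> borel_measurable lborel"
      by measurable
    show "AE t in lborel. cmod ((CLINT y|lborel. indicator {a<..<b} y *\<^sub>R iexp (- (t / \<sigma>) * y)) * complex_of_real (exp (- (1/2) * t\<^sup>2) / (2 * pi * \<sigma>)))
          \<le> norm ((LINT y|lborel. indicator {a<..<b} y :: real) * (exp (- (1/2) * t\<^sup>2) / (2 * pi * \<sigma>)))"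
    proof (rule AE_I2)
      fix t :: real
      have "cmod (CLINT y|lborel. indicator {a<..<b} y *\<^sub>R iexp (- (t / \<sigma>) * y)) \<le> (LINT y|lborel. norm (indicator {a<..<b} y *\<^sub>R iexp (- (t / \<sigma>) * y)))"
        by (rule integral_norm_bound)
      also have "\<dots> = (LINT y|lborel. indicator {a<..<b} y :: real)"
        by (rule Bochner_Integration.integral_cong) auto
      finally show "cmod ((CLINT y|lborel. indicator {a<..<b} y *\<^sub>R iexp (- (t / \<sigma>) * y)) * complex_of_real (exp (- (1/2) * t\<^sup>2) / (2 * pi * \<sigma>)))
          \<le> norm ((LINT y|lborel. indicator {a<..<b} y :: real) * (exp (- (1/2) * t\<^sup>2) / (2 * pi * \<sigma>)))"
        unfolding norm_mult norm_of_real real_norm_def abs_mult by (intro mult_right_mono) (auto intro: order_trans)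
    qed
  qed
  have "complex_of_real (LINT z|lborel. indicator {a<..<b} (x + \<sigma> * z) * std_normal_density z) = (CLINT t|lborel. q t * iexp (t / \<sigma> * x))" for x
  proof -
    \<comment> \<open>Integrating \<open>K\<close> over t restores the Gaussian kernel centered at
      x, integrating it over y produces \<open>q\<close>; the claim is the exchange of the
      two.\<close>
    define K where "K y t = (indicator {a<..<b} y *\<^sub>R complex_of_real (exp (- (1/2) * t\<^sup>2) / (2 * pi * \<sigma>))) * iexp ((x - y) / \<sigma> * t)" for y t
    have K: "integrable (lborel \<Otimes>\<^sub>M lborel) (\<lambda>(y, t). K y t)"
      unfolding K_def
    proof (rule Bochner_Integration.integrable_bound)
      show "integrable (lborel \<Otimes>\<^sub>M lborel) (\<lambda>(y, t). (indicator {a<..<b} y :: real) * (exp (- (1/2) * t\<^sup>2) / (2 * pi * \<sigma>)))"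
        using i1 i2 by (intro integrable_pair_mult lborel.sigma_finite_measure_axioms) auto
    qed (use assms in \<open>auto simp: indicator_def norm_divide norm_mult\<close>)
    have st: "complex_of_real (std_normal_density u) = (CLINT t|lborel. complex_of_real (exp (- (1/2) * t\<^sup>2) / (2 * pi)) * iexp (u * t))" for u
    proof -
      have "(CLINT t|lborel. complex_of_real (exp (- (1/2) * t\<^sup>2) / (2 * pi)) * iexp (u * t)) =
         (CLINT t|lborel. complex_of_real (exp (- (1/2) * t\<^sup>2)) * iexp (u * t)) / complex_of_real (2 * pi)"
        by (subst integral_divide_zero[symmetric]) (simp add: field_simps)
      also have "\<dots> = complex_of_real (std_normal_density u)"
        using gaussian_fourier_real[of "1/2" u] by (simp add: has_bochner_integral_iff std_normal_density_def real_sqrt_mult field_simps flip: of_real_mult)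
      finally show ?thesis by simp
    qed
    have "(LINT z|lborel. indicator {a<..<b} (x + \<sigma> * z) * std_normal_density z)
       = (LINT z|lborel. indicator {a<..<b} (x + \<sigma> * z) * std_normal_density (((x + \<sigma> * z) - x) / \<sigma>))"
      using assms by simp
    also have "\<dots> = (LINT y|lborel. indicator {a<..<b} y * std_normal_density ((y - x) / \<sigma>)) / \<sigma>"
      by (subst (2) lborel_integral_real_affine[where c=\<sigma> and t=x]) (use assms in auto)
    also have "\<dots> = (LINT y|lborel. indicator {a<..<b} y * std_normal_density ((y - x) / \<sigma>) / \<sigma>)"
      by simp
    also have "complex_of_real \<dots> = (CLINT y|lborel. CLINT t|lborel. K y t)"
      unfolding integral_complex_of_real[symmetric]
    proof (rule Bochner_Integration.integral_cong[OF refl])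
      fix y
      have even: "std_normal_density ((y - x) / \<sigma>) = std_normal_density ((x - y) / \<sigma>)"
        by (simp add: std_normal_density_def power2_commute power_divide)
      have "complex_of_real (indicator {a<..<b} y * std_normal_density ((y - x) / \<sigma>) / \<sigma>) =
         (complex_of_real (indicator {a<..<b} y) / complex_of_real \<sigma>) * (CLINT t|lborel. complex_of_real (exp (- (1/2) * t\<^sup>2) / (2 * pi)) * iexp ((x - y) / \<sigma> * t))"
        unfolding st[symmetric] by (subst even) simp
      also have "\<dots> = (CLINT t|lborel. K y t)"
        unfolding integral_mult_right_zero[symmetric] K_def
        by (rule Bochner_Integration.integral_cong[OF refl]) (simp only: scaleR_conv_of_real of_real_divide of_real_mult times_divide_eq_left times_divide_eq_right divide_divide_eq_left mult_ac)
      finally show "complex_of_real (indicator {a<..<b} y * std_normal_density ((y - x) / \<sigma>) / \<sigma>) = (CLINT t|lborel. K y t)" .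
    qed
    also have "\<dots> = (CLINT t|lborel. CLINT y|lborel. K y t)"
      by (rule lborel_pair.Fubini_integral[OF K, symmetric])
    also have "\<dots> = (CLINT t|lborel. q t * iexp (t / \<sigma> * x))"
    proof (rule Bochner_Integration.integral_cong[OF refl])
      fix t
      have "K y t = (indicator {a<..<b} y *\<^sub>R iexp (- (t / \<sigma>) * y)) * (complex_of_real (exp (- (1/2) * t\<^sup>2) / (2 * pi * \<sigma>)) * iexp (t / \<sigma> * x))" for y
      proof -
        have *: "iexp ((x - y) / \<sigma> * t) = iexp (- (t / \<sigma>) * y) * iexp (t / \<sigma> * x)"
          by (subst exp_add[symmetric]) (simp add: algebra_simps diff_divide_distrib)
        show ?thesis unfolding * K_def by (simp only: scaleR_conv_of_real mult_ac)
      qed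
      then show "(CLINT y|lborel. K y t) = q t * iexp (t / \<sigma> * x)"
        unfolding q_def mult.assoc by (subst integral_mult_left_zero[symmetric]) (rule Bochner_Integration.integral_cong[OF refl])
    qed
    finally show ?thesis .
  qed
  with q show ?thesis by (intro exI[of _ q] conjI allI)
qed

section \<open>Uniqueness of characteristic functions on finite products\<close>

text \<open>A product of superpositions of one-dimensional characters is a superposition of
  characters of the product space. By Fubini the measure enters only through its characteristic
  function.\<close>

lemma char_fun_smoothed_PiM:
  fixes \<mu> :: "('i \<Rightarrow> real) measure" and \<Phi> :: "'i \<Rightarrow> real \<Rightarrow> complex"
  assumes J: "finite J" and \<mu>: "finite_measure \<mu>" "sets \<mu> = sets (PiM J (\<lambda>_. borel))"
    and q: "\<And>j. integrable lborel (q j)"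
    and \<Phi>: "\<And>j x. \<Phi> j x = (CLINT t|lborel. q j t * iexp (t / \<sigma> * x))"
  shows "(CLINT x|\<mu>. \<Prod>j\<in>J. \<Phi> j (x j)) =
    (CLINT t|PiM J (\<lambda>_. lborel). (\<Prod>j\<in>J. q j (t j)) * (CLINT x|\<mu>. iexp (\<Sum>j\<in>J. t j / \<sigma> * x j)))"
proof -
  interpret \<mu>: finite_measure \<mu> by fact
  interpret P: product_sigma_finite "\<lambda>_::'i. lborel :: real measure" ..
  interpret F: finite_product_sigma_finite "\<lambda>_::'i. lborel :: real measure" J by standard fact
  interpret pair_sigma_finite \<mu> "PiM J (\<lambda>_. lborel :: real measure)" ..
  note [measurable] = borel_measurable_integrable[OF q]
  have [measurable_cong]: "sets \<mu> = sets (PiM J (\<lambda>_. borel))" by fact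
  have iq: "integrable (PiM J (\<lambda>_. lborel)) (\<lambda>t. \<Prod>j\<in>J. q j (t j))"
    by (rule P.product_integrable_prod[OF J q])
  let ?K = "\<lambda>x t. (\<Prod>j\<in>J. q j (t j)) * iexp (\<Sum>j\<in>J. t j / \<sigma> * x j)"
  have K: "integrable (\<mu> \<Otimes>\<^sub>M PiM J (\<lambda>_. lborel)) (\<lambda>(x, t). ?K x t)"
  proof (rule Bochner_Integration.integrable_bound)
    show "integrable (\<mu> \<Otimes>\<^sub>M PiM J (\<lambda>_. lborel)) (\<lambda>(x, t). 1 * (\<Prod>j\<in>J. q j (t j)))"
      by (intro integrable_pair_mult iq) (auto intro: \<mu>.sigma_finite_measure_axioms F.sigma_finite_measure_axioms)
    show "(\<lambda>(x, t). ?K x t) \<in> borel_measurable (\<mu> \<Otimes>\<^sub>M PiM J (\<lambda>_. lborel))"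
      using J by measurable
  qed (auto simp: norm_mult)
  have "(\<Prod>j\<in>J. \<Phi> j (x j)) = (CLINT t|PiM J (\<lambda>_. lborel). ?K x t)" for x
  proof -
    have "(\<Prod>j\<in>J. \<Phi> j (x j)) = (CLINT t|PiM J (\<lambda>_. lborel). \<Prod>j\<in>J. q j (t j) * iexp (t j / \<sigma> * x j))"
      unfolding \<Phi>
    proof (rule P.product_integral_prod[OF J, symmetric])
      fix j show "integrable lborel (\<lambda>t. q j t * iexp (t / \<sigma> * x j))"
        by (rule Bochner_Integration.integrable_bound[OF q[of j]]) (auto simp: norm_mult)
    qed
    also have "\<dots> = (CLINT t|PiM J (\<lambda>_. lborel). ?K x t)"
      using J by (simp add: prod.distrib exp_sum sum_distrib_left)
    finally show ?thesis .
  qed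
  then have "(CLINT x|\<mu>. \<Prod>j\<in>J. \<Phi> j (x j)) = (CLINT x|\<mu>. CLINT t|PiM J (\<lambda>_. lborel). ?K x t)"
    by simp
  also have "\<dots> = (CLINT t|PiM J (\<lambda>_. lborel). CLINT x|\<mu>. ?K x t)"
    by (rule Fubini_integral[OF K, symmetric])
  finally show ?thesis by simp
qed

text \<open>Open boxes are stable under intersection and adapted to the smoothing, so this is the
  generator on which two measures will be compared.\<close>

lemma sets_PiM_boxes:
  assumes "finite J"
  shows "sets (PiM J (\<lambda>_. borel :: real measure)) =
    sigma_sets (PiE J (\<lambda>_. UNIV)) {PiE J (\<lambda>j. {a j<..<b j}) |a b. True}" (is "?L = sigma_sets ?\<Omega> ?E")
proof
  have E: "?E \<subseteq> Pow ?\<Omega>" by auto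
  define N where "N = sigma ?\<Omega> ?E"
  have sN: "space N = ?\<Omega>" "sets N = sigma_sets ?\<Omega> ?E"
    using E by (auto simp: N_def)
  have m: "(\<lambda>x. x i) \<in> borel_measurable N" if "i \<in> J" for i
  proof (rule borel_measurableI_less)
    fix y :: real
    \<comment> \<open>A half-space is exhausted by boxes that are cut at y in direction i and at n
      in all others. Finiteness of \<open>J\<close> lets one n bound all coordinates of a
      point.\<close>
    have "{x \<in> ?\<Omega>. x i < y} = (\<Union>n::nat. PiE J (\<lambda>j. {- real n<..<(if j = i then y else real n)}))" (is "?A = (\<Union>n. ?B n)")
    proof (intro equalityI subsetI)
      fix x assume x: "x \<in> ?A"
      obtain n :: nat where n: "(\<Sum>j\<in>J. \<bar>x j\<bar>) < real n" using reals_Archimedean2 by blast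
      have "\<bar>x j\<bar> < real n" if "j \<in> J" for j
        by (rule le_less_trans[OF member_le_sum[of j J "\<lambda>j. \<bar>x j\<bar>"] n]) (use that \<open>finite J\<close> in auto)
      then have "\<And>j. j \<in> J \<Longrightarrow> - real n < x j \<and> x j < real n" by (smt (verit))
      then have "x \<in> ?B n" using x by (auto simp: PiE_iff)
      then show "x \<in> (\<Union>n. ?B n)" by blast
    next
      fix x assume "x \<in> (\<Union>n. ?B n)"
      then obtain n where n: "x \<in> ?B n" by blast
      from PiE_mem[OF n that] n show "x \<in> ?A" by (auto simp: PiE_iff)
    qed
    also have "\<dots> \<in> sets N"
    proof (intro sets.countable_UN image_subsetI)
      fix n :: nat
      have "?B n \<in> ?E"
        by (rule CollectI, rule exI[of _ "\<lambda>_. - real n"], rule exI[of _ "\<lambda>j. if j = i then y else real n"]) simp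
      then show "?B n \<in> sets N" by (simp add: sN sigma_sets.Basic)
    qed
    finally show "{x \<in> space N. x i < y} \<in> sets N" by (simp add: sN)
  qed
  show "?L \<subseteq> sigma_sets ?\<Omega> ?E"
    unfolding sN(2)[symmetric]
  proof (rule sets_PiM_in_sets)
    fix i and A :: "real set" assume "i \<in> J" "A \<in> sets borel"
    then show "{x \<in> space N. x i \<in> A} \<in> sets N"
      using measurable_sets[OF m, of i A] by (simp add: vimage_def Int_def conj_commute)
  qed (simp add: sN)
  have "?E \<subseteq> ?L"
    using assms by (auto intro!: sets_PiM_I_finite)
  from sets.sigma_sets_subset[OF this] show "sigma_sets ?\<Omega> ?E \<subseteq> ?L"
    by (simp add: space_PiM)
qed

text \<open>The measure of an open box is a limit of integrals of products of smoothed indicators,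
  and each of these integrals is determined by the characteristic function. Agreement on boxes
  extends to all measurable sets by the generator argument.\<close>

theorem char_fun_unique_PiM:
  fixes \<mu> \<nu> :: "('i \<Rightarrow> real) measure"
  assumes J: "finite J"
    and \<mu>: "finite_measure \<mu>" "sets \<mu> = sets (PiM J (\<lambda>_. borel))"
    and \<nu>: "finite_measure \<nu>" "sets \<nu> = sets (PiM J (\<lambda>_. borel))"
    and eq: "\<And>t. (CLINT x|\<mu>. iexp (\<Sum>j\<in>J. t j * x j)) = (CLINT x|\<nu>. iexp (\<Sum>j\<in>J. t j * x j))"
  shows "\<mu> = \<nu>"
proof (rule measure_eqI_generator_eq)
  let ?\<Omega> = "PiE J (\<lambda>_. UNIV :: real set)" and ?E = "{PiE J (\<lambda>j. {a j<..<b j :: real}) |a b. True}"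
  show "Int_stable ?E"
  proof (rule Int_stableI, safe)
    fix a b a' b' :: "'i \<Rightarrow> real"
    have "PiE J (\<lambda>j. {a j<..<b j}) \<inter> PiE J (\<lambda>j. {a' j<..<b' j}) = PiE J (\<lambda>j. {max (a j) (a' j)<..<min (b j) (b' j)})"
      by (simp add: PiE_Int)
    then show "\<exists>a'' b''. PiE J (\<lambda>j. {a j<..<b j}) \<inter> PiE J (\<lambda>j. {a' j<..<b' j}) = PiE J (\<lambda>j. {a'' j<..<b'' j}) \<and> True"
      by (intro exI conjI TrueI) assumption
  qed
  show "?E \<subseteq> Pow ?\<Omega>" by auto
  show "sets \<mu> = sigma_sets ?\<Omega> ?E" "sets \<nu> = sigma_sets ?\<Omega> ?E"
    using \<mu> \<nu> sets_PiM_boxes[OF J] by auto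
  interpret \<mu>: finite_measure \<mu> by fact
  interpret \<nu>: finite_measure \<nu> by fact
  let ?A = "\<lambda>n::nat. PiE J (\<lambda>j. {- real n<..<real n})"
  show "range ?A \<subseteq> ?E"
  proof safe
    fix n show "\<exists>a b. ?A n = PiE J (\<lambda>j. {a j<..<b j}) \<and> True"
      by (rule exI[of _ "\<lambda>_. - real n"], rule exI[of _ "\<lambda>_. real n"]) simp
  qed
  show "emeasure \<mu> (?A i) \<noteq> \<infinity>" for i by simp
  show "(\<Union>n. ?A n) = ?\<Omega>"
  proof (intro equalityI subsetI)
    fix x assume x: "x \<in> ?\<Omega>"
    obtain n :: nat where n: "(\<Sum>j\<in>J. \<bar>x j\<bar>) < real n" using reals_Archimedean2 by blast
    have "\<bar>x j\<bar> < real n" if "j \<in> J" for j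
      by (rule le_less_trans[OF member_le_sum[of j J "\<lambda>j. \<bar>x j\<bar>"] n]) (use that J in auto)
    then have "\<And>j. j \<in> J \<Longrightarrow> - real n < x j \<and> x j < real n" by (smt (verit))
      then have "x \<in> ?A n" using x by (auto simp: PiE_iff)
    then show "x \<in> (\<Union>n. ?A n)" by blast
  qed auto
  fix X assume "X \<in> ?E"
  then obtain a b :: "'i \<Rightarrow> real" where X: "X = PiE J (\<lambda>j. {a j<..<b j})" by auto
  \<comment> \<open>The intervals shrink by \<open>1/(n+1)\<close> while the Gaussian noise has the smaller scale \<open>1/(n+1)\<^sup>2\<close>; this
    makes the limit vanish at the endpoints, which may be atoms.\<close>
  define \<Phi> where "\<Phi> n j x = (LINT z|lborel. indicator {a j + 1 / real (Suc n)<..<b j - 1 / real (Suc n)} (x + 1 / (real (Suc n))\<^sup>2 * z) * std_normal_density z)" for n j x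
  have \<Phi>_eq: "(LINT x|\<mu>. (\<Prod>j\<in>J. \<Phi> n j (x j))) = (LINT x|\<nu>. (\<Prod>j\<in>J. \<Phi> n j (x j)))" for n
  proof -
    have "\<forall>j. \<exists>q. integrable lborel q \<and> (\<forall>x. complex_of_real (\<Phi> n j x) = (CLINT t|lborel. q t * iexp (t / (1 / (real (Suc n))\<^sup>2) * x)))"
      unfolding \<Phi>_def by (intro allI smoothed_indicator_fourier) simp
    from choice[OF this] obtain q where "\<forall>j. integrable lborel (q j) \<and> (\<forall>x. complex_of_real (\<Phi> n j x) = (CLINT t|lborel. q j t * iexp (t / (1 / (real (Suc n))\<^sup>2) * x)))" ..
    note q = this[rule_format, THEN conjunct1] this[rule_format, THEN conjunct2, rule_format]
    have "(CLINT x|\<mu>. \<Prod>j\<in>J. complex_of_real (\<Phi> n j (x j))) = (CLINT x|\<nu>. \<Prod>j\<in>J. complex_of_real (\<Phi> n j (x j)))"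
      unfolding char_fun_smoothed_PiM[OF J \<mu> q] char_fun_smoothed_PiM[OF J \<nu> q] eq ..
    then show ?thesis
      unfolding of_real_prod[symmetric] integral_complex_of_real of_real_eq_iff .
  qed
  have [measurable]: "\<Phi> n j \<in> borel_measurable borel" for n j
    unfolding \<Phi>_def by measurable
  have \<Phi>_bound: "\<bar>\<Phi> n j x\<bar> \<le> 1" for n j x
  proof -
    have "\<bar>\<Phi> n j x\<bar> \<le> (LINT z|lborel. \<bar>indicator {a j + 1 / real (Suc n)<..<b j - 1 / real (Suc n)} (x + 1 / (real (Suc n))\<^sup>2 * z) * std_normal_density z\<bar>)"
      unfolding \<Phi>_def by (rule integral_abs_bound)
    also have "\<dots> \<le> (LINT z|lborel. std_normal_density z)"
      by (rule integral_mono') (auto simp: indicator_def)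
    finally show ?thesis by simp
  qed
  have \<Phi>_lim: "(\<lambda>n. \<Phi> n j x) \<longlonglongrightarrow> indicator {a j<..<b j} x" for j x
  proof -
    have "(\<lambda>n. \<Phi> n j x) \<longlonglongrightarrow> (LINT z|lborel. indicator {a j<..<b j} x * std_normal_density z)"
      unfolding \<Phi>_def
    proof (rule integral_dominated_convergence[where w = std_normal_density])
      show "AE z in lborel. (\<lambda>n. indicator {a j + 1 / real (Suc n)<..<b j - 1 / real (Suc n)} (x + 1 / (real (Suc n))\<^sup>2 * z) * std_normal_density z) \<longlonglongrightarrow> indicator {a j<..<b j} x * std_normal_density z"
      proof (rule AE_I2, rule tendsto_eventually)
        fix z :: real
        \<comment> \<open>From this index on the noise |z|/(n+1)^2 is at most the margin 1/(n+1), so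
          a point on or beyond an endpoint is never pushed into the shrunken interval.\<close>
        have large: "\<forall>\<^sub>F n in sequentially. real (Suc n) > \<bar>z\<bar>"
        proof -
          obtain m :: nat where m: "\<bar>z\<bar> < real m" using reals_Archimedean2 by blast
          show ?thesis by (rule eventually_sequentiallyI[of m]) (use m in auto)
        qed
        have lim0: "(\<lambda>n. 1 / real (Suc n)) \<longlonglongrightarrow> 0"
          using LIMSEQ_inverse_real_of_nat by (simp add: inverse_eq_divide)
        from tendsto_mult[OF lim0 lim0] have lim1: "(\<lambda>n. 1 / (real (Suc n))\<^sup>2) \<longlonglongrightarrow> 0"
          by (simp add: power2_eq_square)
        have 2: "(\<lambda>n. a j + 1 / real (Suc n) - 1 / (real (Suc n))\<^sup>2 * z) \<longlonglongrightarrow> a j + 0 - 0 * z"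
             "(\<lambda>n. b j - 1 / real (Suc n) - 1 / (real (Suc n))\<^sup>2 * z) \<longlonglongrightarrow> b j - 0 - 0 * z"
          by (intro tendsto_intros lim0 lim1)+
        consider "x \<le> a j" | "x \<ge> b j" | "a j < x" "x < b j" by linarith
        then show "\<forall>\<^sub>F n in sequentially. indicator {a j + 1 / real (Suc n)<..<b j - 1 / real (Suc n)} (x + 1 / (real (Suc n))\<^sup>2 * z) * std_normal_density z = indicator {a j<..<b j} x * std_normal_density z"
        proof cases
          case 3
          have "\<forall>\<^sub>F n in sequentially. a j + 1 / real (Suc n) - 1 / (real (Suc n))\<^sup>2 * z < x"
            by (rule order_tendstoD(2)[OF 2(1)]) (use 3 in simp)
          moreover have "\<forall>\<^sub>F n in sequentially. x < b j - 1 / real (Suc n) - 1 / (real (Suc n))\<^sup>2 * z"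
            by (rule order_tendstoD(1)[OF 2(2)]) (use 3 in simp)
          ultimately show ?thesis
          proof eventually_elim
            case (elim n)
            then have "x + 1 / (real (Suc n))\<^sup>2 * z \<in> {a j + 1 / real (Suc n)<..<b j - 1 / real (Suc n)}"
              by (simp only: greaterThanLessThan_iff) linarith
            with 3 show ?case by simp
          qed
        next
          case 1
          show ?thesis using large
          proof eventually_elim
            case (elim n)
            have "1 / (real (Suc n))\<^sup>2 * z \<le> 1 / (real (Suc n))\<^sup>2 * real (Suc n)"
              by (intro mult_left_mono) (use elim in auto)
            also have "\<dots> = 1 / real (Suc n)" by (simp add: power2_eq_square del: of_nat_Suc)
            finally have "1 / (real (Suc n))\<^sup>2 * z \<le> 1 / real (Suc n)" .
            with 1 show ?case by (auto simp: indicator_def)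
          qed
        next
          case 2
          show ?thesis using large
          proof eventually_elim
            case (elim n)
            have "1 / (real (Suc n))\<^sup>2 * - z \<le> 1 / (real (Suc n))\<^sup>2 * real (Suc n)"
              by (intro mult_left_mono) (use elim in auto)
            also have "\<dots> = 1 / real (Suc n)" by (simp add: power2_eq_square del: of_nat_Suc)
            finally have "- (1 / (real (Suc n))\<^sup>2 * z) \<le> 1 / real (Suc n)" by simp
            with 2 show ?case by (auto simp: indicator_def)
          qed
        qed
      qed
    qed (auto simp: indicator_def)
    then show ?thesis by simp
  qed
  have lim: "(\<lambda>n. LINT x|\<rho>. (\<Prod>j\<in>J. \<Phi> n j (x j))) \<longlonglongrightarrow> measure \<rho> X"
    if \<rho>: "finite_measure \<rho>" "sets \<rho> = sets (PiM J (\<lambda>_. borel))" for \<rho>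
  proof -
    interpret \<rho>: finite_measure \<rho> by fact
    have [measurable_cong]: "sets \<rho> = sets (PiM J (\<lambda>_. borel))" by fact
    have sp: "space \<rho> = ?\<Omega>" using sets_eq_imp_space_eq[OF \<rho>(2)] by (simp add: space_PiM)
    have "(\<lambda>n. LINT x|\<rho>. (\<Prod>j\<in>J. \<Phi> n j (x j))) \<longlonglongrightarrow> (LINT x|\<rho>. indicator X x)"
    proof (rule integral_dominated_convergence[where w = "\<lambda>_. 1"])
      show "(\<lambda>x. indicator X x :: real) \<in> borel_measurable \<rho>"
        unfolding X using J by measurable
      show "(\<lambda>x. \<Prod>j\<in>J. \<Phi> n j (x j)) \<in> borel_measurable \<rho>" for n
        by measurable
      show "AE x in \<rho>. (\<lambda>n. \<Prod>j\<in>J. \<Phi> n j (x j)) \<longlonglongrightarrow> indicator X x"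
      proof (rule AE_I2)
        fix x assume x: "x \<in> space \<rho>"
        have "(\<lambda>n. \<Prod>j\<in>J. \<Phi> n j (x j)) \<longlonglongrightarrow> (\<Prod>j\<in>J. indicator {a j<..<b j} (x j))"
          by (intro tendsto_prod \<Phi>_lim)
        also have "(\<Prod>j\<in>J. indicator {a j<..<b j} (x j) :: real) = indicator X x"
          using x J unfolding X sp by (auto simp: indicator_def PiE_iff prod_zero_iff intro!: prod.neutral)
        finally show "(\<lambda>n. \<Prod>j\<in>J. \<Phi> n j (x j)) \<longlonglongrightarrow> indicator X x" .
      qed
      show "AE x in \<rho>. norm (\<Prod>j\<in>J. \<Phi> n j (x j)) \<le> 1" for n
        unfolding prod_norm[symmetric] by (intro AE_I2 prod_le_1) (auto simp: \<Phi>_bound)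
    qed auto
    moreover have "X \<in> sets \<rho>" unfolding \<rho>(2) X using J by measurable
    ultimately show ?thesis by simp
  qed
  from lim[OF \<mu>] lim[OF \<nu>] have "measure \<mu> X = measure \<nu> X"
    unfolding \<Phi>_eq by (rule LIMSEQ_unique)
  then show "emeasure \<mu> X = emeasure \<nu> X"
    by (simp add: \<mu>.emeasure_eq_measure \<nu>.emeasure_eq_measure)
qed

section \<open>Laws of centered Gaussian processes\<close>

text \<open>Zero mean forces the location parameter to be 0 both for a point mass and for a normal
  density, after which one formula covers the two cases. The characteristic function is needed at 1
  only, since frequencies are absorbed into the coefficients of a linear combination.\<close>

lemma gaussian_rv_centered:
  assumes "prob_space M" and Y: "gaussian_rv M Y" and mean: "(LINT \<omega>|M. Y \<omega>) = 0"
  shows gaussian_rv_square_integrable: "integrable M (\<lambda>\<omega>. (Y \<omega>)\<^sup>2)"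
    and gaussian_rv_char_fun: "(CLINT \<omega>|M. iexp (Y \<omega>)) = complex_of_real (exp (- (LINT \<omega>|M. (Y \<omega>)\<^sup>2) / 2))"
proof -
  interpret prob_space M by fact
  have [measurable]: "Y \<in> borel_measurable M" using Y by (simp add: gaussian_rv_def)
  obtain \<mu> \<sigma> where \<sigma>: "\<sigma> \<ge> 0" and D: "distr M borel Y =
        (if \<sigma> = 0 then return borel \<mu> else density lborel (\<lambda>x. ennreal (normal_density \<mu> \<sigma> x)))"
    using Y by (auto simp: gaussian_rv_def)
  have E: "(LINT \<omega>|M. f (Y \<omega>)) = (LINT x|distr M borel Y. f x)" if [measurable]: "f \<in> borel_measurable borel" for f :: "real \<Rightarrow> real"
    by (simp add: integral_distr)
  have C: "(CLINT \<omega>|M. iexp (Y \<omega>)) = (CLINT x|distr M borel Y. iexp x)"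
    by (subst integral_distr) simp_all
  have I: "integrable M (\<lambda>\<omega>. (Y \<omega>)\<^sup>2) \<longleftrightarrow> integrable (distr M borel Y) (\<lambda>x. x\<^sup>2)"
    by (simp add: integrable_distr_eq)
  have "integrable M (\<lambda>\<omega>. (Y \<omega>)\<^sup>2) \<and> (CLINT \<omega>|M. iexp (Y \<omega>)) = complex_of_real (exp (- (LINT \<omega>|M. (Y \<omega>)\<^sup>2) / 2))"
  proof (cases "\<sigma> = 0")
    case True
    then have D': "distr M borel Y = return borel \<mu>" using D by simp
    interpret R: prob_space "return borel \<mu> :: real measure" by (rule prob_space_return) simp
    from E[of "\<lambda>x. x"] mean have "\<mu> = 0" by (simp add: D' integral_return)
    have "integrable (return borel \<mu>) (\<lambda>x. x\<^sup>2)"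
      by (rule R.integrable_const_bound[where B="\<mu>\<^sup>2"]) (auto simp: AE_return)
    then show ?thesis
      unfolding I C E[of "\<lambda>x. x\<^sup>2", simplified] D' using \<open>\<mu> = 0\<close> by (simp add: integral_return)
  next
    case False
    then have s: "\<sigma> > 0" and D': "distr M borel Y = density lborel (\<lambda>x. ennreal (normal_density \<mu> \<sigma> x))"
      using D \<sigma> by auto
    from E[of "\<lambda>x. x"] mean have "\<mu> = 0"
      using s by (simp add: D' integral_density integral_normal_moment_nz_1)
    have "integrable (distr M borel Y) (\<lambda>x. x\<^sup>2)"
      using integrable_normal_moment[OF s, of 0 2] \<open>\<mu> = 0\<close> s unfolding D' by (subst integrable_density) auto
    moreover have "(LINT \<omega>|M. (Y \<omega>)\<^sup>2) = \<sigma>\<^sup>2"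
      using integral_normal_moment_even[OF s, of 0 1] \<open>\<mu> = 0\<close> s
      unfolding E[of "\<lambda>x. x\<^sup>2", simplified] D' by (subst integral_density) (auto simp: fact_numeral)
    moreover have "(CLINT x|distr M borel Y. iexp x) = complex_of_real (exp (- \<sigma>\<^sup>2 / 2))"
    proof -
      have nd: "complex_of_real (normal_density 0 \<sigma> x) = complex_of_real (1 / sqrt (2 * pi * \<sigma>\<^sup>2)) * complex_of_real (exp (- (1 / (2 * \<sigma>\<^sup>2)) * x\<^sup>2))" for x
        by (simp add: normal_density_def)
      have "(CLINT x|distr M borel Y. iexp x) = (CLINT x|lborel. complex_of_real (1 / sqrt (2 * pi * \<sigma>\<^sup>2)) * (complex_of_real (exp (- (1 / (2 * \<sigma>\<^sup>2)) * x\<^sup>2)) * iexp (1 * x)))"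
        unfolding D' \<open>\<mu> = 0\<close> using s by (subst integral_density) (auto simp: scaleR_conv_of_real nd mult.assoc)
      also have "\<dots> = complex_of_real (1 / sqrt (2 * pi * \<sigma>\<^sup>2)) * complex_of_real (sqrt (pi / (1 / (2 * \<sigma>\<^sup>2))) * exp (- 1\<^sup>2 / (4 * (1 / (2 * \<sigma>\<^sup>2)))))"
        unfolding integral_mult_right_zero
        by (subst has_bochner_integral_integral_eq[OF gaussian_fourier_real]) (use s in auto)
      also have "\<dots> = complex_of_real (exp (- \<sigma>\<^sup>2 / 2))"
      proof -
        have "pi / (1 / (2 * \<sigma>\<^sup>2)) = 2 * pi * \<sigma>\<^sup>2" "4 * (1 / (2 * \<sigma>\<^sup>2)) = 2 / \<sigma>\<^sup>2"
          by auto
        then show ?thesis using s by (simp only: of_real_mult[symmetric]) simp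
      qed
      finally show ?thesis .
    qed
    ultimately show ?thesis unfolding I C by simp
  qed
  then show "integrable M (\<lambda>\<omega>. (Y \<omega>)\<^sup>2)"
    "(CLINT \<omega>|M. iexp (Y \<omega>)) = complex_of_real (exp (- (LINT \<omega>|M. (Y \<omega>)\<^sup>2) / 2))" by auto
qed

lemma centered_gaussian_process_sum:
  assumes "centered_gaussian_process M I X K" "finite J" "J \<subseteq> I"
  shows "gaussian_rv M (\<lambda>\<omega>. \<Sum>j\<in>J. a j * X j \<omega>)"
  using assms by (simp add: centered_gaussian_process_def)

lemma centered_gaussian_process_rv:
  assumes "centered_gaussian_process M I X K" "i \<in> I"
  shows "gaussian_rv M (X i)"
  using centered_gaussian_process_sum[OF assms(1), of "{i}" "\<lambda>_. 1"] assms(2) by simp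

text \<open>A linear combination is again a centered Gaussian variable, so its variance determines
  it, and that variance is the quadratic form of the covariance \<open>K\<close>.\<close>

lemma centered_gaussian_process_char_fun:
  assumes X: "centered_gaussian_process M I X K" and J: "finite J" "J \<subseteq> I"
  shows "(CLINT \<omega>|M. iexp (\<Sum>j\<in>J. a j * X j \<omega>)) = complex_of_real (exp (- (\<Sum>i\<in>J. \<Sum>j\<in>J. a i * a j * K i j) / 2))"
proof -
  interpret prob_space M using X by (simp add: centered_gaussian_process_def)
  have m: "\<And>i. i \<in> I \<Longrightarrow> (LINT \<omega>|M. X i \<omega>) = 0"
    and K: "\<And>i j. i \<in> I \<Longrightarrow> j \<in> I \<Longrightarrow> (LINT \<omega>|M. X i \<omega> * X j \<omega>) = K i j"
    using X by (auto simp: centered_gaussian_process_def)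
  note gJ = centered_gaussian_process_sum[OF X J]
  note g = centered_gaussian_process_rv[OF X]
  have meas: "X i \<in> borel_measurable M" if "i \<in> I" for i
    using g[OF that] by (simp add: gaussian_rv_def)
  \<comment> \<open>The definition of a process gives the values of means and covariances but not
    their integrability; that comes from the Gaussian law of each single variable.\<close>
  have sq: "integrable M (\<lambda>\<omega>. (X i \<omega>)\<^sup>2)" if "i \<in> I" for i
    using gaussian_rv_square_integrable[OF prob_space_axioms g m] that by blast
  have int: "integrable M (X i)" if "i \<in> I" for i
    using square_integrable_imp_integrable[OF meas sq] that by blast
  have prod: "integrable M (\<lambda>\<omega>. X i \<omega> * X j \<omega>)" if "i \<in> I" "j \<in> I" for i j
  proof (rule Bochner_Integration.integrable_bound)
    show "integrable M (\<lambda>\<omega>. (X i \<omega>)\<^sup>2 + (X j \<omega>)\<^sup>2)" using sq that by simp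
    show "(\<lambda>\<omega>. X i \<omega> * X j \<omega>) \<in> borel_measurable M" using meas that by simp
    have "\<bar>x * y\<bar> \<le> \<bar>x\<^sup>2 + y\<^sup>2\<bar>" for x y :: real
      using sum_squares_bound[of "\<bar>x\<bar>" "\<bar>y\<bar>"] mult_nonneg_nonneg[of "\<bar>x\<bar>" "\<bar>y\<bar>"]
      by (simp add: abs_mult del: mult_nonneg_nonneg zero_le_mult_iff)
    then show "AE \<omega> in M. norm (X i \<omega> * X j \<omega>) \<le> norm ((X i \<omega>)\<^sup>2 + (X j \<omega>)\<^sup>2)" by simp
  qed
  have "(LINT \<omega>|M. (\<Sum>j\<in>J. a j * X j \<omega>)) = (\<Sum>j\<in>J. a j * (LINT \<omega>|M. X j \<omega>))"
    using int J by (subst Bochner_Integration.integral_sum) auto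
  also have "\<dots> = 0" using m J by (intro sum.neutral) auto
  finally have mean: "(LINT \<omega>|M. (\<Sum>j\<in>J. a j * X j \<omega>)) = 0" .
  have "(LINT \<omega>|M. (\<Sum>j\<in>J. a j * X j \<omega>)\<^sup>2) = (LINT \<omega>|M. (\<Sum>i\<in>J. \<Sum>j\<in>J. a i * a j * (X i \<omega> * X j \<omega>)))"
    unfolding power2_eq_square sum_product
    by (intro Bochner_Integration.integral_cong sum.cong refl) (simp only: mult_ac)
  also have "\<dots> = (\<Sum>i\<in>J. \<Sum>j\<in>J. a i * a j * (LINT \<omega>|M. X i \<omega> * X j \<omega>))"
    using prod J by (subst Bochner_Integration.integral_sum, force intro!: Bochner_Integration.integrable_sum)
      (intro sum.cong refl, subst Bochner_Integration.integral_sum, auto)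
  also have "\<dots> = (\<Sum>i\<in>J. \<Sum>j\<in>J. a i * a j * K i j)"
    using K J by (intro sum.cong refl) (auto simp: subset_iff)
  finally show ?thesis
    unfolding gaussian_rv_char_fun[OF prob_space_axioms gJ mean] by simp
qed

theorem centered_gaussian_processes_same_fin_dim_distributions:
  fixes X :: "'i \<Rightarrow> 'v \<Rightarrow> real" and Y :: "'i \<Rightarrow> 'w \<Rightarrow> real"
  assumes X: "centered_gaussian_process M UNIV X K" and Y: "centered_gaussian_process N UNIV Y K"
  shows "same_fin_dim_distributions M X N Y"
  unfolding same_fin_dim_distributions_def
proof (intro conjI allI impI)
  have meas: "Z i \<in> borel_measurable L" if "centered_gaussian_process L UNIV Z K" for L Z i
    using centered_gaussian_process_rv[OF that, of i] by (simp add: gaussian_rv_def)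
  show mX: "X i \<in> borel_measurable M" and mY: "Y i \<in> borel_measurable N" for i
    by (rule meas[OF X] meas[OF Y])+
  fix J :: "'i set" assume J: "finite J"
  have char: "(CLINT x|distr L (PiM J (\<lambda>_. borel)) (\<lambda>\<omega>. \<lambda>j\<in>J. Z j \<omega>). iexp (\<Sum>j\<in>J. t j * x j))
      = complex_of_real (exp (- (\<Sum>i\<in>J. \<Sum>j\<in>J. t i * t j * K i j) / 2))"
    if Z: "centered_gaussian_process L UNIV Z K" for L Z t
  proof -
    have [measurable]: "Z i \<in> borel_measurable L" for i by (rule meas[OF Z])
    have "(CLINT x|distr L (PiM J (\<lambda>_. borel)) (\<lambda>\<omega>. \<lambda>j\<in>J. Z j \<omega>). iexp (\<Sum>j\<in>J. t j * x j))
      = (CLINT \<omega>|L. iexp (\<Sum>j\<in>J. t j * Z j \<omega>))"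
    proof -
      have eq: "(\<Sum>j\<in>J. t j * (\<lambda>j\<in>J. Z j \<omega>) j) = (\<Sum>j\<in>J. t j * Z j \<omega>)" for \<omega>
        by (rule sum.cong) auto
      have 1: "(\<lambda>\<omega>. \<lambda>j\<in>J. Z j \<omega>) \<in> L \<rightarrow>\<^sub>M PiM J (\<lambda>_. borel)"
        and 2: "(\<lambda>x. iexp (\<Sum>j\<in>J. t j * x j)) \<in> borel_measurable (PiM J (\<lambda>_. borel))"
        by measurable
      show ?thesis unfolding integral_distr[OF 1 2] eq ..
    qed
    then show ?thesis using centered_gaussian_process_char_fun[OF Z J] by simp
  qed
  have fin: "finite_measure (distr L (PiM J (\<lambda>_. borel)) (\<lambda>\<omega>. \<lambda>j\<in>J. Z j \<omega>))"
    if Z: "centered_gaussian_process L UNIV Z K" for L Z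
  proof -
    interpret prob_space L using Z by (simp add: centered_gaussian_process_def)
    have [measurable]: "Z i \<in> borel_measurable L" for i by (rule meas[OF Z])
    show ?thesis by (rule finite_measure_distr) measurable
  qed
  show "distr M (PiM J (\<lambda>_. borel)) (\<lambda>\<omega>. \<lambda>j\<in>J. X j \<omega>) = distr N (PiM J (\<lambda>_. borel)) (\<lambda>\<omega>. \<lambda>j\<in>J. Y j \<omega>)"
    by (rule char_fun_unique_PiM[OF J fin[OF X] sets_distr fin[OF Y] sets_distr])
      (rule trans[OF char[OF X] char[OF Y, symmetric]])
qed

lemma centered_gaussian_process_reindex:
  assumes X: "centered_gaussian_process M I X K" and g: "\<And>x. x \<in> A \<Longrightarrow> g x \<in> I"
  shows "centered_gaussian_process M A (\<lambda>x. X (g x)) (\<lambda>x y. K (g x) (g y))"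
  unfolding centered_gaussian_process_def
proof (intro conjI allI impI ballI)
  show "prob_space M" using X by (simp add: centered_gaussian_process_def)
  fix J a assume J: "finite J" "J \<subseteq> A"
  \<comment> \<open>The map \<open>g\<close> need not be injective, so the coefficients of all
    indices with the same image are added up before the hypothesis on \<open>X\<close>
    applies.\<close>
  have "gaussian_rv M (\<lambda>\<omega>. \<Sum>i\<in>g ` J. (\<Sum>x\<in>{x \<in> J. g x = i}. a x) * X i \<omega>)"
    by (rule centered_gaussian_process_sum[OF X]) (use J g in auto)
  also have "(\<lambda>\<omega>. \<Sum>i\<in>g ` J. (\<Sum>x\<in>{x \<in> J. g x = i}. a x) * X i \<omega>) = (\<lambda>\<omega>. \<Sum>x\<in>J. a x * X (g x) \<omega>)"
    by (subst sum.image_gen[OF J(1), of _ g]) (auto simp: sum_distrib_right intro!: sum.cong)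
  finally show "gaussian_rv M (\<lambda>\<omega>. \<Sum>x\<in>J. a x * X (g x) \<omega>)" .
qed (use X g in \<open>auto simp: centered_gaussian_process_def\<close>)

lemma centered_gaussian_process_scale:
  assumes X: "centered_gaussian_process M I X K"
  shows "centered_gaussian_process M I (\<lambda>x \<omega>. c * X x \<omega>) (\<lambda>x y. c\<^sup>2 * K x y)"
  unfolding centered_gaussian_process_def
proof (intro conjI allI impI ballI)
  show "prob_space M" using X by (simp add: centered_gaussian_process_def)
  fix J a assume J: "finite J" "J \<subseteq> I"
  have "gaussian_rv M (\<lambda>\<omega>. \<Sum>x\<in>J. (a x * c) * X x \<omega>)"
    by (rule centered_gaussian_process_sum[OF X J])
  then show "gaussian_rv M (\<lambda>\<omega>. \<Sum>x\<in>J. a x * (c * X x \<omega>))" by (simp only: mult.assoc)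
next
  fix x y assume "x \<in> I" "y \<in> I"
  then have "(LINT \<omega>|M. c\<^sup>2 * (X x \<omega> * X y \<omega>)) = c\<^sup>2 * K x y"
    using X unfolding centered_gaussian_process_def by simp
  then show "(LINT \<omega>|M. c * X x \<omega> * (c * X y \<omega>)) = c\<^sup>2 * K x y"
    by (simp add: power2_eq_square mult_ac)
qed (use X in \<open>auto simp: centered_gaussian_process_def\<close>)

section \<open>Radial power functions\<close>

lemma integrable_powr_bounds:
  fixes g :: "real \<Rightarrow> 'b::{banach, second_countable_topology}"
  assumes [measurable]: "g \<in> borel_measurable borel"
    and \<alpha>: "\<alpha> > -1" and \<beta>: "\<beta> < -1"
    and zero: "\<And>t. t \<le> 0 \<Longrightarrow> g t = 0"
    and small: "\<And>t. 0 < t \<Longrightarrow> t \<le> 1 \<Longrightarrow> norm (g t) \<le> C * t powr \<alpha>"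
    and large: "\<And>t. 1 \<le> t \<Longrightarrow> norm (g t) \<le> C * t powr \<beta>"
  shows "integrable lborel g"
proof (rule integrableI_bounded)
  have C: "0 \<le> C" using small[of 1] norm_ge_zero[of "g 1"] by (auto simp del: norm_ge_zero)
  have "(\<integral>\<^sup>+t. ennreal (norm (g t)) \<partial>lborel)
      \<le> (\<integral>\<^sup>+t. ennreal C * (ennreal (t powr \<alpha>) * indicator {0..1} t) + ennreal C * (ennreal (t powr \<beta>) * indicator {1..} t) \<partial>lborel)"
  proof (rule nn_integral_mono)
    fix t :: real
    show "ennreal (norm (g t)) \<le> ennreal C * (ennreal (t powr \<alpha>) * indicator {0..1} t) + ennreal C * (ennreal (t powr \<beta>) * indicator {1..} t)"
      using zero[of t] small[of t] large[of t] C
      by (cases "t \<le> 0"; cases "t \<le> 1"; cases "1 \<le> t")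
         (auto simp: indicator_def ennreal_mult[symmetric] ennreal_plus[symmetric] simp del: ennreal_plus intro!: ennreal_leI intro: order_trans add_increasing2)
  qed
  also have "\<dots> = ennreal C * (\<integral>\<^sup>+t. ennreal (t powr \<alpha>) * indicator {0..1} t \<partial>lborel) + ennreal C * (\<integral>\<^sup>+t. ennreal (t powr \<beta>) * indicator {1..} t \<partial>lborel)"
    by (simp add: nn_integral_add nn_integral_cmult)
  also have "\<dots> < \<infinity>"
    using nn_integral_has_integral_lebesgue'[OF _ has_integral_powr_from_0[OF \<alpha>, of 1]]
      nn_integral_has_integral_lebesgue'[OF _ has_integral_powr_to_inf[OF \<beta>, of 1]]
    by (simp add: ennreal_mult_less_top)
  finally show "(\<integral>\<^sup>+t. ennreal (norm (g t)) \<partial>lborel) < \<infinity>" .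
qed simp

text \<open>Euler's integral for Gamma, rescaled by t \<mapsto> r t. With r = |\<xi>|^2 and q = s/2
  it is the representation of |\<xi>|^(-s) by Gaussians on which the whole computation
  rests.\<close>

lemma gamma_subordination:
  fixes q r :: real
  assumes q: "q > 0" and r: "r > 0"
  shows "has_bochner_integral lborel (\<lambda>t. indicator {0<..} t * t powr (q - 1) * exp (- r * t)) (Gamma q * r powr (- q))"
proof -
  let ?f = "\<lambda>t::real. indicator {0<..} t * t powr (q - 1) * exp (- t)"
  have "(\<integral>\<^sup>+t. ennreal (?f t) \<partial>lborel) = (\<integral>\<^sup>+t. ennreal (t powr (q - 1) / exp t) * indicator {0..} t \<partial>lborel)"
    by (intro nn_integral_cong) (auto simp: indicator_def exp_minus field_simps)
  also have "\<dots> = ennreal (Gamma q)"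
    by (rule nn_integral_has_integral_lebesgue') (use Gamma_integral_real[OF q] in auto)
  finally have "has_bochner_integral lborel ?f (Gamma q)"
    by (intro has_bochner_integral_nn_integral) (use Gamma_real_pos[OF q] in auto)
  then have "has_bochner_integral lborel (\<lambda>t. ?f (0 + r * t)) (Gamma q /\<^sub>R \<bar>r\<bar>)"
    by (subst lborel_has_bochner_integral_real_affine_iff[symmetric]) (use r in auto)
  then have "has_bochner_integral lborel (\<lambda>t. r powr (1 - q) * ?f (0 + r * t)) (r powr (1 - q) * (Gamma q /\<^sub>R \<bar>r\<bar>))"
    by (rule has_bochner_integral_mult_right)
  moreover have "r powr (1 - q) * ?f (0 + r * t) = indicator {0<..} t * t powr (q - 1) * exp (- r * t)" for t
    using r by (auto simp: indicator_def zero_less_mult_iff powr_mult powr_add[symmetric])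
  moreover have "r powr (1 - q) * (Gamma q /\<^sub>R \<bar>r\<bar>) = Gamma q * r powr (- q)"
    using r by (simp add: powr_diff powr_minus field_simps)
  ultimately show ?thesis by (simp only:)
qed

lemma nn_gamma_subordination:
  fixes q r :: real
  assumes q: "q > 0" and r: "r > 0"
  shows "(\<integral>\<^sup>+t. ennreal (indicator {0<..} t * t powr (q - 1) * exp (- r * t)) \<partial>lborel) = ennreal (Gamma q * r powr (- q))"
  using gamma_subordination[OF assms]
  by (subst nn_integral_eq_integral) (auto simp: has_bochner_integral_iff)

lemma gaussian_integral:
  assumes "a > 0"
  shows "has_bochner_integral lborel (\<lambda>x::'a::euclidean_space. exp (- a * (norm x)\<^sup>2)) ((pi / a) powr (DIM('a) / 2))"
proof -
  have "has_bochner_integral lborel (\<lambda>x::'a. complex_of_real (exp (- a * (norm x)\<^sup>2))) (complex_of_real ((pi / a) powr (DIM('a) / 2)))"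
    using gaussian_fourier[OF assms, of "0::'a"] by simp
  then show ?thesis
    by (simp only: has_bochner_integral_iff complex_of_real_integrable_eq integral_complex_of_real of_real_eq_iff)
qed

lemma nn_gaussian_integral:
  assumes "a > 0"
  shows "(\<integral>\<^sup>+x. ennreal (exp (- a * (norm (x::'a::euclidean_space))\<^sup>2)) \<partial>lborel) = ennreal ((pi / a) powr (DIM('a) / 2))"
  using gaussian_integral[OF assms, where 'a='a]
  by (subst nn_integral_eq_integral) (auto simp: has_bochner_integral_iff)

text \<open>Subordination takes the place of polar coordinates. Writing |x|^(-p) as an integral of
  Gaussians and integrating over x first leaves t^(p/2-1) (pi/(t+1))^(d/2), which is integrable at 0
  because p > 0 and at infinity because p < d.\<close>

lemma integrable_norm_powr_gaussian:
  fixes p :: real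
  assumes p: "0 < p" "p < DIM('a)"
  shows "integrable lborel (\<lambda>x::'a::euclidean_space. norm x powr (- p) * exp (- (norm x)\<^sup>2))"
proof (rule integrableI_bounded)
  let ?G = "\<lambda>(x::'a) t. ennreal (indicator {0<..} t * t powr (p / 2 - 1) * exp (- (t + 1) * (norm x)\<^sup>2))"
  have "(\<integral>\<^sup>+x. ennreal (norm (norm x powr (- p) * exp (- (norm x)\<^sup>2))) \<partial>(lborel :: 'a measure)) \<le>
    (\<integral>\<^sup>+x. ennreal (1 / Gamma (p / 2)) * (\<integral>\<^sup>+t. ?G x t \<partial>lborel) \<partial>lborel)"
  proof (rule nn_integral_mono)
    \<comment> \<open>Only an inequality is claimed: at x = 0 the left side is 0, since
      \<open>0 powr r\<close> is 0, whereas the t-integral diverges.\<close>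
    fix x :: 'a
    show "ennreal (norm (norm x powr (- p) * exp (- (norm x)\<^sup>2))) \<le> ennreal (1 / Gamma (p / 2)) * (\<integral>\<^sup>+t. ?G x t \<partial>lborel)"
    proof (cases "x = 0")
      case False
      then have pos: "(norm x)\<^sup>2 > 0" by simp
      have "(\<integral>\<^sup>+t. ?G x t \<partial>lborel) = (\<integral>\<^sup>+t. ennreal (exp (- (norm x)\<^sup>2)) * ennreal (indicator {0<..} t * t powr (p / 2 - 1) * exp (- (norm x)\<^sup>2 * t)) \<partial>lborel)"
        by (intro nn_integral_cong) (simp add: ennreal_mult[symmetric] exp_add[symmetric] algebra_simps)
      also have "\<dots> = ennreal (exp (- (norm x)\<^sup>2)) * ennreal (Gamma (p / 2) * (norm x)\<^sup>2 powr (- (p / 2)))"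
        using nn_gamma_subordination[OF _ pos, of "p / 2"] p by (subst nn_integral_cmult) auto
      also have "(norm x)\<^sup>2 powr (- (p / 2)) = norm x powr (- p)"
        using False by (simp add: powr_powr flip: powr_numeral)
      finally show ?thesis
        using less_imp_neq[OF Gamma_real_pos[of "p / 2"]] p by (simp add: ennreal_mult[symmetric] mult_ac)
    qed simp
  qed
  also have "\<dots> = ennreal (1 / Gamma (p / 2)) * (\<integral>\<^sup>+t. (\<integral>\<^sup>+x. ?G x t \<partial>lborel) \<partial>lborel)"
    by (subst nn_integral_cmult, measurable, subst lborel_pair.Fubini') auto
  also have "(\<integral>\<^sup>+t. (\<integral>\<^sup>+x. ?G x t \<partial>lborel) \<partial>lborel) = (\<integral>\<^sup>+t. ennreal (indicator {0<..} t * t powr (p / 2 - 1) * (pi / (t + 1)) powr (DIM('a) / 2)) \<partial>lborel)"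
  proof (rule nn_integral_cong)
    fix t :: real
    show "(\<integral>\<^sup>+x. ?G x t \<partial>lborel) = ennreal (indicator {0<..} t * t powr (p / 2 - 1) * (pi / (t + 1)) powr (DIM('a) / 2))"
      using nn_gaussian_integral[of "t + 1", where 'a='a]
      by (cases "t > 0") (auto simp: ennreal_mult nn_integral_cmult)
  qed
  also have "ennreal (1 / Gamma (p / 2)) * \<dots> < \<infinity>"
  proof -
    have "integrable lborel (\<lambda>t. indicator {0<..} t * t powr (p / 2 - 1) * (pi / (t + 1)) powr (DIM('a) / 2))"
    proof (rule integrable_powr_bounds)
      show "- 1 < p / 2 - 1" "p / 2 - 1 - DIM('a) / 2 < - 1" using p by auto
      fix t :: real
      show "norm (indicator {0<..} t * t powr (p / 2 - 1) * (pi / (t + 1)) powr (DIM('a) / 2)) \<le> pi powr (DIM('a) / 2) * t powr (p / 2 - 1)"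
        if "0 < t" "t \<le> 1"
      proof -
        have "(pi / (t + 1)) powr (DIM('a) / 2) \<le> pi powr (DIM('a) / 2)"
          using that by (intro powr_mono2) (auto simp: field_simps)
        then show ?thesis using that by (simp add: mult.commute mult_left_mono)
      qed
      show "norm (indicator {0<..} t * t powr (p / 2 - 1) * (pi / (t + 1)) powr (DIM('a) / 2)) \<le> pi powr (DIM('a) / 2) * t powr (p / 2 - 1 - DIM('a) / 2)"
        if "1 \<le> t"
      proof -
        have "(pi / (t + 1)) powr (DIM('a) / 2) \<le> (pi / t) powr (DIM('a) / 2)"
          using that by (intro powr_mono2) (auto simp: field_simps)
        then have "t powr (p / 2 - 1) * (pi / (t + 1)) powr (DIM('a) / 2) \<le> t powr (p / 2 - 1) * (pi / t) powr (DIM('a) / 2)"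
          by (rule mult_left_mono) simp
        also have "\<dots> = pi powr (DIM('a) / 2) * t powr (p / 2 - 1 - DIM('a) / 2)"
          using that by (simp add: powr_divide powr_diff)
        finally show ?thesis using that by simp
      qed
    qed auto
    then have "(\<integral>\<^sup>+t. ennreal (indicator {0<..} t * t powr (p / 2 - 1) * (pi / (t + 1)) powr (DIM('a) / 2)) \<partial>lborel) < \<infinity>"
      by (simp add: integrable_iff_bounded abs_mult)
    then show ?thesis by (simp add: ennreal_mult_less_top)
  qed
  finally show "(\<integral>\<^sup>+x. ennreal (norm (norm x powr (- p) * exp (- (norm x)\<^sup>2))) \<partial>(lborel :: 'a measure)) < \<infinity>" .
qed simp

text \<open>The counterpart at infinity, by the same device: after the x-integration what remains is
  the Gamma integral with parameter (p - d)/2, which converges because p > d.\<close>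

lemma integrable_one_plus_norm_powr:
  fixes p :: real
  assumes p: "DIM('a) < p"
  shows "integrable lborel (\<lambda>x::'a::euclidean_space. (1 + (norm x)\<^sup>2) powr (- p / 2))"
proof (rule integrableI_bounded)
  have p': "p > 0" using p of_nat_0_le_iff[of "DIM('a)"] by linarith
  let ?G = "\<lambda>(x::'a) t. ennreal (indicator {0<..} t * t powr (p / 2 - 1) * exp (- (1 + (norm x)\<^sup>2) * t))"
  have "(\<integral>\<^sup>+x. ennreal (norm ((1 + (norm x)\<^sup>2) powr (- p / 2))) \<partial>(lborel :: 'a measure)) =
    (\<integral>\<^sup>+x. ennreal (1 / Gamma (p / 2)) * (\<integral>\<^sup>+t. ?G x t \<partial>lborel) \<partial>lborel)"
  proof (rule nn_integral_cong)
    fix x :: 'a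
    have "1 + (norm x)\<^sup>2 > 0" by (simp add: add_pos_nonneg)
    from nn_gamma_subordination[OF _ this, of "p / 2"] p'
    show "ennreal (norm ((1 + (norm x)\<^sup>2) powr (- p / 2))) = ennreal (1 / Gamma (p / 2)) * (\<integral>\<^sup>+t. ?G x t \<partial>lborel)"
      using less_imp_neq[OF Gamma_real_pos[of "p / 2"]] p' by (simp add: ennreal_mult[symmetric])
  qed
  also have "\<dots> = ennreal (1 / Gamma (p / 2)) * (\<integral>\<^sup>+t. (\<integral>\<^sup>+x. ?G x t \<partial>lborel) \<partial>lborel)"
    by (subst nn_integral_cmult, measurable, subst lborel_pair.Fubini') auto
  also have "(\<integral>\<^sup>+t. (\<integral>\<^sup>+x. ?G x t \<partial>lborel) \<partial>lborel) = (\<integral>\<^sup>+t. ennreal (pi powr (DIM('a) / 2)) * ennreal (indicator {0<..} t * t powr ((p - DIM('a)) / 2 - 1) * exp (- 1 * t)) \<partial>lborel)"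
  proof (rule nn_integral_cong)
    fix t :: real
    show "(\<integral>\<^sup>+x. ?G x t \<partial>lborel) = ennreal (pi powr (DIM('a) / 2)) * ennreal (indicator {0<..} t * t powr ((p - DIM('a)) / 2 - 1) * exp (- 1 * t))"
    proof (cases "t > 0")
      case True
      have "(\<integral>\<^sup>+x. ?G x t \<partial>lborel) = (\<integral>\<^sup>+x. ennreal (t powr (p / 2 - 1) * exp (- t)) * ennreal (exp (- t * (norm (x::'a))\<^sup>2)) \<partial>lborel)"
        using True by (intro nn_integral_cong) (simp add: ennreal_mult[symmetric] exp_add[symmetric] algebra_simps)
      also have "\<dots> = ennreal (t powr (p / 2 - 1) * exp (- t)) * ennreal ((pi / t) powr (DIM('a) / 2))"
        using nn_gaussian_integral[OF True, where 'a='a] by (subst nn_integral_cmult) auto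
      also have "\<dots> = ennreal (pi powr (DIM('a) / 2) * (t powr ((p - DIM('a)) / 2 - 1) * exp (- t)))"
      proof -
        have e: "(p - DIM('a)) / 2 - 1 = (p / 2 - 1) - DIM('a) / 2" by (simp add: diff_divide_distrib)
        show ?thesis unfolding e using True by (simp add: ennreal_mult[symmetric] powr_divide powr_diff[of t "p / 2 - 1"])
      qed
      finally show ?thesis using True by (simp add: ennreal_mult)
    qed simp
  qed
  also have "\<dots> = ennreal (pi powr (DIM('a) / 2)) * ennreal (Gamma ((p - DIM('a)) / 2) * 1 powr (- ((p - DIM('a)) / 2)))"
    using p by (subst nn_integral_cmult, measurable, subst nn_gamma_subordination) auto
  also have "ennreal (1 / Gamma (p / 2)) * \<dots> < \<infinity>"
    by (simp add: ennreal_mult_less_top)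
  finally show "(\<integral>\<^sup>+x. ennreal (norm ((1 + (norm x)\<^sup>2) powr (- p / 2))) \<partial>(lborel :: 'a measure)) < \<infinity>" .
qed simp

text \<open>The two model weights above, one singular at the origin and one decaying at infinity,
  together dominate \<open>f\<close>. This is the integrability test for all functions on the space
  that are compared with powers of the norm.\<close>

theorem integrable_radial_bounds:
  fixes f :: "'a::euclidean_space \<Rightarrow> 'b::{banach, second_countable_topology}" and p q \<rho> :: real
  assumes [measurable]: "f \<in> borel_measurable borel"
    and pq: "0 < p" "p < DIM('a)" "DIM('a) < q" and \<rho>: "\<rho> > 0"
    and near: "\<And>x. x \<noteq> 0 \<Longrightarrow> norm x \<le> \<rho> \<Longrightarrow> norm (f x) \<le> C * norm x powr (- p)"
    and far: "\<And>x. norm x \<ge> \<rho> \<Longrightarrow> norm (f x) \<le> D * norm x powr (- q)"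
  shows "integrable lborel f"
proof (rule Bochner_Integration.integrable_bound)
  \<comment> \<open>On |x| \<le> \<rho> the factor exp(\<rho>^2) compensates the Gaussian. The other
    factor comes from 1 + |x|^2 \<le> (1 + 1/\<rho>^2) |x|^2, valid on |x| \<ge> \<rho>.\<close>
  let ?w = "\<lambda>x::'a. \<bar>C\<bar> * exp (\<rho>\<^sup>2) * (norm x powr (- p) * exp (- (norm x)\<^sup>2)) + \<bar>D\<bar> * (1 + 1 / \<rho>\<^sup>2) powr (q / 2) * (1 + (norm x)\<^sup>2) powr (- q / 2)"
  show "integrable lborel ?w"
    using pq by (intro Bochner_Integration.integrable_add integrable_mult_right integrable_norm_powr_gaussian integrable_one_plus_norm_powr) auto
  show "AE x in lborel. norm (f x) \<le> norm (?w x)"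
    using AE_lborel_singleton[of 0]
  proof eventually_elim
    case (elim x)
    have "norm (f x) \<le> ?w x"
    proof (cases "norm x \<le> \<rho>")
      case True
      have "norm (f x) \<le> C * norm x powr (- p)" using near True elim by auto
      also have "\<dots> \<le> \<bar>C\<bar> * norm x powr (- p)" by (intro mult_right_mono) auto
      also have "\<dots> \<le> \<bar>C\<bar> * norm x powr (- p) * (exp (\<rho>\<^sup>2) * exp (- (norm x)\<^sup>2))"
      proof -
        have "1 \<le> exp (\<rho>\<^sup>2 - (norm x)\<^sup>2)"
          using True by (simp add: power_mono)
        then have "\<bar>C\<bar> * norm x powr (- p) * 1 \<le> \<bar>C\<bar> * norm x powr (- p) * exp (\<rho>\<^sup>2 - (norm x)\<^sup>2)"
          by (intro mult_left_mono) auto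
        then show ?thesis by (simp add: exp_diff exp_minus divide_inverse)
      qed
      also have "\<dots> \<le> ?w x" by (simp add: mult_ac)
      finally show ?thesis .
    next
      case False
      then have x: "norm x \<ge> \<rho>" "norm x > 0" using \<rho> by auto
      have "norm (f x) \<le> D * norm x powr (- q)" using far x by auto
      also have "\<dots> \<le> \<bar>D\<bar> * norm x powr (- q)" by (intro mult_right_mono) auto
      also have "norm x powr (- q) = ((1 + 1 / \<rho>\<^sup>2) * (norm x)\<^sup>2) powr (- q / 2) * (1 + 1 / \<rho>\<^sup>2) powr (q / 2)"
      proof -
        have "1 + 1 / \<rho>\<^sup>2 > 0" by (simp add: add_pos_nonneg)
        moreover have "(norm x)\<^sup>2 powr (- q / 2) = norm x powr (- q)"
          using x by (simp add: powr_powr flip: powr_numeral)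
        ultimately show ?thesis
          by (simp add: powr_mult powr_minus)
      qed
      also have "\<dots> \<le> (1 + (norm x)\<^sup>2) powr (- q / 2) * (1 + 1 / \<rho>\<^sup>2) powr (q / 2)"
      proof -
        have "1 \<le> (norm x)\<^sup>2 / \<rho>\<^sup>2" using x \<rho> by (simp add: power_mono)
        then have "1 + (norm x)\<^sup>2 \<le> (1 + 1 / \<rho>\<^sup>2) * (norm x)\<^sup>2" by (simp add: algebra_simps)
        then have "((1 + 1 / \<rho>\<^sup>2) * (norm x)\<^sup>2) powr (- q / 2) \<le> (1 + (norm x)\<^sup>2) powr (- q / 2)"
          using pq by (intro powr_mono2') (auto simp: add_pos_nonneg)
        then show ?thesis by (rule mult_right_mono) simp
      qed
      finally have "norm (f x) \<le> \<bar>D\<bar> * ((1 + (norm x)\<^sup>2) powr (- q / 2) * (1 + 1 / \<rho>\<^sup>2) powr (q / 2))"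
        by (simp add: mult_left_mono)
      also have "\<dots> \<le> ?w x" by (simp add: mult_ac)
      finally show ?thesis .
    qed
    then show "norm (f x) \<le> norm (?w x)" by simp
  qed
qed simp

section \<open>Schwartz functions\<close>

lemma iterated_partial_bounded_linear:
  assumes L: "bounded_linear L" and f: "\<And>js x. iterated_partial js f differentiable (at x)"
  shows "iterated_partial is (\<lambda>x. L (f x)) = (\<lambda>x. L (iterated_partial is f x))"
proof (induction "is")
  case (Cons i "is")
  have "frechet_derivative (\<lambda>y. L (iterated_partial is f y)) (at x) = (\<lambda>v. L (frechet_derivative (iterated_partial is f) (at x) v))" for x
    by (rule frechet_derivative_at[symmetric], rule bounded_linear.has_derivative[OF L])
       (use f in \<open>simp add: frechet_derivative_works\<close>)
  with Cons show ?case by simp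
qed simp

text \<open>Meant for the real part: Gaussian test functions are built complex-valued, while the
  spaces of Schwartz functions with vanishing moments are real.\<close>

lemma schwartz_bounded_linear:
  assumes L: "bounded_linear L" and f: "f \<in> schwartz"
  shows "(\<lambda>x. L (f x)) \<in> schwartz"
proof -
  interpret bounded_linear L by fact
  have d: "\<And>is x. iterated_partial is f differentiable (at x)"
    and b: "\<And>is k. bounded (range (\<lambda>x. norm x ^ k *\<^sub>R iterated_partial is f x))"
    using f by (auto simp: schwartz_def)
  have 1: "(\<lambda>x. L (iterated_partial is f x)) differentiable (at x)" for "is" x
    using d[of "is" x] bounded_linear.has_derivative[OF L] by (auto simp: differentiable_def)
  have 2: "bounded (range (\<lambda>x. norm x ^ k *\<^sub>R L (iterated_partial is f x)))" for k "is"
  proof -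
    have "range (\<lambda>x. norm x ^ k *\<^sub>R L (iterated_partial is f x)) = L ` range (\<lambda>x. norm x ^ k *\<^sub>R iterated_partial is f x)"
      by (auto simp: image_image scaleR)
    then show ?thesis using bounded_linear_image[OF b L] by simp
  qed
  show ?thesis
    unfolding schwartz_def mem_Collect_eq iterated_partial_bounded_linear[OF L d]
    using 1 2 by auto
qed

text \<open>A class of concrete Schwartz functions that contains its own partial derivatives, which
  is why multiplication by coordinates is included. The parameter \<open>b\<close> accounts for
  translated Gaussians, \<open>t\<close> for modulated ones.\<close>

inductive_set gaussian_polys :: "(real ^ 'n \<Rightarrow> complex) set" where
  exp: "a > 0 \<Longrightarrow> (\<lambda>x. exp (complex_of_real (- a * (norm x)\<^sup>2 + b \<bullet> x) + \<i> * complex_of_real (t \<bullet> x))) \<in> gaussian_polys"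
| coord: "f \<in> gaussian_polys \<Longrightarrow> (\<lambda>x. complex_of_real (x $ i) * f x) \<in> gaussian_polys"
| scale: "f \<in> gaussian_polys \<Longrightarrow> (\<lambda>x. c * f x) \<in> gaussian_polys"
| add: "f \<in> gaussian_polys \<Longrightarrow> g \<in> gaussian_polys \<Longrightarrow> (\<lambda>x. f x + g x) \<in> gaussian_polys"

lemma gaussian_polys_has_derivative:
  fixes f :: "real ^ 'n::finite \<Rightarrow> complex"
  assumes "f \<in> gaussian_polys"
  shows "\<exists>D. (\<forall>x. (f has_derivative D x) (at x)) \<and> (\<forall>i. (\<lambda>x. D x (axis i 1)) \<in> gaussian_polys)"
  using assms
proof induction
  case (exp a b t)
  let ?f = "\<lambda>x. exp (complex_of_real (- a * (norm x)\<^sup>2 + b \<bullet> x) + \<i> * complex_of_real (t \<bullet> x))"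
  let ?D = "\<lambda>x h. ?f x * (complex_of_real (- (2 * a) * (x \<bullet> h) + b \<bullet> h) + \<i> * complex_of_real (t \<bullet> h))"
  have "(?f has_derivative ?D x) (at x)" for x
  proof -
    have "((\<lambda>x. - a * (norm x)\<^sup>2 + b \<bullet> x) has_derivative (\<lambda>h. - (2 * a) * (x \<bullet> h) + b \<bullet> h)) (at x)"
      unfolding power2_norm_eq_inner by (auto intro!: derivative_eq_intros simp: inner_commute algebra_simps)
    moreover have "((\<lambda>x. t \<bullet> x) has_derivative (\<lambda>h. t \<bullet> h)) (at x)"
      by (auto intro!: derivative_eq_intros)
    ultimately have "((\<lambda>x. complex_of_real (- a * (norm x)\<^sup>2 + b \<bullet> x) + \<i> * complex_of_real (t \<bullet> x)) has_derivative
        (\<lambda>h. complex_of_real (- (2 * a) * (x \<bullet> h) + b \<bullet> h) + \<i> * complex_of_real (t \<bullet> h))) (at x)"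
      by (rule has_derivative_add[OF bounded_linear.has_derivative[OF bounded_linear_of_real]
            has_derivative_mult_right[OF bounded_linear.has_derivative[OF bounded_linear_of_real]]])
    from has_derivative_compose[OF this DERIV_exp[unfolded has_field_derivative_def]] show ?thesis .
  qed
  moreover have "(\<lambda>x. ?D x (axis i 1)) \<in> gaussian_polys" for i
  proof -
    have "(\<lambda>x. complex_of_real (- (2 * a)) * (complex_of_real (x $ i) * ?f x) + (complex_of_real (b $ i) + \<i> * complex_of_real (t $ i)) * ?f x) \<in> gaussian_polys"
      using exp by (intro gaussian_polys.intros)
    also have "(\<lambda>x. complex_of_real (- (2 * a)) * (complex_of_real (x $ i) * ?f x) + (complex_of_real (b $ i) + \<i> * complex_of_real (t $ i)) * ?f x) = (\<lambda>x. ?D x (axis i 1))"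
      by (simp add: inner_axis algebra_simps)
    finally show ?thesis .
  qed
  ultimately show ?case by (intro exI[of _ ?D]) simp
next
  case (coord f j)
  then obtain D where D: "\<And>x. (f has_derivative D x) (at x)" "\<And>i. (\<lambda>x. D x (axis i 1)) \<in> gaussian_polys" by blast
  let ?D = "\<lambda>x h. complex_of_real (x $ j) * D x h + complex_of_real (h $ j) * f x"
  have "((\<lambda>x. complex_of_real (x $ j) * f x) has_derivative ?D x) (at x)" for x
    by (rule has_derivative_mult[OF bounded_linear_imp_has_derivative D(1)])
       (intro bounded_linear_compose[OF bounded_linear_of_real] bounded_linear_vec_nth)
  moreover have "(\<lambda>x. ?D x (axis i 1)) \<in> gaussian_polys" for i
    using D(2) coord by (intro gaussian_polys.intros)
  ultimately show ?case by (intro exI[of _ ?D]) simp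
next
  case (scale f c)
  then obtain D where D: "\<And>x. (f has_derivative D x) (at x)" "\<And>i. (\<lambda>x. D x (axis i 1)) \<in> gaussian_polys" by blast
  have "((\<lambda>x. c * f x) has_derivative (\<lambda>h. c * D x h)) (at x)" for x
    by (rule has_derivative_mult_right[OF D(1)])
  with D(2) show ?case by (intro exI[of _ "\<lambda>x h. c * D x h"]) (auto intro: gaussian_polys.intros)
next
  case (add f g)
  then obtain D E where D: "\<And>x. (f has_derivative D x) (at x)" "\<And>i. (\<lambda>x. D x (axis i 1)) \<in> gaussian_polys"
    and E: "\<And>x. (g has_derivative E x) (at x)" "\<And>i. (\<lambda>x. E x (axis i 1)) \<in> gaussian_polys" by blast
  have "((\<lambda>x. f x + g x) has_derivative (\<lambda>h. D x h + E x h)) (at x)" for x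
    by (rule has_derivative_add[OF D(1) E(1)])
  with D(2) E(2) show ?case by (intro exI[of _ "\<lambda>x h. D x h + E x h"]) (auto intro: gaussian_polys.intros)
qed

lemma iterated_partial_gaussian_polys:
  fixes f :: "real ^ 'n::finite \<Rightarrow> complex"
  assumes "f \<in> gaussian_polys"
  shows "iterated_partial is f \<in> gaussian_polys"
proof (induction "is")
  case (Cons i "is")
  from gaussian_polys_has_derivative[OF this] obtain D where
    D: "\<And>x. (iterated_partial is f has_derivative D x) (at x)" "\<And>i. (\<lambda>x. D x (axis i 1)) \<in> gaussian_polys" by blast
  have "frechet_derivative (iterated_partial is f) (at x) = D x" for x
    using frechet_derivative_at[OF D(1)] by simp
  then show ?case using D(2) by simp
qed (simp add: assms)

text \<open>Since r \<le> exp r, the power r^k costs only a linear term k r in the exponent;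
  completing the square gives the bound.\<close>

lemma power_times_gaussian_bounded:
  fixes a \<beta> r :: real
  assumes "a > 0" "r \<ge> 0"
  shows "r ^ k * exp (- a * r\<^sup>2 + \<beta> * r) \<le> exp ((\<beta> + real k)\<^sup>2 / (4 * a))"
proof -
  have "r \<le> exp r" using exp_ge_add_one_self[of r] by linarith
  then have "r ^ k \<le> exp r ^ k" using assms by (intro power_mono) auto
  also have "\<dots> = exp (real k * r)" by (simp add: exp_of_nat_mult)
  finally have "r ^ k * exp (- a * r\<^sup>2 + \<beta> * r) \<le> exp (real k * r) * exp (- a * r\<^sup>2 + \<beta> * r)"
    by (rule mult_right_mono) simp
  also have "\<dots> = exp ((\<beta> + real k)\<^sup>2 / (4 * a) - a * (r - (\<beta> + real k) / (2 * a))\<^sup>2)"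
    using assms by (simp add: exp_add[symmetric] power2_eq_square field_simps)
  also have "\<dots> \<le> exp ((\<beta> + real k)\<^sup>2 / (4 * a))" using assms by simp
  finally show ?thesis .
qed

text \<open>The induction keeps \<open>k\<close> general because each coordinate factor raises the
  power of the norm by one.\<close>

lemma gaussian_polys_bounded:
  fixes f :: "real ^ 'n::finite \<Rightarrow> complex"
  assumes "f \<in> gaussian_polys"
  shows "\<exists>B. \<forall>x. norm x ^ k * cmod (f x) \<le> B"
  using assms
proof (induction arbitrary: k)
  case (exp a b t)
  have "norm x ^ k * cmod (exp (complex_of_real (- a * (norm x)\<^sup>2 + b \<bullet> x) + \<i> * complex_of_real (t \<bullet> x)))
     \<le> exp ((norm b + real k)\<^sup>2 / (4 * a))" for x :: "real ^ 'n"
  proof -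
    have "norm x ^ k * cmod (exp (complex_of_real (- a * (norm x)\<^sup>2 + b \<bullet> x) + \<i> * complex_of_real (t \<bullet> x)))
      \<le> norm x ^ k * exp (- a * (norm x)\<^sup>2 + norm b * norm x)"
      using Cauchy_Schwarz_ineq2[of b x] by (intro mult_left_mono) (auto simp: norm_exp_eq_Re)
    also have "\<dots> \<le> exp ((norm b + real k)\<^sup>2 / (4 * a))"
      by (rule power_times_gaussian_bounded) (use exp in auto)
    finally show ?thesis .
  qed
  then show ?case by blast
next
  case (coord f i)
  from coord.IH[of "Suc k"] obtain B where B: "\<And>x. norm x ^ Suc k * cmod (f x) \<le> B" by blast
  have "norm x ^ k * cmod (complex_of_real (x $ i) * f x) \<le> B" for x
  proof -
    have "norm x ^ k * cmod (complex_of_real (x $ i) * f x) \<le> norm x ^ k * (norm x * cmod (f x))"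
      using component_le_norm_cart[of x i] by (intro mult_left_mono) (auto simp: norm_mult mult_right_mono)
    with B[of x] show ?thesis by (simp add: mult_ac)
  qed
  then show ?case by blast
next
  case (scale f c)
  from scale.IH[of k] obtain B where B: "\<And>x. norm x ^ k * cmod (f x) \<le> B" by blast
  have "norm x ^ k * cmod (c * f x) \<le> cmod c * B" for x
    using mult_left_mono[OF B[of x], of "cmod c"] by (simp add: norm_mult mult_ac)
  then show ?case by blast
next
  case (add f g)
  from add.IH(1)[of k] add.IH(2)[of k] obtain B C where
    B: "\<And>x. norm x ^ k * cmod (f x) \<le> B" and C: "\<And>x. norm x ^ k * cmod (g x) \<le> C" by blast
  have "norm x ^ k * cmod (f x + g x) \<le> B + C" for x
  proof -
    have "norm x ^ k * cmod (f x + g x) \<le> norm x ^ k * (cmod (f x) + cmod (g x))"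
      by (intro mult_left_mono norm_triangle_ineq) simp
    with B[of x] C[of x] show ?thesis by (simp add: distrib_left)
  qed
  then show ?case by blast
qed

theorem gaussian_polys_schwartz:
  "(gaussian_polys :: (real ^ 'n::finite \<Rightarrow> complex) set) \<subseteq> schwartz"
proof
  fix f :: "real ^ 'n \<Rightarrow> complex" assume f: "f \<in> gaussian_polys"
  show "f \<in> schwartz"
    unfolding schwartz_def
  proof (intro CollectI allI conjI)
    show "iterated_partial is f differentiable (at x)" for "is" x
      using gaussian_polys_has_derivative[OF iterated_partial_gaussian_polys[OF f, of "is"]] unfolding differentiable_def by blast
    show "bounded (range (\<lambda>x. norm x ^ k *\<^sub>R iterated_partial is f x))" for "is" k
      using gaussian_polys_bounded[OF iterated_partial_gaussian_polys[OF f], of k "is"] by (auto simp: bounded_iff)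
  qed
qed

section \<open>Decay and integrability of general Schwartz functions\<close>

lemma schwartz_bounds:
  fixes f :: "real ^ 'n::finite \<Rightarrow> 'b::real_normed_vector"
  assumes "f \<in> schwartz"
  shows schwartz_continuous_on: "continuous_on A f"
    and schwartz_decay: "\<exists>B. \<forall>x. norm x ^ k * norm (f x) \<le> B"
proof -
  have "f differentiable (at x)" for x
    using assms by (auto simp: schwartz_def dest: spec[of _ "[]"])
  then show "continuous_on A f"
    by (intro continuous_at_imp_continuous_on ballI differentiable_imp_continuous_within)
  have "bounded (range (\<lambda>x. norm x ^ k *\<^sub>R f x))"
    using assms by (auto simp: schwartz_def dest: spec[of _ "[]"])
  then show "\<exists>B. \<forall>x. norm x ^ k * norm (f x) \<le> B"
    by (auto simp: bounded_iff)
qed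

lemma schwartz_borel_measurable:
  fixes f :: "real ^ 'n::finite \<Rightarrow> 'b::real_normed_vector"
  assumes "f \<in> schwartz"
  shows "f \<in> borel_measurable borel"
  using schwartz_continuous_on[OF assms, of UNIV] by (rule borel_measurable_continuous_onI)

lemma schwartz_bounded:
  fixes f :: "real ^ 'n::finite \<Rightarrow> 'b::real_normed_vector"
  assumes "f \<in> schwartz"
  shows "\<exists>B. \<forall>x. norm (f x) \<le> B"
  using schwartz_decay[OF assms, of 0] by auto

lemma schwartz_integrable:
  fixes f :: "real ^ 'n::finite \<Rightarrow> 'b::{banach, second_countable_topology}"
  assumes f: "f \<in> schwartz"
  shows "integrable lborel f"
proof -
  obtain B where B: "\<And>x. norm (f x) \<le> B" using schwartz_bounded[OF f] by blast
  obtain C where C: "\<And>x. norm x ^ (DIM(real ^ 'n) + 1) * norm (f x) \<le> C" using schwartz_decay[OF f] by blast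
  have B0: "B \<ge> 0" using order_trans[OF norm_ge_zero B] .
  show ?thesis
  \<comment> \<open>Boundedness is all that is used near the origin, so any exponent between 0 and d
    serves there; 1/2 fits every dimension. The exponent d + 1 is the least integer that is
    integrable at infinity.\<close>
  proof (rule integrable_radial_bounds[where p = "1/2" and q = "DIM(real ^ 'n) + 1" and \<rho> = 1 and C = B and D = C])
    show "1 / 2 < real DIM(real ^ 'n)" using DIM_positive[where 'a="real ^ 'n"] by linarith
    fix x :: "real ^ 'n"
    show "norm (f x) \<le> B * norm x powr (- (1 / 2))" if "x \<noteq> 0" "norm x \<le> 1"
    proof -
      have "1 \<le> norm x powr (- (1 / 2))" using powr_mono2'[of "-(1/2)" "norm x" 1] that by simp
      with B0 have "B * 1 \<le> B * norm x powr (- (1 / 2))" by (rule mult_left_mono[rotated])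
      with B[of x] show ?thesis by linarith
    qed
    show "norm (f x) \<le> C * norm x powr (- real (DIM(real ^ 'n) + 1))" if "1 \<le> norm x"
    proof -
      have "norm x powr (- real (DIM(real ^ 'n) + 1)) = 1 / norm x ^ (DIM(real ^ 'n) + 1)"
        using that by (subst powr_minus, subst powr_realpow) (auto simp: divide_inverse)
      moreover have "norm x ^ (DIM(real ^ 'n) + 1) > 0" using that by (intro zero_less_power) linarith
      ultimately show ?thesis using C[of x] by (simp only: pos_le_divide_eq mult_ac times_divide_eq_right mult_1_right)
    qed
  qed (use schwartz_borel_measurable[OF f] in auto)
qed

section \<open>Uniqueness of Fourier transforms\<close>

text \<open>Coordinates identify the space with a finite product of lines, where uniqueness is
  known. Since \<psi> undoes \<phi>, a measure is recovered from its image.\<close>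

theorem char_fun_unique:
  fixes \<mu> \<nu> :: "'a::euclidean_space measure"
  assumes \<mu>: "finite_measure \<mu>" "sets \<mu> = sets borel"
    and \<nu>: "finite_measure \<nu>" "sets \<nu> = sets borel"
    and eq: "\<And>t. (CLINT x|\<mu>. iexp (t \<bullet> x)) = (CLINT x|\<nu>. iexp (t \<bullet> x))"
  shows "\<mu> = \<nu>"
proof -
  define \<phi> where "\<phi> x = (\<lambda>b\<in>Basis. x \<bullet> b)" for x :: 'a
  define \<psi> where "\<psi> f = (\<Sum>b\<in>Basis. f b *\<^sub>R b)" for f :: "'a \<Rightarrow> real"
  have \<phi>[measurable]: "\<phi> \<in> borel \<rightarrow>\<^sub>M PiM Basis (\<lambda>_. borel)"
    unfolding \<phi>_def by measurable
  have \<psi>[measurable]: "\<psi> \<in> PiM Basis (\<lambda>_. borel) \<rightarrow>\<^sub>M borel"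
    unfolding \<psi>_def by measurable
  have fin: "finite_measure (distr \<rho> (PiM Basis (\<lambda>_. borel)) \<phi>)" 
    if \<rho>: "finite_measure \<rho>" "sets \<rho> = sets borel" for \<rho>
    by (rule finite_measure.finite_measure_distr[OF \<rho>(1)]) (use \<phi> in \<open>simp add: measurable_cong_sets[OF \<rho>(2) refl]\<close>)
  have char: "(CLINT f|distr \<rho> (PiM Basis (\<lambda>_. borel)) \<phi>. iexp (\<Sum>b\<in>Basis. t b * f b)) = (CLINT x|\<rho>. iexp (\<psi> t \<bullet> x))"
    if \<rho>: "sets \<rho> = sets borel" for \<rho> t
  proof -
    have 1: "\<phi> \<in> \<rho> \<rightarrow>\<^sub>M PiM Basis (\<lambda>_. borel)"
      using \<phi> by (simp add: measurable_cong_sets[OF \<rho> refl])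
    have 2: "(\<lambda>f. iexp (\<Sum>b\<in>Basis. t b * f b)) \<in> borel_measurable (PiM Basis (\<lambda>_::'a. borel))"
      by measurable
    have "(\<Sum>b\<in>Basis. t b * \<phi> x b) = \<psi> t \<bullet> x" for x
      by (simp add: \<phi>_def \<psi>_def inner_sum_left inner_commute[of x])
    then show ?thesis
      unfolding integral_distr[OF 1 2] by (simp only:)
  qed
  have "distr \<mu> (PiM Basis (\<lambda>_. borel)) \<phi> = distr \<nu> (PiM Basis (\<lambda>_. borel)) \<phi>"
    by (rule char_fun_unique_PiM[OF finite_Basis fin[OF \<mu>] sets_distr fin[OF \<nu>] sets_distr])
      (simp only: char[OF \<mu>(2)] char[OF \<nu>(2)] eq)
  then have "distr (distr \<mu> (PiM Basis (\<lambda>_. borel)) \<phi>) borel \<psi> = distr (distr \<nu> (PiM Basis (\<lambda>_. borel)) \<phi>) borel \<psi>"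
    by simp
  moreover have "distr (distr \<rho> (PiM Basis (\<lambda>_. borel)) \<phi>) borel \<psi> = \<rho>" if \<rho>: "sets \<rho> = sets borel" for \<rho>
  proof -
    have 1: "\<phi> \<in> \<rho> \<rightarrow>\<^sub>M PiM Basis (\<lambda>_. borel)"
      using \<phi> by (simp add: measurable_cong_sets[OF \<rho> refl])
    have "\<psi> \<circ> \<phi> = (\<lambda>x. x)"
      by (auto simp: \<phi>_def \<psi>_def fun_eq_iff euclidean_representation)
    then show ?thesis
      unfolding distr_distr[OF \<psi> 1] using \<rho> by (simp add: distr_id2)
  qed
  ultimately show ?thesis using \<mu>(2) \<nu>(2) by simp
qed

section \<open>Rotation invariance of Lebesgue measure\<close>

lemma lborel_distr_orthogonal:
  fixes T :: "'a::euclidean_space \<Rightarrow> 'a"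
  assumes T: "orthogonal_transformation T"
  shows "distr lborel borel T = lborel"
proof -
  have lin: "linear T" using T by (rule orthogonal_transformation_linear)
  have [measurable]: "T \<in> borel_measurable borel"
    using linear_continuous_on[OF lin[unfolded linear_conv_bounded_linear]] by (rule borel_measurable_continuous_onI)
  \<comment> \<open>The Gaussian measure is invariant under \<open>T\<close>, as its characteristic function is radial; dividing
    by the radial density \<open>e\<close> transfers this to Lebesgue measure.\<close>
  define e where "e x = exp (- 1 * (norm x)\<^sup>2)" for x :: 'a
  have [measurable]: "e \<in> borel_measurable borel" unfolding e_def by measurable
  have e_pos: "e x > 0" for x by (simp add: e_def)
  have eT: "e (T x) = e x" for x by (simp add: e_def orthogonal_transformation_norm[OF T])
  define G where "G = density lborel (\<lambda>x::'a. ennreal (e x))"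
  have G: "sets G = sets borel" by (simp add: G_def)
  have finG: "finite_measure G"
  proof
    have "emeasure G (space G) = ennreal (pi powr (DIM('a) / 2))"
      using nn_gaussian_integral[of 1, where 'a='a] by (simp add: G_def emeasure_density e_def)
    then show "emeasure G (space G) \<noteq> \<infinity>" by simp
  qed
  have char: "(CLINT x|G. iexp (t \<bullet> x)) = complex_of_real ((pi / 1) powr (DIM('a) / 2) * exp (- (norm t)\<^sup>2 / (4 * 1)))" for t
  proof -
    have "(CLINT x|G. iexp (t \<bullet> x)) = (CLINT x|lborel. complex_of_real (exp (- 1 * (norm x)\<^sup>2)) * iexp (t \<bullet> x))"
      unfolding G_def by (subst integral_density) (auto simp: e_def scaleR_conv_of_real)
    then show ?thesis
      using has_bochner_integral_integral_eq[OF gaussian_fourier[of 1 t]] by simp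
  qed
  have mT: "T \<in> G \<rightarrow>\<^sub>M borel" by (simp add: measurable_cong_sets[OF G refl])
  have "distr G borel T = G"
  proof (rule char_fun_unique[OF finite_measure.finite_measure_distr[OF finG mT] sets_distr finG G])
    fix t
    obtain t' where t: "t = T t'" using orthogonal_transformation_surj[OF T] by (metis surjD)
    have "(CLINT x|distr G borel T. iexp (t \<bullet> x)) = (CLINT x|G. iexp (t \<bullet> T x))"
      by (subst integral_distr[OF mT]) auto
    also have "\<dots> = (CLINT x|G. iexp (t' \<bullet> x))"
      using T by (simp add: t orthogonal_transformation_def)
    also have "\<dots> = (CLINT x|G. iexp (t \<bullet> x))"
      unfolding char t orthogonal_transformation_norm[OF T] ..
    finally show "(CLINT x|distr G borel T. iexp (t \<bullet> x)) = (CLINT x|G. iexp (t \<bullet> x))" .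
  qed
  moreover have "distr G borel T = density (distr lborel borel T) (\<lambda>x. ennreal (e x))"
    unfolding G_def by (subst density_distr) (simp_all add: eT)
  ultimately have "density (density (distr lborel borel T) (\<lambda>x. ennreal (e x))) (\<lambda>x. ennreal (1 / e x))
      = density (density lborel (\<lambda>x. ennreal (e x))) (\<lambda>x. ennreal (1 / e x))"
    by (simp add: G_def)
  moreover have "density (density M (\<lambda>x. ennreal (e x))) (\<lambda>x. ennreal (1 / e x)) = M" if "sets M = sets borel" for M
  proof -
    have [measurable_cong]: "sets M = sets borel" by fact
    have "ennreal (e x) * ennreal (1 / e x) = 1" for x
      using e_pos[of x] by (simp add: ennreal_mult[symmetric] flip: ennreal_1)
    then show ?thesis
      by (subst density_density_eq) (auto simp: density_1)
  qed
  ultimately show ?thesis by simp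
qed

text \<open>The positive and negative parts of \<open>u\<close> are densities of finite measures
  with the same characteristic function. These measures coincide, so the two parts agree almost
  everywhere, which is possible only where \<open>u\<close> is 0.\<close>

lemma fourier_zero_imp_AE_zero_real:
  fixes u :: "'a::euclidean_space \<Rightarrow> real"
  assumes u: "integrable lborel u"
    and zero: "\<And>t. (CLINT x|lborel. complex_of_real (u x) * iexp (t \<bullet> x)) = 0"
  shows "AE x in lborel. u x = 0"
proof -
  note [measurable] = borel_measurable_integrable[OF u]
  define P where "P v = density lborel (\<lambda>x::'a. ennreal (max 0 (v x)))" for v :: "'a \<Rightarrow> real"
  have int: "integrable lborel (\<lambda>x. max 0 (v x))" if "integrable lborel v" for v :: "'a \<Rightarrow> real"
    using that by (intro integrable_max) auto
  have fin: "finite_measure (P v)" if v: "integrable lborel v" for v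
  proof
    note [measurable] = borel_measurable_integrable[OF v]
    have "emeasure (P v) (space (P v)) = (\<integral>\<^sup>+x. ennreal (max 0 (v x)) \<partial>lborel)"
      by (simp add: P_def emeasure_density)
    also have "\<dots> = (\<integral>\<^sup>+x. ennreal (norm (max 0 (v x))) \<partial>lborel)" by simp
    also have "\<dots> < \<infinity>" using int[OF v] by (simp only: integrable_iff_bounded)
    finally show "emeasure (P v) (space (P v)) \<noteq> \<infinity>" by simp
  qed
  have char: "(CLINT x|P v. iexp (t \<bullet> x)) = (CLINT x|lborel. complex_of_real (max 0 (v x)) * iexp (t \<bullet> x))"
    if v: "integrable lborel v" for v t
  proof -
    note [measurable] = borel_measurable_integrable[OF v]
    show ?thesis
      unfolding P_def by (subst integral_density) (auto simp: scaleR_conv_of_real)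
  qed
  have u': "integrable lborel (\<lambda>x. - u x)" using u by simp
  have "P u = P (\<lambda>x. - u x)"
  proof (rule char_fun_unique[OF fin[OF u] _ fin[OF u']])
    fix t :: 'a
    have i: "integrable lborel (\<lambda>x. complex_of_real (max 0 (v x)) * iexp (t \<bullet> x))" if v: "integrable lborel v" for v
    proof -
      note [measurable] = borel_measurable_integrable[OF v]
      show ?thesis by (rule Bochner_Integration.integrable_bound[OF int[OF v]]) (auto simp: norm_mult)
    qed
    have "(CLINT x|lborel. complex_of_real (max 0 (u x)) * iexp (t \<bullet> x)) - (CLINT x|lborel. complex_of_real (max 0 (- u x)) * iexp (t \<bullet> x))
       = (CLINT x|lborel. complex_of_real (u x) * iexp (t \<bullet> x))"
      unfolding Bochner_Integration.integral_diff[OF i[OF u] i[OF u'], symmetric] left_diff_distrib[symmetric] of_real_diff[symmetric]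
      by (intro Bochner_Integration.integral_cong refl) (auto simp: max_def)
    then show "(CLINT x|P u. iexp (t \<bullet> x)) = (CLINT x|P (\<lambda>x. - u x). iexp (t \<bullet> x))"
      unfolding char[OF u] char[OF u'] zero by (simp only: right_minus_eq)
  qed (simp_all add: P_def)
  then have "AE x in lborel. ennreal (max 0 (u x)) = ennreal (max 0 (- u x))"
    unfolding P_def by (subst (asm) sigma_finite_measure.density_unique_iff[OF lborel.sigma_finite_measure_axioms]) auto
  then show ?thesis
    by eventually_elim (auto simp: max_def split: if_splits)
qed

text \<open>Conjugation turns frequency t into -t, so the transform of \<open>cnj (h x)\<close>
  vanishes as well. The real and imaginary parts are combinations of \<open>h\<close> and its
  conjugate.\<close>

lemma fourier_zero_imp_AE_zero:
  fixes h :: "'a::euclidean_space \<Rightarrow> complex"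
  assumes h: "integrable lborel h"
    and zero: "\<And>t. (CLINT x|lborel. h x * iexp (t \<bullet> x)) = 0"
  shows "AE x in lborel. h x = 0"
proof -
  note [measurable] = borel_measurable_integrable[OF h]
  have i: "integrable lborel (\<lambda>x. h x * iexp (t \<bullet> x))" for t
    by (rule Bochner_Integration.integrable_bound[OF h]) (auto simp: norm_mult)
  have "integrable lborel (\<lambda>x. cnj (h x))" using h by simp
  note [measurable] = borel_measurable_integrable[OF this]
  have ic: "integrable lborel (\<lambda>x. cnj (h x) * iexp (t \<bullet> x))" for t
    by (rule Bochner_Integration.integrable_bound[OF h]) (auto simp: norm_mult)
  have zc: "(CLINT x|lborel. cnj (h x) * iexp (t \<bullet> x)) = 0" for t
  proof -
    have "(CLINT x|lborel. cnj (h x) * iexp (t \<bullet> x)) = (CLINT x|lborel. cnj (h x * iexp ((- t) \<bullet> x)))"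
      by (intro Bochner_Integration.integral_cong refl) (simp add: exp_cnj)
    also have "\<dots> = 0" by (simp only: Bochner_Integration.integral_cnj zero complex_cnj_zero)
    finally show ?thesis .
  qed
  have "AE x in lborel. Re (h x) = 0"
  proof (rule fourier_zero_imp_AE_zero_real)
    fix t
    have "(CLINT x|lborel. complex_of_real (Re (h x)) * iexp (t \<bullet> x))
      = (CLINT x|lborel. (1/2) * (h x * iexp (t \<bullet> x)) + (1/2) * (cnj (h x) * iexp (t \<bullet> x)))"
      by (intro Bochner_Integration.integral_cong refl) (simp add: complex_eq_iff field_simps)
    also have "\<dots> = 0"
      by (subst Bochner_Integration.integral_add, intro integrable_mult_right i, intro integrable_mult_right ic)
        (simp only: integral_mult_right_zero zero zc mult_zero_right add_0)
    finally show "(CLINT x|lborel. complex_of_real (Re (h x)) * iexp (t \<bullet> x)) = 0" .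
  qed (use h in auto)
  moreover have "AE x in lborel. Im (h x) = 0"
  proof (rule fourier_zero_imp_AE_zero_real)
    fix t
    have "(CLINT x|lborel. complex_of_real (Im (h x)) * iexp (t \<bullet> x))
      = (CLINT x|lborel. (-\<i>/2) * (h x * iexp (t \<bullet> x)) + (\<i>/2) * (cnj (h x) * iexp (t \<bullet> x)))"
      by (intro Bochner_Integration.integral_cong refl) (simp add: complex_eq_iff field_simps)
    also have "\<dots> = 0"
      by (subst Bochner_Integration.integral_add, intro integrable_mult_right i, intro integrable_mult_right ic)
        (simp only: integral_mult_right_zero zero zc mult_zero_right add_0)
    finally show "(CLINT x|lborel. complex_of_real (Im (h x)) * iexp (t \<bullet> x)) = 0" .
  qed (use h in auto)
  ultimately show ?thesis
    by eventually_elim (simp add: complex_eq_iff)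
qed

text \<open>Modulated Gaussians are test functions, so (f - g) times a Gaussian is integrable with
  vanishing Fourier transform; the Gaussian has no zeros. This makes the choices in
  \<open>fourier_density\<close> and \<open>L2_representative\<close> harmless.\<close>

theorem represented_by_unique:
  fixes u :: "'n::finite dist_functional"
  assumes f: "represented_by u f" and g: "represented_by u g"
  shows "AE x in lborel. f x = g x"
proof -
  let ?w = "\<lambda>x :: real ^ 'n. complex_of_real (exp (- (norm x)\<^sup>2))"
  have w: "(\<lambda>x. ?w x * iexp (t \<bullet> x)) \<in> schwartz" for t
  proof -
    have "(\<lambda>x. exp (complex_of_real (- 1 * (norm x)\<^sup>2 + 0 \<bullet> x) + \<i> * complex_of_real (t \<bullet> x))) \<in> gaussian_polys"
      by (rule gaussian_polys.exp) simp
    also have "(\<lambda>x. exp (complex_of_real (- 1 * (norm x)\<^sup>2 + 0 \<bullet> x) + \<i> * complex_of_real (t \<bullet> x))) = (\<lambda>x. ?w x * iexp (t \<bullet> x))"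
      by (rule ext) (simp only: exp_add mult_1 mult_minus_left inner_zero_left add_0_right exp_of_real)
    finally show ?thesis using gaussian_polys_schwartz by blast
  qed
  have i: "integrable lborel (\<lambda>x. (f x - g x) * ?w x * iexp (t \<bullet> x))"
    and z: "(CLINT x|lborel. (f x - g x) * ?w x * iexp (t \<bullet> x)) = 0" for t
  proof -
    have fi: "integrable lborel (\<lambda>x. f x * (?w x * iexp (t \<bullet> x)))" and gi: "integrable lborel (\<lambda>x. g x * (?w x * iexp (t \<bullet> x)))"
      and eq: "(CLINT x|lborel. f x * (?w x * iexp (t \<bullet> x))) = (CLINT x|lborel. g x * (?w x * iexp (t \<bullet> x)))"
      using f g w[of t] by (auto simp: represented_by_def dist_of_fun_def)
    have e: "(f x - g x) * ?w x * iexp (t \<bullet> x) = f x * (?w x * iexp (t \<bullet> x)) - g x * (?w x * iexp (t \<bullet> x))" for x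
      by (simp only: left_diff_distrib mult.assoc)
    show "integrable lborel (\<lambda>x. (f x - g x) * ?w x * iexp (t \<bullet> x))"
      unfolding e by (rule Bochner_Integration.integrable_diff[OF fi gi])
    show "(CLINT x|lborel. (f x - g x) * ?w x * iexp (t \<bullet> x)) = 0"
      unfolding e Bochner_Integration.integral_diff[OF fi gi] eq by simp
  qed
  have "AE x in lborel. (f x - g x) * ?w x = 0"
    by (rule fourier_zero_imp_AE_zero) (use i[of 0] z in auto)
  then show ?thesis by eventually_elim simp
qed

section \<open>Differences of Riesz kernels\<close>

lemma lborel_integrable_translate:
  fixes f :: "'a::euclidean_space \<Rightarrow> 'b::{banach, second_countable_topology}"
  assumes [measurable]: "f \<in> borel_measurable borel"
  shows "integrable lborel (\<lambda>x. f (x - t)) \<longleftrightarrow> integrable lborel f"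
  using integrable_distr_eq[of "(+) (- t)" lborel borel f] by (simp add: lborel_distr_plus)

lemma lborel_integral_translate:
  fixes f :: "'a::euclidean_space \<Rightarrow> 'b::{banach, second_countable_topology}"
  assumes [measurable]: "f \<in> borel_measurable borel"
  shows "(LINT x|lborel. f (x - t)) = (LINT x|lborel. f x)"
  using integral_distr[of "(+) (- t)" lborel borel f] by (simp add: lborel_distr_plus)

lemma lborel_integral_scale:
  fixes f :: "'a::euclidean_space \<Rightarrow> real"
  assumes [measurable]: "f \<in> borel_measurable borel" and c: "c \<noteq> 0"
  shows "(LINT x|lborel. f x) = \<bar>c\<bar> ^ DIM('a) * (LINT x|lborel. f (c *\<^sub>R x))"
  by (subst lborel_affine[OF c, of 0]) (simp add: integral_density integral_distr)

text \<open>Mean value theorem: the slope of u^(-b) is largest in modulus at the lower end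
  m.\<close>

lemma powr_neg_diff_bound:
  fixes b m u v :: real
  assumes "b > 0" "0 < m" "m \<le> u" "m \<le> v"
  shows "\<bar>u powr (- b) - v powr (- b)\<bar> \<le> b * m powr (- b - 1) * \<bar>u - v\<bar>"
proof -
  have main: "\<bar>u powr (- b) - v powr (- b)\<bar> \<le> b * m powr (- b - 1) * \<bar>u - v\<bar>" if "m \<le> u" "u < v" for u v
  proof -
    have "\<exists>z>u. z < v \<and> v powr (- b) - u powr (- b) = (v - u) * ((- b) * z powr (- b - 1))"
      by (rule MVT2) (use that assms in \<open>auto intro!: derivative_eq_intros\<close>)
    then obtain z where z: "u < z" "z < v" "v powr (- b) - u powr (- b) = (v - u) * ((- b) * z powr (- b - 1))" by blast
    have "z powr (- b - 1) \<le> m powr (- b - 1)"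
      using z that assms by (intro powr_mono2') auto
    then have "(v - u) * b * z powr (- b - 1) \<le> (v - u) * b * m powr (- b - 1)"
      using that assms by (intro mult_left_mono) auto
    moreover have "\<bar>u powr (- b) - v powr (- b)\<bar> = (v - u) * b * z powr (- b - 1)"
      using z(3) that assms by (simp add: abs_minus_commute[of "u powr (- b)"] abs_mult)
    ultimately show ?thesis using that by (simp add: mult_ac)
  qed
  consider "u < v" | "v < u" | "u = v" by linarith
  then show ?thesis
    using main[of u v] main[of v u] assms by cases (auto simp: abs_minus_commute)
qed

text \<open>The difference of Riesz kernels, used with b = d - s. At the poles z = x and z = 0 the
  singular term reads 0 instead of infinity, by the convention for \<open>powr\<close>; these points
  form a null set.\<close>

definition riesz_diff :: "real \<Rightarrow> 'a::euclidean_space \<Rightarrow> 'a \<Rightarrow> real" where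
  "riesz_diff b x z = norm (z - x) powr (- b) - norm z powr (- b)"

lemma riesz_diff_measurable [measurable]: "riesz_diff b x \<in> borel_measurable borel"
  unfolding riesz_diff_def by measurable

text \<open>Locally each kernel is square integrable by itself, because 2b < d. Far away the
  cancellation gains one power, the difference being of order |z|^(-b-1), and its square is
  integrable because 2b + 2 > d.\<close>

lemma integrable_riesz_diff_square:
  fixes b :: real and x :: "'a::euclidean_space"
  assumes b: "0 < b" "2 * b < DIM('a)" "DIM('a) < 2 * b + 2"
  shows "integrable lborel (\<lambda>z. (riesz_diff b x z)\<^sup>2)"
proof -
  \<comment> \<open>Large enough that |z| \<ge> \<rho> implies |z - x| \<ge> |z|/2, and that |z|
    \<le> \<rho> implies |z - x| \<le> 2 \<rho>.\<close>
  define \<rho> where "\<rho> = 2 * norm x + 1"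
  have \<rho>: "\<rho> > 0" by (simp add: \<rho>_def add_nonneg_pos)
  define n where "n R z = indicator {z. norm z \<le> R} z * (norm z powr (- b))\<^sup>2" for R and z :: 'a
  have sq: "(norm z powr (- b))\<^sup>2 = norm z powr (- (2 * b))" for z :: 'a
    by (simp add: power2_eq_square powr_add[symmetric])
  have [measurable]: "n R \<in> borel_measurable borel" for R
    unfolding n_def by measurable
  have n: "integrable lborel (n R)" if "R > 0" for R
  \<comment> \<open>The radius is \<open>R + 1\<close> rather than \<open>R\<close>: the far bound
    with constant 0 must already hold on the separating sphere, and the truncated kernel does not
    vanish at |z| = R.\<close>
  proof (rule integrable_radial_bounds[where p = "2 * b" and q = "DIM('a) + 1" and \<rho> = "R + 1" and C = 1 and D = 0])
    show "norm (n R z) \<le> 1 * norm z powr (- (2 * b))" for z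
      by (auto simp: n_def sq indicator_def)
  qed (use b that in \<open>auto simp: n_def\<close>)
  have near: "integrable lborel (\<lambda>z. 2 * n (2 * \<rho>) (z - x) + 2 * n (2 * \<rho>) z)"
    using \<rho> by (intro Bochner_Integration.integrable_add integrable_mult_right lborel_integrable_translate[THEN iffD2] n) auto
  have far: "integrable lborel (\<lambda>z. indicator {z. norm z > \<rho>} z * (riesz_diff b x z)\<^sup>2)"
  proof (rule integrable_radial_bounds[where p = "2 * b" and q = "2 * b + 2" and \<rho> = \<rho> and C = 0 and D = "(b * 2 powr (b + 1) * norm x)\<^sup>2"])
    fix z :: 'a assume z: "norm z \<ge> \<rho>"
    then have z0: "norm z > 0" and zx: "norm z \<ge> 2 * norm x" using \<rho> by (auto simp: \<rho>_def)
    have "\<bar>riesz_diff b x z\<bar> \<le> b * (norm z / 2) powr (- b - 1) * \<bar>norm (z - x) - norm z\<bar>"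
      unfolding riesz_diff_def
      by (rule powr_neg_diff_bound) (use b z0 zx norm_triangle_ineq2[of z x] in auto)
    also have "\<dots> \<le> b * (norm z / 2) powr (- b - 1) * norm x"
      using b norm_triangle_ineq3[of "z - x" z] by (intro mult_left_mono) auto
    also have "(norm z / 2) powr (- b - 1) = 2 powr (b + 1) * norm z powr (- b - 1)"
    proof -
      have "2 powr (b + 1) = inverse (2 powr (- b - 1))"
        by (subst powr_minus[symmetric]) (simp add: add.commute)
      moreover have "(norm z / 2) powr (- b - 1) = norm z powr (- b - 1) / 2 powr (- b - 1)"
        by (rule powr_divide)
      ultimately show ?thesis by (simp only: divide_inverse mult.commute)
    qed
    finally have "\<bar>riesz_diff b x z\<bar> \<le> b * 2 powr (b + 1) * norm x * norm z powr (- b - 1)" by (simp add: mult_ac)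
    then have "\<bar>riesz_diff b x z\<bar>\<^sup>2 \<le> (b * 2 powr (b + 1) * norm x * norm z powr (- b - 1))\<^sup>2"
      by (intro power_mono) auto
    also have "\<dots> = (b * 2 powr (b + 1) * norm x)\<^sup>2 * norm z powr (- (2 * b + 2))"
      by (simp add: power_mult_distrib power2_eq_square[of "norm z powr _"] powr_add[symmetric])
    finally show "norm (indicator {z. norm z > \<rho>} z * (riesz_diff b x z)\<^sup>2) \<le> (b * 2 powr (b + 1) * norm x)\<^sup>2 * norm z powr (- (2 * b + 2))"
      by (auto simp: indicator_def)
  qed (use b \<rho> in \<open>auto simp: indicator_def\<close>)
  show ?thesis
  proof (rule Bochner_Integration.integrable_bound[OF Bochner_Integration.integrable_add[OF near far]])
    have "(riesz_diff b x z)\<^sup>2 \<le> (2 * n (2 * \<rho>) (z - x) + 2 * n (2 * \<rho>) z) + indicator {z. norm z > \<rho>} z * (riesz_diff b x z)\<^sup>2" for z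
    proof (cases "norm z > \<rho>")
      case True
      then show ?thesis by (simp add: n_def)
    next
      case False
      then have "norm (z - x) \<le> 2 * \<rho>" "norm z \<le> 2 * \<rho>"
        using norm_triangle_ineq4[of z x] \<rho> by (auto simp: \<rho>_def)
      moreover have "(p - q)\<^sup>2 \<le> 2 * p\<^sup>2 + 2 * q\<^sup>2" for p q :: real
        using sum_squares_bound[of p "- q"] by (simp add: power2_diff)
      ultimately show ?thesis using False by (simp add: n_def riesz_diff_def)
    qed
    moreover have "0 \<le> (riesz_diff b x z)\<^sup>2" for z by simp
    ultimately show "AE z in lborel. norm ((riesz_diff b x z)\<^sup>2) \<le> norm (2 * n (2 * \<rho>) (z - x) + 2 * n (2 * \<rho>) z + indicator {z. norm z > \<rho>} z * (riesz_diff b x z)\<^sup>2)"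
      by (intro AE_I2) (metis abs_of_nonneg order_trans real_norm_def)
  qed simp
qed

text \<open>In the ball of radius |x|/2 around 0 every point is strictly closer to 0 than to x, so
  away from the center the difference is strictly negative on a set of positive measure.\<close>

lemma integral_riesz_diff_square_pos:
  fixes b :: real and x :: "'a::euclidean_space"
  assumes b: "0 < b" "2 * b < DIM('a)" "DIM('a) < 2 * b + 2" and x: "x \<noteq> 0"
  shows "(LINT z|lborel. (riesz_diff b x z)\<^sup>2) > 0"
proof -
  have "(LINT z|lborel. (riesz_diff b x z)\<^sup>2) \<noteq> 0"
  proof
    assume "(LINT z|lborel. (riesz_diff b x z)\<^sup>2) = 0"
    then have "AE z in lborel. (riesz_diff b x z)\<^sup>2 = 0"
      using integral_nonneg_eq_0_iff_AE[OF integrable_riesz_diff_square[OF b, of x]] by simp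
    moreover have "AE z in lborel. z \<noteq> (0::'a)" by (rule AE_lborel_singleton)
    ultimately have ae: "AE z in lborel. z \<notin> ball (0::'a) (norm x / 2)"
    proof eventually_elim
      case (elim z)
      show ?case
      proof
        assume "z \<in> ball 0 (norm x / 2)"
        then have "norm z < norm x / 2" by simp
        then have "norm z < norm (z - x)" using norm_triangle_ineq2[of x z] by (simp add: norm_minus_commute)
        with elim(2) b have "norm (z - x) powr (- b) < norm z powr (- b)"
          by (intro powr_less_mono2_neg) auto
        with elim(1) show False by (simp add: riesz_diff_def)
      qed
    qed
    have "emeasure lborel (ball (0::'a) (norm x / 2)) = 0"
      using AE_iff_null_sets[of "ball (0::'a) (norm x / 2)" lborel] ae by (simp add: null_sets_def)
    moreover have "emeasure lborel (ball (0::'a) (norm x / 2)) > 0"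
      using x by (simp add: emeasure_lborel_ball_finite emeasure_ball unit_ball_vol_pos)
    ultimately show False by simp
  qed
  moreover have "(LINT z|lborel. (riesz_diff b x z)\<^sup>2) \<ge> 0" by simp
  ultimately show ?thesis by linarith
qed

text \<open>Write x as a rotated and dilated copy of the unit vector e. The dilation contributes
  |x|^d through the volume and |x|^(-2b) through the homogeneity of the kernel.\<close>

lemma integral_riesz_diff_square_scale:
  fixes b :: real and x e :: "real ^ 'n::finite"
  assumes e: "norm e = 1"
  shows "(LINT z|lborel. (riesz_diff b x z)\<^sup>2) = norm x powr (CARD('n) - 2 * b) * (LINT z|lborel. (riesz_diff b e z)\<^sup>2)"
proof (cases "x = 0")
  case True
  then show ?thesis by (simp add: riesz_diff_def)
next
  case False
  define r where "r = norm x"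
  have r: "r > 0" using False by (simp add: r_def)
  obtain T where T: "orthogonal_transformation T" "T e = x /\<^sub>R r"
    using orthogonal_transformation_exists_1[of e "x /\<^sub>R r"] e r by (auto simp: r_def)
  have lin: "linear T" using T by (simp add: orthogonal_transformation_linear)
  have Tm[measurable]: "T \<in> borel_measurable borel"
    using linear_continuous_on[OF lin[unfolded linear_conv_bounded_linear]] by (rule borel_measurable_continuous_onI)
  have "riesz_diff b x (r *\<^sub>R T z) = r powr (- b) * riesz_diff b e z" for z
  proof -
    have "x = r *\<^sub>R T e" using r by (simp add: T)
    then have "r *\<^sub>R T z - x = r *\<^sub>R T (z - e)"
      by (simp add: linear_diff[OF lin] scaleR_diff_right)
    then have "norm (r *\<^sub>R T z - x) = r * norm (z - e)" "norm (r *\<^sub>R T z) = r * norm z"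
      using r by (simp_all add: orthogonal_transformation_norm[OF T(1)])
    then show ?thesis
      using r by (simp only: riesz_diff_def powr_mult norm_ge_zero less_imp_le right_diff_distrib)
  qed
  then have eq: "(riesz_diff b x (r *\<^sub>R T z))\<^sup>2 = r powr (- 2 * b) * (riesz_diff b e z)\<^sup>2" for z
    by (simp add: power_mult_distrib power2_eq_square[of "r powr _"] powr_add[symmetric])
  have "(LINT z|lborel. (riesz_diff b x z)\<^sup>2) = r ^ CARD('n) * (LINT z|lborel. (riesz_diff b x (r *\<^sub>R z))\<^sup>2)"
    by (subst lborel_integral_scale[where c = r]) (use r in auto)
  also have "(LINT z|lborel. (riesz_diff b x (r *\<^sub>R z))\<^sup>2) = (LINT z|distr lborel borel T. (riesz_diff b x (r *\<^sub>R z))\<^sup>2)"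
    by (simp only: lborel_distr_orthogonal[OF T(1)])
  also have "\<dots> = (LINT z|lborel. (riesz_diff b x (r *\<^sub>R T z))\<^sup>2)"
    by (rule integral_distr) simp_all
  also have "\<dots> = r powr (- 2 * b) * (LINT z|lborel. (riesz_diff b e z)\<^sup>2)"
    unfolding eq by simp
  also have "r ^ CARD('n) * \<dots> = r powr (CARD('n) - 2 * b) * (LINT z|lborel. (riesz_diff b e z)\<^sup>2)"
    using r by (simp add: powr_realpow[symmetric] powr_diff powr_minus field_simps)
  finally show ?thesis by (simp add: r_def)
qed

text \<open>Polarization applies because the increments are stationary: the difference of the
  functions attached to x and y is the function attached to x - y, translated by y.\<close>

theorem riesz_diff_covariance:
  fixes b :: real and x y e :: "real ^ 'n::finite"
  assumes b: "0 < b" "2 * b < CARD('n)" "CARD('n) < 2 * b + 2" and e: "norm e = 1"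
  shows "(LINT z|lborel. riesz_diff b x z * riesz_diff b y z) = (LINT z|lborel. (riesz_diff b e z)\<^sup>2) *
    ((norm x powr (CARD('n) - 2 * b) + norm y powr (CARD('n) - 2 * b) - norm (x - y) powr (CARD('n) - 2 * b)) / 2)"
proof -
  have i: "integrable lborel (\<lambda>z. (riesz_diff b w z)\<^sup>2)" for w :: "real ^ 'n"
    using integrable_riesz_diff_square[of b w] b by simp
  have shift: "riesz_diff b x z - riesz_diff b y z = riesz_diff b (x - y) (z - y)" for z
    by (simp add: riesz_diff_def)
  have id: "integrable lborel (\<lambda>z. (riesz_diff b (x - y) (z - y))\<^sup>2)"
    by (subst lborel_integrable_translate) (use i[of "x - y"] in auto)
  have "riesz_diff b x z * riesz_diff b y z = ((riesz_diff b x z)\<^sup>2 + (riesz_diff b y z)\<^sup>2 - (riesz_diff b (x - y) (z - y))\<^sup>2) / 2" for z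
    unfolding shift[symmetric] by (simp add: power2_diff)
  then have "(LINT z|lborel. riesz_diff b x z * riesz_diff b y z)
     = ((LINT z|lborel. (riesz_diff b x z)\<^sup>2) + (LINT z|lborel. (riesz_diff b y z)\<^sup>2) - (LINT z|lborel. (riesz_diff b (x - y) (z - y))\<^sup>2)) / 2"
    by (simp only: Bochner_Integration.integral_divide_zero Bochner_Integration.integral_diff[OF Bochner_Integration.integrable_add[OF i i] id] Bochner_Integration.integral_add[OF i i])
  also have "(LINT z|lborel. (riesz_diff b (x - y) (z - y))\<^sup>2) = (LINT z|lborel. (riesz_diff b (x - y) z)\<^sup>2)"
    by (rule lborel_integral_translate) simp
  finally show ?thesis
    unfolding integral_riesz_diff_square_scale[OF e, of b x] integral_riesz_diff_square_scale[OF e, of b y] integral_riesz_diff_square_scale[OF e, of b "x - y"]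
    by (simp add: algebra_simps)
qed

section \<open>Gaussian regularization\<close>

text \<open>\<open>heat a\<close> is \<open>(2\<pi>)\<^sup>d\<close> times the heat kernel at time \<open>a\<close>, the Fourier integral of \<open>exp (-a |\<xi>|\<^sup>2)\<close>.\<close>

definition heat :: "real \<Rightarrow> 'a::euclidean_space \<Rightarrow> real" where
  "heat a v = (pi / a) powr (DIM('a) / 2) * exp (- (norm v)\<^sup>2 / (4 * a))"

lemma heat_measurable [measurable]: "heat a \<in> borel_measurable borel"
  unfolding heat_def by measurable

lemma heat_nonneg: "heat a v \<ge> 0"
  by (simp add: heat_def)

lemma heat_le: "a > 0 \<Longrightarrow> heat a (v :: 'a::euclidean_space) \<le> (pi / a) powr (DIM('a) / 2)"
  unfolding heat_def by (intro mult_left_le) auto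

text \<open>The mass is the same for every a, since (pi/a) (4 pi a) = (2 pi)^2. This gives bounds
  uniform in the regularization.\<close>

lemma has_bochner_integral_heat:
  fixes w :: "'a::euclidean_space"
  assumes a: "a > 0"
  shows "has_bochner_integral lborel (\<lambda>y. heat a (y - w)) ((2 * pi) ^ DIM('a))"
proof -
  have "has_bochner_integral lborel (\<lambda>y::'a. (pi / a) powr (DIM('a) / 2) * exp (- (1 / (4 * a)) * (norm y)\<^sup>2)) ((pi / a) powr (DIM('a) / 2) * (pi / (1 / (4 * a))) powr (DIM('a) / 2))"
    by (intro has_bochner_integral_mult_right gaussian_integral) (use a in auto)
  also have "(\<lambda>y::'a. (pi / a) powr (DIM('a) / 2) * exp (- (1 / (4 * a)) * (norm y)\<^sup>2)) = heat a"
    by (simp add: heat_def fun_eq_iff)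
  also have "(pi / a) powr (DIM('a) / 2) * (pi / (1 / (4 * a))) powr (DIM('a) / 2) = ((pi / a) * (pi / (1 / (4 * a)))) powr (DIM('a) / 2)"
    by (rule powr_mult[symmetric])
  also have "(pi / a) * (pi / (1 / (4 * a))) = (2 * pi)\<^sup>2"
    using a by (simp add: power2_eq_square)
  also have "(2 * pi)\<^sup>2 powr (DIM('a) / 2) = (2 * pi) ^ DIM('a)"
  proof -
    have "(2 * pi)\<^sup>2 powr (DIM('a) / 2) = ((2 * pi) powr 2) powr (DIM('a) / 2)" by (simp add: powr_realpow)
    also have "\<dots> = (2 * pi) powr DIM('a)" by (simp only: powr_powr) simp
    finally show ?thesis by (simp add: powr_realpow)
  qed
  finally have h: "has_bochner_integral lborel (heat a :: 'a \<Rightarrow> real) ((2 * pi) ^ DIM('a))" .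
  then show ?thesis
    using integrable_distr_eq[of "(+) (- w)" lborel borel "heat a"] integral_distr[of "(+) (- w)" lborel borel "heat a"]
    by (simp add: lborel_distr_plus has_bochner_integral_iff)
qed

text \<open>The Gaussian damping makes the double integral absolutely convergent, so \<xi> may be
  integrated first, which produces the heat kernel. The phase with frequency w becomes a
  translation, through which the Dirac mass at x enters later.\<close>

lemma gaussian_regularized_fourier:
  fixes \<psi> :: "'a::euclidean_space \<Rightarrow> complex"
  assumes \<psi>: "integrable lborel \<psi>" and a: "a > 0"
  shows "has_bochner_integral lborel
    (\<lambda>\<xi>. complex_of_real (exp (- a * (norm \<xi>)\<^sup>2)) * iexp (w \<bullet> \<xi>) * (CLINT y|lborel. iexp (y \<bullet> \<xi>) * \<psi> y))
    (CLINT y|lborel. \<psi> y * complex_of_real (heat a (y + w)))"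
proof -
  note [measurable] = borel_measurable_integrable[OF \<psi>]
  define K where "K y \<xi> = \<psi> y * (complex_of_real (exp (- a * (norm \<xi>)\<^sup>2)) * iexp ((y + w) \<bullet> \<xi>))" for y \<xi>
  have g: "integrable lborel (\<lambda>\<xi>::'a. complex_of_real (exp (- a * (norm \<xi>)\<^sup>2)))"
    using gaussian_integral[OF a, where 'a='a] by (simp only: has_bochner_integral_iff complex_of_real_integrable_eq)
  have K: "integrable (lborel \<Otimes>\<^sub>M lborel) (\<lambda>(y, \<xi>). K y \<xi>)"
    unfolding K_def
  proof (rule Bochner_Integration.integrable_bound)
    show "integrable (lborel \<Otimes>\<^sub>M lborel) (\<lambda>(y, \<xi>::'a). \<psi> y * complex_of_real (exp (- a * (norm \<xi>)\<^sup>2)))"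
      by (intro integrable_pair_mult lborel.sigma_finite_measure_axioms \<psi> g)
  qed (auto simp: norm_mult)
  have K1: "(CLINT y|lborel. K y \<xi>) = complex_of_real (exp (- a * (norm \<xi>)\<^sup>2)) * iexp (w \<bullet> \<xi>) * (CLINT y|lborel. iexp (y \<bullet> \<xi>) * \<psi> y)" for \<xi>
  proof -
    have "K y \<xi> = (complex_of_real (exp (- a * (norm \<xi>)\<^sup>2)) * iexp (w \<bullet> \<xi>)) * (iexp (y \<bullet> \<xi>) * \<psi> y)" for y
      by (simp only: K_def inner_add_left of_real_add distrib_left exp_add mult_ac)
    then show ?thesis by (simp only: integral_mult_right_zero)
  qed
  have K2: "(CLINT \<xi>|lborel. K y \<xi>) = \<psi> y * complex_of_real (heat a (y + w))" for y
    unfolding K_def heat_def integral_mult_right_zero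
    by (subst has_bochner_integral_integral_eq[OF gaussian_fourier[OF a]]) simp
  show ?thesis
    unfolding has_bochner_integral_iff
    using lborel_pair.integrable_snd[OF K] lborel_pair.Fubini_integral[OF K] by (simp only: K1 K2)
qed

lemma norm_iexp_minus_one_le: "cmod (iexp x - 1) \<le> \<bar>x\<bar>" "cmod (iexp x - 1) \<le> 2"
  using iexp_approx1[of x 0] norm_triangle_ineq4[of "iexp x" 1] by auto

text \<open>
  The regularized \<open>L\<^sup>2\<close> norm of the transform is a double integral against the heat kernel, bounded by
  Young's inequality; then the regularization is removed by Fatou's lemma.
\<close>

lemma square_integrable_fourier_schwartz:
  fixes \<psi> :: "real ^ 'n::finite \<Rightarrow> complex"
  assumes \<psi>: "\<psi> \<in> schwartz"
  shows "integrable lborel (\<lambda>\<xi>. (cmod (CLINT y|lborel. iexp (y \<bullet> \<xi>) * \<psi> y))\<^sup>2)"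
proof -
  note i = schwartz_integrable[OF \<psi>]
  note [measurable] = borel_measurable_integrable[OF i]
  define F where "F \<xi> = (CLINT y|lborel. iexp (y \<bullet> \<xi>) * \<psi> y)" for \<xi>
  have [measurable]: "F \<in> borel_measurable borel" unfolding F_def by measurable
  obtain B where B: "\<And>y. cmod (\<psi> y) \<le> B" using schwartz_bounded[OF \<psi>] by blast
  have sq: "integrable lborel (\<lambda>y. (cmod (\<psi> y))\<^sup>2)"
  proof (rule Bochner_Integration.integrable_bound)
    show "integrable lborel (\<lambda>y. B * cmod (\<psi> y))" using i by simp
    show "AE y in lborel. norm ((cmod (\<psi> y))\<^sup>2) \<le> norm (B * cmod (\<psi> y))"
      using B by (intro AE_I2) (simp add: power2_eq_square abs_mult, meson abs_ge_self mult_right_mono norm_ge_zero order_trans)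
  qed simp
  define N where "N = (LINT y|lborel. (cmod (\<psi> y))\<^sup>2)"
  define D where "D = (2 * pi) ^ DIM(real ^ 'n) * N"
  have D: "D \<ge> 0" by (simp add: D_def N_def)
  have reg: "(\<integral>\<^sup>+\<xi>. ennreal (exp (- a * (norm \<xi>)\<^sup>2) * (cmod (F \<xi>))\<^sup>2) \<partial>lborel) \<le> ennreal D" if a: "a > 0" for a
  proof -
    \<comment> \<open>Over y this integrates to the damped |F(\<xi>)|^2, over \<xi> to a pairing of
      the conjugate of \<psi> with a heat average of \<psi>.\<close>
    define K where "K y \<xi> = cnj (\<psi> y) * (complex_of_real (exp (- a * (norm \<xi>)\<^sup>2)) * iexp ((- y) \<bullet> \<xi>) * F \<xi>)" for y \<xi>
    have ic: "integrable lborel (\<lambda>y. cnj (\<psi> y))" using i by simp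
    note [measurable] = borel_measurable_integrable[OF ic]
    have gF: "has_bochner_integral lborel (\<lambda>\<xi>. complex_of_real (exp (- a * (norm \<xi>)\<^sup>2)) * iexp (w \<bullet> \<xi>) * F \<xi>) (CLINT y|lborel. \<psi> y * complex_of_real (heat a (y + w)))" for w
      using gaussian_regularized_fourier[OF i a] by (simp only: F_def)
    have gF0: "integrable lborel (\<lambda>\<xi>. complex_of_real (exp (- a * (norm \<xi>)\<^sup>2)) * F \<xi>)"
      using gF[of 0] by (simp add: has_bochner_integral_iff)
    have K: "integrable (lborel \<Otimes>\<^sub>M lborel) (\<lambda>(y, \<xi>). K y \<xi>)"
      unfolding K_def
    proof (rule Bochner_Integration.integrable_bound)
      show "integrable (lborel \<Otimes>\<^sub>M lborel) (\<lambda>(y, \<xi>). cnj (\<psi> y) * (complex_of_real (exp (- a * (norm \<xi>)\<^sup>2)) * F \<xi>))"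
        by (intro integrable_pair_mult lborel.sigma_finite_measure_axioms ic gF0)
    qed (auto simp: norm_mult)
    have K1: "(CLINT y|lborel. K y \<xi>) = complex_of_real (exp (- a * (norm \<xi>)\<^sup>2) * (cmod (F \<xi>))\<^sup>2)" for \<xi>
    proof -
      have "(CLINT y|lborel. K y \<xi>) = (CLINT y|lborel. (complex_of_real (exp (- a * (norm \<xi>)\<^sup>2)) * F \<xi>) * cnj (iexp (y \<bullet> \<xi>) * \<psi> y))"
        by (intro Bochner_Integration.integral_cong refl) (simp add: K_def exp_cnj mult_ac)
      also have "\<dots> = (complex_of_real (exp (- a * (norm \<xi>)\<^sup>2)) * F \<xi>) * cnj (F \<xi>)"
        by (simp only: integral_mult_right_zero Bochner_Integration.integral_cnj F_def)
      finally show ?thesis by (simp only: of_real_mult complex_norm_square mult.assoc)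
    qed
    have K2: "(CLINT \<xi>|lborel. K y \<xi>) = cnj (\<psi> y) * (CLINT z|lborel. \<psi> z * complex_of_real (heat a (z - y)))" for y
      unfolding K_def integral_mult_right_zero
      using has_bochner_integral_integral_eq[OF gF[of "- y"]] by simp
    have iL: "integrable lborel (\<lambda>\<xi>. exp (- a * (norm \<xi>)\<^sup>2) * (cmod (F \<xi>))\<^sup>2)"
      using lborel_pair.integrable_snd[OF K] by (simp only: K1 complex_of_real_integrable_eq)
    have "(LINT \<xi>|lborel. exp (- a * (norm \<xi>)\<^sup>2) * (cmod (F \<xi>))\<^sup>2) = cmod (CLINT y|lborel. CLINT \<xi>|lborel. K y \<xi>)"
      unfolding lborel_pair.Fubini_integral[OF K, symmetric] K1 integral_complex_of_real norm_of_real by simp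
    moreover have "ennreal (cmod (CLINT y|lborel. CLINT \<xi>|lborel. K y \<xi>)) \<le> ennreal D"
    proof -
      have h: "(\<integral>\<^sup>+z. ennreal (heat a (z - y)) \<partial>lborel) = ennreal ((2 * pi) ^ DIM(real ^ 'n))" for y :: "real ^ 'n"
        using has_bochner_integral_heat[OF a, of y]
        by (subst nn_integral_eq_integral) (auto simp: has_bochner_integral_iff heat_nonneg)
      have hsym: "heat a (z - y) = heat a (y - z)" for y z :: "real ^ 'n"
        by (simp add: heat_def norm_minus_commute)
      have nN: "(\<integral>\<^sup>+y. ennreal ((cmod (\<psi> y))\<^sup>2) \<partial>lborel) = ennreal N"
        unfolding N_def by (rule nn_integral_eq_integral[OF sq]) simp
      have "ennreal (cmod (CLINT y|lborel. CLINT \<xi>|lborel. K y \<xi>)) \<le> (\<integral>\<^sup>+y. ennreal (cmod (CLINT \<xi>|lborel. K y \<xi>)) \<partial>lborel)"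
        using lborel_pair.integrable_fst[OF K] by (intro integral_norm_bound_ennreal) auto
      also have "\<dots> \<le> (\<integral>\<^sup>+y. (\<integral>\<^sup>+z. ennreal ((cmod (\<psi> y))\<^sup>2 / 2) * ennreal (heat a (z - y)) + ennreal ((cmod (\<psi> z))\<^sup>2 / 2) * ennreal (heat a (z - y)) \<partial>lborel) \<partial>lborel)"
      proof (rule nn_integral_mono)
        fix y
        have ih: "integrable lborel (\<lambda>z. \<psi> z * complex_of_real (heat a (z - y)))"
        proof (rule Bochner_Integration.integrable_bound)
          show "integrable lborel (\<lambda>z. B * heat a (z - y))"
            using has_bochner_integral_heat[OF a, of y] by (simp add: has_bochner_integral_iff)
          show "AE z in lborel. norm (\<psi> z * complex_of_real (heat a (z - y))) \<le> norm (B * heat a (z - y))"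
            using B by (intro AE_I2) (simp add: norm_mult abs_mult, meson abs_ge_self abs_ge_zero mult_right_mono order_trans)
        qed measurable
        have "ennreal (cmod (CLINT \<xi>|lborel. K y \<xi>)) = ennreal (cmod (\<psi> y)) * ennreal (cmod (CLINT z|lborel. \<psi> z * complex_of_real (heat a (z - y))))"
          unfolding K2 norm_mult complex_mod_cnj by (rule ennreal_mult) auto
        also have "\<dots> \<le> ennreal (cmod (\<psi> y)) * (\<integral>\<^sup>+z. ennreal (cmod (\<psi> z * complex_of_real (heat a (z - y)))) \<partial>lborel)"
          by (intro mult_left_mono integral_norm_bound_ennreal ih) simp
        also have "\<dots> = (\<integral>\<^sup>+z. ennreal (cmod (\<psi> y)) * ennreal (cmod (\<psi> z * complex_of_real (heat a (z - y)))) \<partial>lborel)"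
          by (rule nn_integral_cmult[symmetric]) measurable
        also have "\<dots> \<le> (\<integral>\<^sup>+z. ennreal ((cmod (\<psi> y))\<^sup>2 / 2) * ennreal (heat a (z - y)) + ennreal ((cmod (\<psi> z))\<^sup>2 / 2) * ennreal (heat a (z - y)) \<partial>lborel)"
        proof (rule nn_integral_mono)
          fix z
          \<comment> \<open>This splits the double integral into two equal halves. In each of them
            the heat kernel is integrated in the variable on which \<psi> does not depend, so the
            sum is \<open>D\<close> = (2 pi)^d times the squared norm of \<psi>.\<close>
          have "cmod (\<psi> y) * cmod (\<psi> z) \<le> (cmod (\<psi> y))\<^sup>2 / 2 + (cmod (\<psi> z))\<^sup>2 / 2"
            using sum_squares_bound[of "cmod (\<psi> y)" "cmod (\<psi> z)"] by simp
          from mult_right_mono[OF this heat_nonneg[of a "z - y"]]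
          show "ennreal (cmod (\<psi> y)) * ennreal (cmod (\<psi> z * complex_of_real (heat a (z - y)))) \<le> ennreal ((cmod (\<psi> y))\<^sup>2 / 2) * ennreal (heat a (z - y)) + ennreal ((cmod (\<psi> z))\<^sup>2 / 2) * ennreal (heat a (z - y))"
            by (simp add: ennreal_mult[symmetric] ennreal_plus[symmetric] heat_nonneg norm_mult algebra_simps del: ennreal_plus)
        qed
        finally show "ennreal (cmod (CLINT \<xi>|lborel. K y \<xi>)) \<le> (\<integral>\<^sup>+z. ennreal ((cmod (\<psi> y))\<^sup>2 / 2) * ennreal (heat a (z - y)) + ennreal ((cmod (\<psi> z))\<^sup>2 / 2) * ennreal (heat a (z - y)) \<partial>lborel)" .
      qed
      also have "\<dots> = (\<integral>\<^sup>+y. ennreal ((cmod (\<psi> y))\<^sup>2 / 2) * (\<integral>\<^sup>+z. ennreal (heat a (z - y)) \<partial>lborel) \<partial>lborel) + (\<integral>\<^sup>+y. (\<integral>\<^sup>+z. ennreal ((cmod (\<psi> z))\<^sup>2 / 2) * ennreal (heat a (z - y)) \<partial>lborel) \<partial>lborel)"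
        by (subst nn_integral_add[symmetric], measurable) (simp add: nn_integral_add nn_integral_cmult)
      also have "(\<integral>\<^sup>+y. (\<integral>\<^sup>+z. ennreal ((cmod (\<psi> z))\<^sup>2 / 2) * ennreal (heat a (z - y)) \<partial>lborel) \<partial>lborel) = (\<integral>\<^sup>+z. (\<integral>\<^sup>+y. ennreal ((cmod (\<psi> z))\<^sup>2 / 2) * ennreal (heat a (z - y)) \<partial>lborel) \<partial>lborel)"
        by (rule lborel_pair.Fubini') measurable
      also have "\<dots> = (\<integral>\<^sup>+z. ennreal ((cmod (\<psi> z))\<^sup>2 / 2) * (\<integral>\<^sup>+y. ennreal (heat a (y - z)) \<partial>lborel) \<partial>lborel)"
        unfolding hsym[of _ "_ :: real ^ 'n"] by (subst nn_integral_cmult) (auto simp: hsym)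
      also have "(\<integral>\<^sup>+y. ennreal ((cmod (\<psi> y))\<^sup>2 / 2) * (\<integral>\<^sup>+z. ennreal (heat a (z - y)) \<partial>lborel) \<partial>lborel) + \<dots> = ennreal D"
      proof -
        have "(\<integral>\<^sup>+y. ennreal ((cmod (\<psi> y))\<^sup>2 / 2) * ennreal ((2 * pi) ^ DIM(real ^ 'n)) \<partial>lborel) = (\<integral>\<^sup>+y. ennreal ((2 * pi) ^ DIM(real ^ 'n) / 2) * ennreal ((cmod (\<psi> y))\<^sup>2) \<partial>lborel)"
          by (intro nn_integral_cong) (simp add: ennreal_mult[symmetric] mult_ac)
        also have "\<dots> = ennreal ((2 * pi) ^ DIM(real ^ 'n) / 2) * ennreal N"
          by (subst nn_integral_cmult) (auto simp: nN)
        finally have "(\<integral>\<^sup>+y. ennreal ((cmod (\<psi> y))\<^sup>2 / 2) * ennreal ((2 * pi) ^ DIM(real ^ 'n)) \<partial>lborel) = ennreal (D / 2)"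
          by (simp add: D_def N_def ennreal_mult[symmetric])
        then show ?thesis unfolding h using D by (simp add: ennreal_plus[symmetric] del: ennreal_plus)
      qed
      finally show ?thesis .
    qed
    ultimately show ?thesis
      by (subst nn_integral_eq_integral[OF iL]) auto
  qed
  have "(\<integral>\<^sup>+\<xi>. ennreal ((cmod (F \<xi>))\<^sup>2) \<partial>lborel) = (\<integral>\<^sup>+\<xi>. liminf (\<lambda>n. ennreal (exp (- (1 / real (Suc n)) * (norm \<xi>)\<^sup>2) * (cmod (F \<xi>))\<^sup>2)) \<partial>lborel)"
  proof (rule nn_integral_cong)
    fix \<xi> :: "real ^ 'n"
    have "(\<lambda>n. 1 / real (Suc n)) \<longlonglongrightarrow> 0" using LIMSEQ_inverse_real_of_nat by (simp add: inverse_eq_divide)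
    then have "(\<lambda>n. exp (- (1 / real (Suc n)) * (norm \<xi>)\<^sup>2) * (cmod (F \<xi>))\<^sup>2) \<longlonglongrightarrow> exp (- 0 * (norm \<xi>)\<^sup>2) * (cmod (F \<xi>))\<^sup>2"
      by (intro tendsto_intros)
    then have "(\<lambda>n. ennreal (exp (- (1 / real (Suc n)) * (norm \<xi>)\<^sup>2) * (cmod (F \<xi>))\<^sup>2)) \<longlonglongrightarrow> ennreal ((cmod (F \<xi>))\<^sup>2)"
      by (intro tendsto_ennrealI) simp
    from lim_imp_Liminf[OF _ this] show "ennreal ((cmod (F \<xi>))\<^sup>2) = liminf (\<lambda>n. ennreal (exp (- (1 / real (Suc n)) * (norm \<xi>)\<^sup>2) * (cmod (F \<xi>))\<^sup>2))"
      by simp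
  qed
  also have "\<dots> \<le> liminf (\<lambda>n. \<integral>\<^sup>+\<xi>. ennreal (exp (- (1 / real (Suc n)) * (norm \<xi>)\<^sup>2) * (cmod (F \<xi>))\<^sup>2) \<partial>lborel)"
    by (rule nn_integral_liminf) measurable
  also have "\<dots> \<le> ennreal D"
    by (rule Liminf_le) (simp, intro always_eventually allI, rule reg, simp)
  also have "\<dots> < \<infinity>" by simp
  finally show ?thesis
    unfolding F_def[symmetric] by (intro integrableI_bounded) auto
qed

section \<open>Subordination of the Riesz kernel\<close>

text \<open>The value at |v| = 1 of the integral of t^(s/2-1) \<open>heat t v\<close> over t > 0.
  For s < d it equals pi^(d/2) 2^(d-s) Gamma((d-s)/2).\<close>

definition riesz_const :: "real \<Rightarrow> real \<Rightarrow> real" where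
  "riesz_const d s = (LINT t|lborel. indicator {0<..} t * t powr (s / 2 - 1) * ((pi / t) powr (d / 2) * exp (- 1 / (4 * t))))"

text \<open>For an integer k \<ge> c, the k-th power of u \<le> 4k exp(u/(4k)) costs exactly the
  factor exp(u/4).\<close>

lemma powr_times_exp_bounded:
  fixes c u :: real
  assumes "u \<ge> 1"
  shows "u powr c * exp (- u / 4) \<le> (4 * real (nat \<lceil>\<bar>c\<bar>\<rceil> + 1)) ^ (nat \<lceil>\<bar>c\<bar>\<rceil> + 1)"
proof -
  define k where "k = nat \<lceil>\<bar>c\<bar>\<rceil> + 1"
  have k: "real k \<ge> c" "real k > 0" unfolding k_def by linarith+
  have "u powr c \<le> u powr real k" using assms k by (intro powr_mono) auto
  also have "\<dots> = u ^ k" using assms by (simp add: powr_realpow)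
  also have "\<dots> \<le> (4 * real k * exp (u / (4 * real k))) ^ k"
  proof (intro power_mono)
    have "u / (4 * real k) \<le> exp (u / (4 * real k))" using exp_ge_add_one_self[of "u / (4 * real k)"] by linarith
    then show "u \<le> 4 * real k * exp (u / (4 * real k))" using k by (simp add: field_simps)
  qed (use assms in auto)
  also have "\<dots> = (4 * real k) ^ k * exp (u / 4)"
    using k by (simp add: power_mult_distrib exp_of_nat_mult[symmetric])
  finally have "u powr c * exp (- u / 4) \<le> (4 * real k) ^ k * exp (u / 4) * exp (- u / 4)"
    by (rule mult_right_mono) simp
  also have "\<dots> = (4 * real k) ^ k" by (simp add: mult.assoc exp_add[symmetric])
  finally show ?thesis by (simp add: k_def)
qed

text \<open>The powers of t combine to t^(-c) with c = 1 + (d-s)/2. At 0 the factor exp(-1/(4t))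
  absorbs any such power; at infinity s < d makes c > 1.\<close>

lemma integrable_riesz_const:
  assumes "s < d"
  shows "integrable lborel (\<lambda>t::real. indicator {0<..} t * t powr (s / 2 - 1) * ((pi / t) powr (d / 2) * exp (- 1 / (4 * t))))"
proof -
  define c where "c = 1 + (d - s) / 2"
  define D where "D = max 1 ((4 * real (nat \<lceil>\<bar>c\<bar>\<rceil> + 1)) ^ (nat \<lceil>\<bar>c\<bar>\<rceil> + 1))"
  have eq: "t powr (s / 2 - 1) * ((pi / t) powr (d / 2) * exp (- 1 / (4 * t))) = pi powr (d / 2) * (t powr (- c) * exp (- 1 / (4 * t)))" if "t > 0" for t
  proof -
    have e: "t powr (s / 2 - 1) / t powr (d / 2) = t powr (- c)"
      unfolding powr_diff[symmetric] c_def by (simp add: diff_divide_distrib algebra_simps)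
    show ?thesis unfolding e[symmetric] by (simp add: powr_divide)
  qed
  show ?thesis
  proof (rule integrable_powr_bounds)
    show "- 1 < (0::real)" "- c < - 1" using assms by (auto simp: c_def)
    fix t :: real
    show "norm (indicator {0<..} t * t powr (s / 2 - 1) * ((pi / t) powr (d / 2) * exp (- 1 / (4 * t)))) \<le> pi powr (d / 2) * D * t powr 0" if t: "0 < t" "t \<le> 1"
    proof -
      have "t powr (- c) * exp (- 1 / (4 * t)) = (1 / t) powr c * exp (- (1 / t) / 4)"
        unfolding powr_divide powr_minus_divide by simp
      also have "\<dots> \<le> (4 * real (nat \<lceil>\<bar>c\<bar>\<rceil> + 1)) ^ (nat \<lceil>\<bar>c\<bar>\<rceil> + 1)" using t by (intro powr_times_exp_bounded) auto
      also have "\<dots> \<le> D" by (simp add: D_def)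
      finally have "t powr (- c) * exp (- 1 / (4 * t)) \<le> D" .
      then show ?thesis unfolding mult.assoc eq[OF t(1)] using t by (simp add: mult_left_mono)
    qed
    show "norm (indicator {0<..} t * t powr (s / 2 - 1) * ((pi / t) powr (d / 2) * exp (- 1 / (4 * t)))) \<le> pi powr (d / 2) * D * t powr (- c)" if t: "1 \<le> t"
    proof -
      have "t powr (- c) * exp (- 1 / (4 * t)) \<le> D * t powr (- c)"
        using mult_left_mono[of "exp (- 1 / (4 * t))" D "t powr (- c)"] t by (simp add: D_def mult.commute le_max_iff_disj)
      moreover have "t > 0" using t by simp
      ultimately show ?thesis unfolding mult.assoc eq[OF \<open>t > 0\<close>] by (simp add: mult_left_mono)
    qed
  qed auto
qed

lemma riesz_const_pos:
  assumes "s < d"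
  shows "riesz_const d s > 0"
proof -
  let ?f = "\<lambda>t::real. indicator {0<..} t * t powr (s / 2 - 1) * ((pi / t) powr (d / 2) * exp (- 1 / (4 * t)))"
  have nn: "?f t \<ge> 0" for t by simp
  have "riesz_const d s \<noteq> 0"
  proof
    assume "riesz_const d s = 0"
    then have "AE t in lborel. ?f t = 0"
      using integral_nonneg_eq_0_iff_AE[OF integrable_riesz_const[OF assms]] nn by (simp add: riesz_const_def)
    then have ae: "AE t in lborel. t \<notin> {0<..<1::real}"
      by eventually_elim (auto simp: indicator_def)
    have "emeasure lborel {0<..<1::real} = 0"
      using AE_iff_null_sets[of "{0<..<1::real}" lborel] ae by (simp add: null_sets_def)
    then show False by simp
  qed
  moreover have "riesz_const d s \<ge> 0" unfolding riesz_const_def using nn by simp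
  ultimately show ?thesis by linarith
qed

text \<open>Up to its prefactor the heat kernel depends on |v|^2/t only, so the substitution t =
  |v|^2 u reduces to |v| = 1. The exponent s - d collects s - 2 from the weight, -d from the
  prefactor and 2 from dt.\<close>

lemma heat_subordination:
  fixes s :: real and v :: "'a::euclidean_space"
  assumes s: "s < DIM('a)" and v: "v \<noteq> 0"
  shows "has_bochner_integral lborel (\<lambda>t. indicator {0<..} t * t powr (s / 2 - 1) * heat t v) (riesz_const DIM('a) s * norm v powr (s - DIM('a)))"
proof -
  let ?d = "real DIM('a)"
  let ?f = "\<lambda>t::real. indicator {0<..} t * t powr (s / 2 - 1) * ((pi / t) powr (?d / 2) * exp (- 1 / (4 * t)))"
  define r where "r = norm v"
  have r: "r > 0" using v by (simp add: r_def)
  have "has_bochner_integral lborel ?f (riesz_const ?d s)"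
    using integrable_riesz_const[OF s] by (simp add: has_bochner_integral_iff riesz_const_def)
  then have "has_bochner_integral lborel (\<lambda>t. ?f (0 + (1 / r\<^sup>2) * t)) (riesz_const ?d s /\<^sub>R \<bar>1 / r\<^sup>2\<bar>)"
    by (subst lborel_has_bochner_integral_real_affine_iff[symmetric]) (use r in auto)
  then have "has_bochner_integral lborel (\<lambda>t. r powr (s - 2 - ?d) * ?f (0 + (1 / r\<^sup>2) * t)) (r powr (s - 2 - ?d) * (riesz_const ?d s /\<^sub>R \<bar>1 / r\<^sup>2\<bar>))"
    by (rule has_bochner_integral_mult_right)
  moreover have "r powr (s - 2 - ?d) * ?f (0 + (1 / r\<^sup>2) * t) = indicator {0<..} t * t powr (s / 2 - 1) * heat t v" for t
  proof (cases "t > 0")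
    case True
    have r2: "r\<^sup>2 = r powr 2" using r by (simp add: powr_realpow)
    have e1: "(1 / r\<^sup>2 * t) powr (s / 2 - 1) = r powr (2 - s) * t powr (s / 2 - 1)"
    proof -
      have "(1 / r\<^sup>2 * t) powr (s / 2 - 1) = (r powr (- 2) * t) powr (s / 2 - 1)"
        unfolding r2 powr_minus divide_inverse by simp
      also have "\<dots> = r powr (- 2 * (s / 2 - 1)) * t powr (s / 2 - 1)"
        by (simp only: powr_mult powr_powr)
      finally show ?thesis by (simp add: algebra_simps)
    qed
    have e2: "(pi / (1 / r\<^sup>2 * t)) powr (?d / 2) = r powr ?d * (pi / t) powr (?d / 2)"
    proof -
      have "pi / (1 / r\<^sup>2 * t) = r powr 2 * (pi / t)" unfolding r2[symmetric] by simp
      then show ?thesis by (simp only: powr_mult powr_powr) simp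
    qed
    have e3: "- 1 / (4 * (1 / r\<^sup>2 * t)) = - (norm v)\<^sup>2 / (4 * t)"
      using r True by (simp add: r_def field_simps)
    have e4: "r powr (s - 2 - ?d) * (r powr (2 - s) * r powr ?d) = 1"
      using r by (simp add: powr_add[symmetric])
    have "r powr (s - 2 - ?d) * ?f (0 + (1 / r\<^sup>2) * t) = (r powr (s - 2 - ?d) * (r powr (2 - s) * r powr ?d)) * (t powr (s / 2 - 1) * heat t v)"
      using True r unfolding add_0 e1 e2 e3 heat_def by (simp add: mult_ac)
    then show ?thesis using True unfolding e4 by simp
  qed (use r in \<open>auto simp: zero_less_divide_iff\<close>)
  moreover have "r powr (s - 2 - ?d) * (riesz_const ?d s /\<^sub>R \<bar>1 / r\<^sup>2\<bar>) = riesz_const ?d s * norm v powr (s - ?d)"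
  proof -
    have "r powr (s - 2 - ?d) * r\<^sup>2 = r powr (s - ?d)"
    proof -
      have r2: "r\<^sup>2 = r powr 2" using r by (simp add: powr_realpow)
      show ?thesis unfolding r2 powr_add[symmetric] by simp
    qed
    then show ?thesis using r by (simp add: r_def mult.assoc[symmetric] mult.commute[of "riesz_const _ _"])
  qed
  ultimately show ?thesis by (simp only:)
qed

text \<open>Exchanging the t- and y-integrals needs two bounds on the heat average of |\<psi>|. For
  small t the total mass gives a bound independent of t, enough as s > 0; for large t the supremum
  of the kernel gives t^(-d/2), enough as s < d.\<close>

lemma heat_pairing_subordination:
  fixes s :: real and \<psi> :: "real ^ 'n::finite \<Rightarrow> complex"
  assumes \<psi>: "\<psi> \<in> schwartz" and s: "0 < s" "s < CARD('n)"
  shows "integrable lborel (\<lambda>y. \<psi> y * complex_of_real (riesz_const CARD('n) s * norm (y - x) powr (s - CARD('n))))" (is ?int)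
    and "has_bochner_integral lborel
      (\<lambda>t. complex_of_real (indicator {0<..} t * t powr (s / 2 - 1)) * (CLINT y|lborel. \<psi> y * complex_of_real (heat t (y - x))))
      (CLINT y|lborel. \<psi> y * complex_of_real (riesz_const CARD('n) s * norm (y - x) powr (s - CARD('n))))" (is ?has)
proof -
  note i = schwartz_integrable[OF \<psi>]
  note [measurable] = borel_measurable_integrable[OF i]
  obtain B where B: "\<And>y. cmod (\<psi> y) \<le> B" using schwartz_bounded[OF \<psi>] by blast
  define L where "L t y = complex_of_real (indicator {0<..} t * t powr (s / 2 - 1)) * (\<psi> y * complex_of_real (heat t (y - x)))" for t y
  define A where "A = (LINT y|lborel. cmod (\<psi> y))"
  have A: "A \<ge> 0" by (simp add: A_def)
  have B0: "B \<ge> 0" using order_trans[OF norm_ge_zero B] .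
  have i1: "integrable lborel (\<lambda>y. \<psi> y * complex_of_real (heat t (y - x)))" if t: "t > 0" for t
  proof (rule Bochner_Integration.integrable_bound)
    show "integrable lborel (\<lambda>y. cmod (\<psi> y) * (pi / t) powr (CARD('n) / 2))" using i by simp
    show "AE y in lborel. norm (\<psi> y * complex_of_real (heat t (y - x))) \<le> norm (cmod (\<psi> y) * (pi / t) powr (CARD('n) / 2))"
      using heat_le[OF t, of "_ :: real ^ 'n"] by (intro AE_I2) (simp add: norm_mult heat_nonneg mult_left_mono)
  qed measurable
  have b1: "(LINT y|lborel. cmod (\<psi> y * complex_of_real (heat t (y - x)))) \<le> A * (pi / t) powr (CARD('n) / 2)" if t: "t > 0" for t
  proof -
    have "(LINT y|lborel. cmod (\<psi> y * complex_of_real (heat t (y - x)))) \<le> (LINT y|lborel. cmod (\<psi> y) * (pi / t) powr (CARD('n) / 2))"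
    proof (rule integral_mono)
      show "cmod (\<psi> y * complex_of_real (heat t (y - x))) \<le> cmod (\<psi> y) * (pi / t) powr (CARD('n) / 2)" for y
        using heat_le[OF t, of "y - x"] by (simp add: norm_mult heat_nonneg mult_left_mono)
    qed (use i i1[OF t] in auto)
    then show ?thesis by (simp add: A_def)
  qed
  have b2: "(LINT y|lborel. cmod (\<psi> y * complex_of_real (heat t (y - x)))) \<le> B * (2 * pi) ^ CARD('n)" if t: "t > 0" for t
  proof -
    have "(LINT y|lborel. cmod (\<psi> y * complex_of_real (heat t (y - x)))) \<le> (LINT y|lborel. B * heat t (y - x))"
    proof (rule integral_mono)
      show "cmod (\<psi> y * complex_of_real (heat t (y - x))) \<le> B * heat t (y - x)" for y
        using B[of y] by (simp add: norm_mult heat_nonneg mult_right_mono)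
      show "integrable lborel (\<lambda>y. B * heat t (y - x))"
        using has_bochner_integral_heat[OF t, of x] by (simp add: has_bochner_integral_iff)
    qed (use i1[OF t] in auto)
    also have "\<dots> = B * (2 * pi) ^ CARD('n)"
      using has_bochner_integral_heat[OF t, of x] by (simp add: has_bochner_integral_iff)
    finally show ?thesis .
  qed
  have L: "integrable (lborel \<Otimes>\<^sub>M lborel) (\<lambda>(t, y). L t y)"
  proof (rule lborel_pair.Fubini_integrable)
    show Lm: "(\<lambda>(t, y). L t y) \<in> borel_measurable (lborel \<Otimes>\<^sub>M lborel)"
      unfolding L_def heat_def by measurable
    have nL: "(LINT y|lborel. norm (L t y)) = indicator {0<..} t * t powr (s / 2 - 1) * (LINT y|lborel. cmod (\<psi> y * complex_of_real (heat t (y - x))))" for t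
      unfolding L_def norm_mult[of "complex_of_real _"] norm_of_real integral_mult_right_zero by simp
    have "integrable lborel (\<lambda>t. LINT y|lborel. norm (L t y))"
    proof (rule integrable_powr_bounds)
      show "- 1 < s / 2 - 1" "s / 2 - 1 - CARD('n) / 2 < - 1" using s by auto
      show "(\<lambda>t. LINT y|lborel. norm (L t y)) \<in> borel_measurable borel"
        using lborel.borel_measurable_lebesgue_integral[of "\<lambda>t y. norm (L t y)" lborel] Lm by simp
      define C where "C = max (B * (2 * pi) ^ CARD('n)) (A * pi powr (CARD('n) / 2))"
      show "(LINT y|lborel. norm (L t y)) = 0" if "t \<le> 0" for t
        unfolding nL using that by simp
      show "norm (LINT y|lborel. norm (L t y)) \<le> C * t powr (s / 2 - 1)" if t: "0 < t" "t \<le> 1" for t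
      proof -
        have "(LINT y|lborel. norm (L t y)) \<le> t powr (s / 2 - 1) * (B * (2 * pi) ^ CARD('n))"
          unfolding nL using t b2[OF t(1)] by (simp add: mult_left_mono)
        also have "\<dots> \<le> t powr (s / 2 - 1) * C" by (intro mult_left_mono) (auto simp: C_def)
        finally show ?thesis by (simp add: mult.commute)
      qed
      show "norm (LINT y|lborel. norm (L t y)) \<le> C * t powr (s / 2 - 1 - CARD('n) / 2)" if t: "1 \<le> t" for t
      proof -
        have "(LINT y|lborel. norm (L t y)) \<le> t powr (s / 2 - 1) * (A * (pi / t) powr (CARD('n) / 2))"
          unfolding nL using t b1[of t] by (simp add: mult_left_mono)
        also have "\<dots> = (A * pi powr (CARD('n) / 2)) * t powr (s / 2 - 1 - CARD('n) / 2)"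
          by (simp add: powr_divide powr_diff)
        also have "\<dots> \<le> C * t powr (s / 2 - 1 - CARD('n) / 2)" by (intro mult_right_mono) (auto simp: C_def)
        finally show ?thesis by simp
      qed
    qed
    then show "integrable lborel (\<lambda>t. LINT y|lborel. norm (case (t, y) of (t, y) \<Rightarrow> L t y))" by simp
    show "AE t in lborel. integrable lborel (\<lambda>y. case (t, y) of (t, y) \<Rightarrow> L t y)"
    proof (rule AE_I2)
      fix t :: real
      show "integrable lborel (\<lambda>y. case (t, y) of (t, y) \<Rightarrow> L t y)"
        using i1[of t] by (cases "t > 0") (auto simp: L_def)
    qed
  qed
  have L1: "(CLINT y|lborel. L t y) = complex_of_real (indicator {0<..} t * t powr (s / 2 - 1)) * (CLINT y|lborel. \<psi> y * complex_of_real (heat t (y - x)))" for t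
    unfolding L_def by (rule integral_mult_right_zero)
  have L2: "(CLINT t|lborel. L t y) = \<psi> y * complex_of_real (riesz_const CARD('n) s * norm (y - x) powr (s - CARD('n)))" if "y \<noteq> x" for y
  proof -
    have "(CLINT t|lborel. L t y) = (CLINT t|lborel. \<psi> y * complex_of_real (indicator {0<..} t * t powr (s / 2 - 1) * heat t (y - x)))"
      unfolding L_def by (intro Bochner_Integration.integral_cong refl) (simp only: of_real_mult mult_ac)
    also have "\<dots> = \<psi> y * complex_of_real (riesz_const CARD('n) s * norm (y - x) powr (s - CARD('n)))"
      unfolding integral_mult_right_zero integral_complex_of_real
      using has_bochner_integral_integral_eq[OF heat_subordination[of s "y - x"]] s that by simp
    finally show ?thesis .
  qed
  have ae: "AE y in lborel. (CLINT t|lborel. L t y) = \<psi> y * complex_of_real (riesz_const CARD('n) s * norm (y - x) powr (s - CARD('n)))"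
    using AE_lborel_singleton[of x] by eventually_elim (rule L2)
  have Lm2: "(\<lambda>y. CLINT t|lborel. L t y) \<in> borel_measurable lborel"
    using lborel_pair.integrable_snd[OF L] by (rule borel_measurable_integrable)
  have rm: "(\<lambda>y. \<psi> y * complex_of_real (riesz_const CARD('n) s * norm (y - x) powr (s - CARD('n)))) \<in> borel_measurable lborel"
    by measurable
  show ?int
    using integrable_cong_AE[OF Lm2 rm ae] lborel_pair.integrable_snd[OF L] by simp
  have "(CLINT t|lborel. CLINT y|lborel. L t y) = (CLINT y|lborel. CLINT t|lborel. L t y)"
    by (rule lborel_pair.Fubini_integral[OF L, symmetric])
  moreover have "(CLINT y|lborel. CLINT t|lborel. L t y) = (CLINT y|lborel. \<psi> y * complex_of_real (riesz_const CARD('n) s * norm (y - x) powr (s - CARD('n))))"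
    by (rule integral_cong_AE[OF Lm2 rm ae])
  moreover have "integrable lborel (\<lambda>t. CLINT y|lborel. L t y)"
    using lborel_pair.integrable_fst[OF L] .
  ultimately show ?has
    unfolding has_bochner_integral_iff L1 by simp
qed

section \<open>The Fourier symbol of the field at a Dirac difference\<close>

definition riesz_symbol :: "real \<Rightarrow> 'a::euclidean_space \<Rightarrow> 'a \<Rightarrow> complex" where
  "riesz_symbol s x \<xi> = complex_of_real (norm \<xi> powr (- s)) * (iexp ((- x) \<bullet> \<xi>) - 1)"

lemma riesz_symbol_measurable [measurable]: "riesz_symbol s x \<in> borel_measurable borel"
  unfolding riesz_symbol_def by measurable

text \<open>Near 0 the phase difference is at most |x| |\<xi>|, so the square is of order
  |\<xi>|^(2-2s) with 2s - 2 < d. At infinity the phase difference is at most 2, and 2s > d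
  suffices.\<close>

lemma integrable_riesz_symbol_square:
  fixes s :: real and x :: "'a::euclidean_space"
  assumes s: "1 < s" "DIM('a) < 2 * s" "2 * s < real DIM('a) + 2"
  shows "integrable lborel (\<lambda>\<xi>. (cmod (riesz_symbol s x \<xi>))\<^sup>2)"
proof (rule integrable_radial_bounds[where p = "2 * s - 2" and q = "2 * s" and \<rho> = 1 and C = "(norm x)\<^sup>2" and D = 4])
  have sq: "(norm \<xi> powr (- s))\<^sup>2 = norm \<xi> powr (- (2 * s))" for \<xi> :: 'a
    by (simp add: power2_eq_square powr_add[symmetric])
  have eq: "norm ((cmod (riesz_symbol s x \<xi>))\<^sup>2) = norm \<xi> powr (- (2 * s)) * (cmod (iexp ((- x) \<bullet> \<xi>) - 1))\<^sup>2" for \<xi>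
    unfolding riesz_symbol_def by (simp add: norm_mult power_mult_distrib sq)
  fix \<xi> :: 'a
  show "norm ((cmod (riesz_symbol s x \<xi>))\<^sup>2) \<le> (norm x)\<^sup>2 * norm \<xi> powr (- (2 * s - 2))" if "\<xi> \<noteq> 0" "norm \<xi> \<le> 1"
  proof -
    have "cmod (iexp ((- x) \<bullet> \<xi>) - 1) \<le> norm x * norm \<xi>"
      using norm_iexp_minus_one_le(1)[of "(- x) \<bullet> \<xi>"] Cauchy_Schwarz_ineq2[of "- x" \<xi>] by simp
    then have "(cmod (iexp ((- x) \<bullet> \<xi>) - 1))\<^sup>2 \<le> (norm x * norm \<xi>)\<^sup>2" by (intro power_mono) auto
    then have "norm \<xi> powr (- (2 * s)) * (cmod (iexp ((- x) \<bullet> \<xi>) - 1))\<^sup>2 \<le> norm \<xi> powr (- (2 * s)) * (norm x * norm \<xi>)\<^sup>2"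
      by (rule mult_left_mono) simp
    also have "\<dots> = (norm x)\<^sup>2 * (norm \<xi> powr (- (2 * s)) * norm \<xi> powr 2)"
      using that by (simp add: power_mult_distrib powr_realpow)
    also have "norm \<xi> powr (- (2 * s)) * norm \<xi> powr 2 = norm \<xi> powr (- (2 * s - 2))"
      unfolding powr_add[symmetric] by simp
    finally show ?thesis unfolding eq .
  qed
  show "norm ((cmod (riesz_symbol s x \<xi>))\<^sup>2) \<le> 4 * norm \<xi> powr (- (2 * s))"
  proof -
    have "(cmod (iexp ((- x) \<bullet> \<xi>) - 1))\<^sup>2 \<le> 2\<^sup>2" by (intro power_mono norm_iexp_minus_one_le) auto
    then have "norm \<xi> powr (- (2 * s)) * (cmod (iexp ((- x) \<bullet> \<xi>) - 1))\<^sup>2 \<le> norm \<xi> powr (- (2 * s)) * 2\<^sup>2"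
      by (rule mult_left_mono) simp
    also have "\<dots> = 4 * norm \<xi> powr (- (2 * s))" by simp
    finally show ?thesis unfolding eq .
  qed
qed (use s in auto)

text \<open>Gamma subordination replaces |\<xi>|^(-s) by Gaussians; each is transformed into a heat
  kernel, and heat subordination recombines these into Riesz kernels. Absolute convergence of the
  exchange rests on the symbol and F both being square integrable. It is carried out for the whole
  difference because |\<xi>|^(-s) alone is not square integrable near 0; only after the
  \<xi>-integration are the two terms separated.\<close>

theorem riesz_symbol_pairing:
  fixes s :: real and \<psi> :: "real ^ 'n::finite \<Rightarrow> complex"
  assumes \<psi>: "\<psi> \<in> schwartz" and s: "1 < s" "CARD('n) < 2 * s" "2 * s < real CARD('n) + 2" "s < CARD('n)"
  shows "(CLINT \<xi>|lborel. riesz_symbol s x \<xi> * (CLINT y|lborel. iexp (y \<bullet> \<xi>) * \<psi> y)) =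
    complex_of_real (riesz_const CARD('n) s / Gamma (s / 2)) * (CLINT y|lborel. complex_of_real (riesz_diff (CARD('n) - s) x y) * \<psi> y)"
proof -
  note i = schwartz_integrable[OF \<psi>]
  note [measurable] = borel_measurable_integrable[OF i]
  define F where "F \<xi> = (CLINT y|lborel. iexp (y \<bullet> \<xi>) * \<psi> y)" for \<xi>
  have Fm[measurable]: "F \<in> borel_measurable borel" unfolding F_def by measurable
  have G: "Gamma (s / 2) > 0" using s by (intro Gamma_real_pos) auto
  have F2: "integrable lborel (\<lambda>\<xi>. (cmod (F \<xi>))\<^sup>2)"
    using square_integrable_fourier_schwartz[OF \<psi>] by (simp only: F_def)
  have m2: "integrable lborel (\<lambda>\<xi>. (cmod (riesz_symbol s x \<xi>))\<^sup>2)"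
    by (rule integrable_riesz_symbol_square) (use s in auto)
  have mF: "integrable lborel (\<lambda>\<xi>. riesz_symbol s x \<xi> * F \<xi>)"
  proof (rule Bochner_Integration.integrable_bound[OF Bochner_Integration.integrable_add[OF m2 F2]])
    show "AE \<xi> in lborel. norm (riesz_symbol s x \<xi> * F \<xi>) \<le> norm ((cmod (riesz_symbol s x \<xi>))\<^sup>2 + (cmod (F \<xi>))\<^sup>2)"
    proof (rule AE_I2)
      fix \<xi>
      have "p * q \<le> p\<^sup>2 + q\<^sup>2" if "0 \<le> p" "0 \<le> q" for p q :: real
        using sum_squares_bound[of p q] mult_nonneg_nonneg[OF that] by linarith
      then show "norm (riesz_symbol s x \<xi> * F \<xi>) \<le> norm ((cmod (riesz_symbol s x \<xi>))\<^sup>2 + (cmod (F \<xi>))\<^sup>2)"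
        by (simp add: norm_mult)
    qed
  qed measurable
  define K where "K \<xi> t = complex_of_real (indicator {0<..} t * t powr (s / 2 - 1) * exp (- (norm \<xi>)\<^sup>2 * t)) * ((iexp ((- x) \<bullet> \<xi>) - 1) * F \<xi>)" for \<xi> t
  have sub: "has_bochner_integral lborel (\<lambda>t. indicator {0<..} t * t powr (s / 2 - 1) * exp (- (norm \<xi>)\<^sup>2 * t)) (Gamma (s / 2) * norm \<xi> powr (- s))" if "\<xi> \<noteq> 0" for \<xi> :: "real ^ 'n"
  proof -
    have "(norm \<xi>)\<^sup>2 powr (- (s / 2)) = norm \<xi> powr (- s)"
      using that by (simp add: powr_powr flip: powr_numeral)
    then show ?thesis using gamma_subordination[of "s / 2" "(norm \<xi>)\<^sup>2"] s that by simp
  qed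
  \<comment> \<open>At \<xi> = 0 the subordination integral diverges, but the phase difference is 0
    there.\<close>
  have K0: "K 0 t = 0" for t by (simp add: K_def)
  have K1: "(CLINT t|lborel. K \<xi> t) = complex_of_real (Gamma (s / 2)) * (riesz_symbol s x \<xi> * F \<xi>)" for \<xi>
  proof (cases "\<xi> = 0")
    case False
    then show ?thesis
      unfolding K_def integral_mult_left_zero integral_complex_of_real has_bochner_integral_integral_eq[OF sub[OF False]]
      by (simp add: riesz_symbol_def)
  qed (simp add: K0 riesz_symbol_def)
  have K1n: "(LINT t|lborel. norm (K \<xi> t)) = Gamma (s / 2) * cmod (riesz_symbol s x \<xi> * F \<xi>)" for \<xi>
  proof (cases "\<xi> = 0")
    case False
    have "norm (K \<xi> t) = (indicator {0<..} t * t powr (s / 2 - 1) * exp (- (norm \<xi>)\<^sup>2 * t)) * cmod ((iexp ((- x) \<bullet> \<xi>) - 1) * F \<xi>)" for t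
      unfolding K_def norm_mult[of "complex_of_real _"] norm_of_real by simp
    then show ?thesis
      by (simp only: integral_mult_left_zero has_bochner_integral_integral_eq[OF sub[OF False]])
        (simp add: riesz_symbol_def norm_mult)
  qed (simp add: K0 riesz_symbol_def)
  have K: "integrable (lborel \<Otimes>\<^sub>M lborel) (\<lambda>(\<xi>, t). K \<xi> t)"
  proof (rule lborel_pair.Fubini_integrable)
    show "(\<lambda>(\<xi>, t). K \<xi> t) \<in> borel_measurable (lborel \<Otimes>\<^sub>M lborel)"
      unfolding K_def by measurable
    show "integrable lborel (\<lambda>\<xi>. LINT t|lborel. norm (case (\<xi>, t) of (\<xi>, t) \<Rightarrow> K \<xi> t))"
      using mF by (simp only: prod.case K1n) simp
    show "AE \<xi> in lborel. integrable lborel (\<lambda>t. case (\<xi>, t) of (\<xi>, t) \<Rightarrow> K \<xi> t)"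
    proof (rule AE_I2)
      fix \<xi> :: "real ^ 'n"
      show "integrable lborel (\<lambda>t. case (\<xi>, t) of (\<xi>, t) \<Rightarrow> K \<xi> t)"
      proof (cases "\<xi> = 0")
        case False
        have "integrable lborel (\<lambda>t. complex_of_real (indicator {0<..} t * t powr (s / 2 - 1) * exp (- (norm \<xi>)\<^sup>2 * t)))"
          using sub[OF False] by (simp only: complex_of_real_integrable_eq has_bochner_integral_iff)
        then show ?thesis unfolding prod.case K_def by (rule integrable_mult_left)
      qed (simp add: K0)
    qed
  qed
  define A where "A w t = complex_of_real (indicator {0<..} t * t powr (s / 2 - 1)) * (CLINT y|lborel. \<psi> y * complex_of_real (heat t (y - w)))" for w t
  have K2: "(CLINT \<xi>|lborel. K \<xi> t) = A x t - A 0 t" for t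
  proof (cases "t > 0")
    case True
    define E where "E w \<xi> = complex_of_real (exp (- t * (norm \<xi>)\<^sup>2)) * iexp (w \<bullet> \<xi>) * F \<xi>" for w \<xi>
    have E: "has_bochner_integral lborel (E w) (CLINT y|lborel. \<psi> y * complex_of_real (heat t (y + w)))" for w
      using gaussian_regularized_fourier[OF i True] by (simp only: E_def[abs_def] F_def)
    have "K \<xi> t = complex_of_real (indicator {0<..} t * t powr (s / 2 - 1)) * (E (- x) \<xi> - E 0 \<xi>)" for \<xi>
      by (simp add: K_def E_def algebra_simps)
    then have "(CLINT \<xi>|lborel. K \<xi> t) = complex_of_real (indicator {0<..} t * t powr (s / 2 - 1)) * ((CLINT \<xi>|lborel. E (- x) \<xi>) - (CLINT \<xi>|lborel. E 0 \<xi>))"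
      using E by (simp only: integral_mult_right_zero) (subst Bochner_Integration.integral_diff, auto simp: has_bochner_integral_iff)
    also have "\<dots> = A x t - A 0 t"
      unfolding has_bochner_integral_integral_eq[OF E] A_def by (simp add: right_diff_distrib)
    finally show ?thesis .
  qed (simp add: K_def A_def)
  have A: "has_bochner_integral lborel (A w) (CLINT y|lborel. \<psi> y * complex_of_real (riesz_const CARD('n) s * norm (y - w) powr (s - CARD('n))))" for w
    unfolding A_def by (rule heat_pairing_subordination[OF \<psi>]) (use s in auto)
  have iA: "integrable lborel (\<lambda>y. \<psi> y * complex_of_real (riesz_const CARD('n) s * norm (y - w) powr (s - CARD('n))))" for w
    by (rule heat_pairing_subordination[OF \<psi>]) (use s in auto)
  have "complex_of_real (Gamma (s / 2)) * (CLINT \<xi>|lborel. riesz_symbol s x \<xi> * F \<xi>) = (CLINT \<xi>|lborel. CLINT t|lborel. K \<xi> t)"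
    unfolding K1 by simp
  moreover have "(CLINT \<xi>|lborel. CLINT t|lborel. K \<xi> t) = (CLINT t|lborel. CLINT \<xi>|lborel. K \<xi> t)"
    by (rule lborel_pair.Fubini_integral[OF K, symmetric])
  moreover have "(CLINT t|lborel. CLINT \<xi>|lborel. K \<xi> t) = (CLINT t|lborel. A x t) - (CLINT t|lborel. A 0 t)"
    unfolding K2 using A by (intro Bochner_Integration.integral_diff) (auto simp: has_bochner_integral_iff)
  moreover have "\<dots> = (CLINT y|lborel. \<psi> y * complex_of_real (riesz_const CARD('n) s * norm (y - x) powr (s - CARD('n))) - \<psi> y * complex_of_real (riesz_const CARD('n) s * norm (y - 0) powr (s - CARD('n))))"
    unfolding has_bochner_integral_integral_eq[OF A] by (rule Bochner_Integration.integral_diff[OF iA iA, symmetric])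
  moreover have "\<dots> = (CLINT y|lborel. complex_of_real (riesz_const CARD('n) s) * (complex_of_real (riesz_diff (CARD('n) - s) x y) * \<psi> y))"
    by (intro Bochner_Integration.integral_cong refl) (simp add: riesz_diff_def algebra_simps)
  moreover have "\<dots> = complex_of_real (riesz_const CARD('n) s) * (CLINT y|lborel. complex_of_real (riesz_diff (CARD('n) - s) x y) * \<psi> y)"
    by (rule integral_mult_right_zero)
  ultimately have "complex_of_real (Gamma (s / 2)) * (CLINT \<xi>|lborel. riesz_symbol s x \<xi> * F \<xi>) =
     complex_of_real (riesz_const CARD('n) s) * (CLINT y|lborel. complex_of_real (riesz_diff (CARD('n) - s) x y) * \<psi> y)"
    by (simp only:)
  then show ?thesis
    using G unfolding F_def[symmetric] by (simp add: field_simps)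
qed

text \<open>A Gaussian mollification of the Dirac difference. Both bumps have mass one, and the
  transform is that of the Dirac difference times a Gaussian which tends to 1 as a grows.\<close>

lemma fourier_gaussian_difference:
  fixes x :: "real ^ 'n::finite"
  assumes a: "a > 0"
  defines "g \<equiv> \<lambda>y. (a / pi) powr (CARD('n) / 2) * (exp (- a * (norm (y - x))\<^sup>2) - exp (- a * (norm y)\<^sup>2))"
  shows "g \<in> schwartz"
    and "fourier (\<lambda>y. complex_of_real (g y)) \<xi> = (iexp ((- x) \<bullet> \<xi>) - 1) * complex_of_real (exp (- (norm \<xi>)\<^sup>2 / (4 * a)))"
proof -
  let ?c = "(a / pi) powr (CARD('n) / 2)"
  have "(\<lambda>y. complex_of_real (g y)) \<in> gaussian_polys"
  proof -
    let ?e = "\<lambda>b y. exp (complex_of_real (- a * (norm (y :: real ^ 'n))\<^sup>2 + b \<bullet> y) + \<i> * complex_of_real (0 \<bullet> y))"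
    have "(\<lambda>y. complex_of_real (?c * exp (- a * (norm x)\<^sup>2)) * ?e ((2 * a) *\<^sub>R x) y + complex_of_real (- ?c) * ?e 0 y) \<in> gaussian_polys"
      by (intro gaussian_polys.intros a)
    also have "(\<lambda>y. complex_of_real (?c * exp (- a * (norm x)\<^sup>2)) * ?e ((2 * a) *\<^sub>R x) y + complex_of_real (- ?c) * ?e 0 y) = (\<lambda>y. complex_of_real (g y))"
    proof
      fix y :: "real ^ 'n"
      have "- a * (norm (y - x))\<^sup>2 = - a * (norm x)\<^sup>2 + (- a * (norm y)\<^sup>2 + ((2 * a) *\<^sub>R x) \<bullet> y)"
        unfolding power2_norm_eq_inner by (simp add: inner_diff_left inner_diff_right inner_commute algebra_simps)
      then have "exp (- a * (norm (y - x))\<^sup>2) = exp (- a * (norm x)\<^sup>2) * exp (- a * (norm y)\<^sup>2 + ((2 * a) *\<^sub>R x) \<bullet> y)"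
        by (simp only: exp_add)
      then show "complex_of_real (?c * exp (- a * (norm x)\<^sup>2)) * ?e ((2 * a) *\<^sub>R x) y + complex_of_real (- ?c) * ?e 0 y = complex_of_real (g y)"
        unfolding g_def inner_zero_left of_real_0 mult_zero_right add_0_right exp_of_real of_real_mult[symmetric] of_real_add[symmetric]
        by (simp only: right_diff_distrib mult.assoc) simp
    qed
    finally show ?thesis .
  qed
  then have "(\<lambda>y. complex_of_real (g y)) \<in> schwartz" using gaussian_polys_schwartz by blast
  from schwartz_bounded_linear[OF bounded_linear_Re this] show "g \<in> schwartz" by simp
  have e: "exp (- \<i> * complex_of_real r) = iexp (- r)" for r by simp
  define E where "E z = complex_of_real (exp (- a * (norm z)\<^sup>2)) * iexp ((- \<xi>) \<bullet> z)" for z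
  have E: "has_bochner_integral lborel E (complex_of_real ((pi / a) powr (CARD('n) / 2) * exp (- (norm \<xi>)\<^sup>2 / (4 * a))))"
    using gaussian_fourier[OF a, of "- \<xi>"] by (simp add: E_def[abs_def])
  have Em[measurable]: "E \<in> borel_measurable borel" unfolding E_def by measurable
  have Ex: "integrable lborel (\<lambda>y. E (y - x))"
    by (subst lborel_integrable_translate) (use E in \<open>auto simp: has_bochner_integral_iff\<close>)
  have "exp (- \<i> * complex_of_real (y \<bullet> \<xi>)) * complex_of_real (g y) = complex_of_real ?c * (iexp ((- x) \<bullet> \<xi>) * E (y - x) - E y)" for y
  proof -
    have "iexp ((- x) \<bullet> \<xi>) * iexp ((- \<xi>) \<bullet> (y - x)) = iexp (- (y \<bullet> \<xi>))"
      unfolding exp_add[symmetric] by (simp add: inner_diff_right inner_commute algebra_simps)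
    then have "iexp ((- x) \<bullet> \<xi>) * E (y - x) = complex_of_real (exp (- a * (norm (y - x))\<^sup>2)) * iexp (- (y \<bullet> \<xi>))"
      unfolding E_def by (subst mult.left_commute) (simp only:)
    moreover have "E y = complex_of_real (exp (- a * (norm y)\<^sup>2)) * iexp (- (y \<bullet> \<xi>))"
      unfolding E_def by (simp add: inner_commute)
    ultimately show ?thesis
      unfolding e g_def by (simp only: of_real_mult of_real_diff left_diff_distrib right_diff_distrib mult_ac)
  qed
  then have "fourier (\<lambda>y. complex_of_real (g y)) \<xi> = complex_of_real ?c * (CLINT y|lborel. iexp ((- x) \<bullet> \<xi>) * E (y - x) - E y)"
    unfolding fourier_def by (simp only: integral_mult_right_zero)
  also have "(CLINT y|lborel. iexp ((- x) \<bullet> \<xi>) * E (y - x) - E y) = iexp ((- x) \<bullet> \<xi>) * (CLINT y|lborel. E (y - x)) - (CLINT y|lborel. E y)"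
    by (subst Bochner_Integration.integral_diff) (use E Ex in \<open>auto simp: has_bochner_integral_iff\<close>)
  also have "(CLINT y|lborel. E (y - x)) = (CLINT y|lborel. E y)" by (rule lborel_integral_translate) simp
  also have "(CLINT y|lborel. E y) = complex_of_real ((pi / a) powr (CARD('n) / 2) * exp (- (norm \<xi>)\<^sup>2 / (4 * a)))"
    by (rule has_bochner_integral_integral_eq[OF E])
  also have "complex_of_real ?c * (iexp ((- x) \<bullet> \<xi>) * complex_of_real ((pi / a) powr (CARD('n) / 2) * exp (- (norm \<xi>)\<^sup>2 / (4 * a))) - complex_of_real ((pi / a) powr (CARD('n) / 2) * exp (- (norm \<xi>)\<^sup>2 / (4 * a))))
     = complex_of_real (?c * (pi / a) powr (CARD('n) / 2)) * ((iexp ((- x) \<bullet> \<xi>) - 1) * complex_of_real (exp (- (norm \<xi>)\<^sup>2 / (4 * a))))"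
    by (simp only: of_real_mult left_diff_distrib right_diff_distrib mult_1 mult_ac)
  also have "?c * (pi / a) powr (CARD('n) / 2) = 1"
    using a by (simp add: powr_mult[symmetric])
  finally show "fourier (\<lambda>y. complex_of_real (g y)) \<xi> = (iexp ((- x) \<bullet> \<xi>) - 1) * complex_of_real (exp (- (norm \<xi>)\<^sup>2 / (4 * a)))"
    by simp
qed

section \<open>The Dirac difference as an element of the test space\<close>

lemma represented_by_fourier_dirac_diff:
  fixes x :: "real ^ 'n::finite"
  shows "represented_by (fourier_dist (\<lambda>\<psi>. dirac x \<psi> - dirac 0 \<psi>)) (\<lambda>\<xi>. iexp ((- x) \<bullet> \<xi>) - 1)"
  unfolding represented_by_def
proof (intro conjI ballI)
  show "(\<lambda>\<xi>. iexp ((- x) \<bullet> \<xi>) - 1) \<in> borel_measurable borel" by measurable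
  fix \<psi> :: "real ^ 'n \<Rightarrow> complex" assume \<psi>: "\<psi> \<in> schwartz"
  note i = schwartz_integrable[OF \<psi>]
  note [measurable] = borel_measurable_integrable[OF i]
  have ix: "integrable lborel (\<lambda>\<xi>. iexp ((- x) \<bullet> \<xi>) * \<psi> \<xi>)"
    by (rule Bochner_Integration.integrable_bound[OF i]) (auto simp: norm_mult)
  show "integrable lborel (\<lambda>\<xi>. (iexp ((- x) \<bullet> \<xi>) - 1) * \<psi> \<xi>)"
    unfolding left_diff_distrib mult_1 by (rule Bochner_Integration.integrable_diff[OF ix i])
  have "fourier \<psi> x = (CLINT \<xi>|lborel. iexp ((- x) \<bullet> \<xi>) * \<psi> \<xi>)" "fourier \<psi> 0 = (CLINT \<xi>|lborel. \<psi> \<xi>)"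
    by (simp_all add: fourier_def inner_commute)
  then show "fourier_dist (\<lambda>\<psi>. dirac x \<psi> - dirac 0 \<psi>) \<psi> = dist_of_fun (\<lambda>\<xi>. iexp ((- x) \<bullet> \<xi>) - 1) \<psi>"
    unfolding fourier_dist_def dirac_def dist_of_fun_def left_diff_distrib mult_1
    by (simp only: Bochner_Integration.integral_diff[OF ix i])
qed

lemma tempered_distribution_dirac_diff:
  "tempered_distribution (\<lambda>\<psi>. dirac (x :: real ^ 'n::finite) \<psi> - dirac 0 \<psi>)"
  unfolding tempered_distribution_def
proof (intro conjI ballI allI exI)
  fix \<phi> :: "real ^ 'n \<Rightarrow> complex" assume \<phi>: "\<phi> \<in> schwartz"
  \<comment> \<open>Dirac masses have order zero: the supremum norm alone controls them, which fixes
    N = 0 and C = 2.\<close>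
  have "{is. length is \<le> 0} = {[] :: 'n list}" by auto
  then have eq: "(\<Sum>k\<le>0::nat. \<Sum>is\<in>{is. length is \<le> 0}. schwartz_seminorm k is \<phi>) = (SUP y. cmod (\<phi> y))"
    by (simp add: schwartz_seminorm_def)
  obtain B where B: "\<And>y. cmod (\<phi> y) \<le> B" using schwartz_bounded[OF \<phi>] by blast
  have le: "cmod (\<phi> y) \<le> (SUP y. cmod (\<phi> y))" for y
    by (rule cSUP_upper) (use B in \<open>auto simp: bdd_above_def\<close>)
  show "cmod (dirac x \<phi> - dirac 0 \<phi>) \<le> 2 * (\<Sum>k\<le>0::nat. \<Sum>is\<in>{is. length is \<le> 0}. schwartz_seminorm k is \<phi>)"
    unfolding eq dirac_def using norm_triangle_ineq4[of "\<phi> x" "\<phi> 0"] le[of x] le[of 0] by linarith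
qed (auto simp: dirac_def algebra_simps)

text \<open>As 0 < s - d/2 < 1, the only moment condition is the one of order zero, and it holds
  because the two bumps of the mollified difference have equal mass. The weighted distance to the
  limit is the squared symbol times a factor between 0 and 1 that tends to 0, so dominated
  convergence applies.\<close>

theorem dirac_diff_in_fgf_test_space:
  fixes s :: real and x :: "real ^ 'n::finite"
  assumes s: "1 < s" "CARD('n) < 2 * s" "2 * s < real CARD('n) + 2"
  shows "(\<lambda>\<psi>. dirac x \<psi> - dirac 0 \<psi>) \<in> fgf_test_space s"
  unfolding fgf_test_space_def
proof (intro CollectI conjI exI allI impI)
  show "tempered_distribution (\<lambda>\<psi>. dirac x \<psi> - dirac 0 \<psi>)" by (rule tempered_distribution_dirac_diff)
  show "represented_by (fourier_dist (\<lambda>\<psi>. dirac x \<psi> - dirac 0 \<psi>)) (\<lambda>\<xi>. iexp ((- x) \<bullet> \<xi>) - 1)"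
    by (rule represented_by_fourier_dirac_diff)
  fix \<epsilon> :: real assume \<epsilon>: "\<epsilon> > 0"
  define g where "g n y = (real (Suc n) / pi) powr (CARD('n) / 2) * (exp (- real (Suc n) * (norm (y - x))\<^sup>2) - exp (- real (Suc n) * (norm y)\<^sup>2))" for n and y :: "real ^ 'n"
  have gS: "g n \<in> schwartz"
    and gF: "fourier (\<lambda>y. complex_of_real (g n y)) \<xi> = (iexp ((- x) \<bullet> \<xi>) - 1) * complex_of_real (exp (- (norm \<xi>)\<^sup>2 / (4 * real (Suc n))))" for n \<xi>
    using fourier_gaussian_difference[of "real (Suc n)" x] by (simp_all only: g_def[abs_def])
  have gV: "g n \<in> schwartz_vanishing (s - CARD('n) / 2)" for n
    unfolding schwartz_vanishing_def
  proof (intro CollectI conjI allI impI gS)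
    fix \<alpha> :: "'n \<Rightarrow> nat" assume "real (\<Sum>i\<in>UNIV. \<alpha> i) \<le> s - CARD('n) / 2"
    then have "real (\<Sum>i\<in>UNIV. \<alpha> i) < 1" using s by simp
    then have "(\<Sum>i\<in>UNIV. \<alpha> i) = 0" by linarith
    then have "\<alpha> i = 0" for i by simp
    then have "complex_of_real (LINT y|lborel. (\<Prod>i\<in>UNIV. (y $ i) ^ \<alpha> i) * g n y) = complex_of_real (LINT y|lborel. g n y)" by simp
    also have "\<dots> = fourier (\<lambda>y. complex_of_real (g n y)) 0"
      unfolding fourier_def integral_complex_of_real[symmetric] by simp
    also have "\<dots> = 0" unfolding gF by simp
    finally show "(LINT y|lborel. (\<Prod>i\<in>UNIV. (y $ i) ^ \<alpha> i) * g n y) = 0" by simp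
  qed
  define e where "e n \<xi> = (norm \<xi> powr (- s) * cmod (fourier (\<lambda>y. complex_of_real (g n y)) \<xi> - (iexp ((- x) \<bullet> \<xi>) - 1)))\<^sup>2" for n \<xi>
  have e_eq: "e n \<xi> = (cmod (riesz_symbol s x \<xi>))\<^sup>2 * (1 - exp (- (norm \<xi>)\<^sup>2 / (4 * real (Suc n))))\<^sup>2" for n \<xi>
  proof -
    have "(iexp ((- x) \<bullet> \<xi>) - 1) * complex_of_real (exp (- (norm \<xi>)\<^sup>2 / (4 * real (Suc n)))) - (iexp ((- x) \<bullet> \<xi>) - 1)
      = - ((iexp ((- x) \<bullet> \<xi>) - 1) * complex_of_real (1 - exp (- (norm \<xi>)\<^sup>2 / (4 * real (Suc n)))))"
      by (simp only: of_real_diff of_real_1 right_diff_distrib mult_1_right minus_diff_eq)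
    then show ?thesis
      unfolding e_def gF riesz_symbol_def by (simp only: norm_minus_cancel norm_mult norm_of_real power_mult_distrib power2_abs)
  qed
  have em[measurable]: "e n \<in> borel_measurable borel" for n
    unfolding e_eq[abs_def] by measurable
  have m2: "integrable lborel (\<lambda>\<xi>. (cmod (riesz_symbol s x \<xi>))\<^sup>2)"
    by (rule integrable_riesz_symbol_square) (use s in auto)
  have "(\<lambda>n. \<integral>\<^sup>+\<xi>. ennreal (e n \<xi>) \<partial>lborel) \<longlonglongrightarrow> (\<integral>\<^sup>+\<xi>. 0 \<partial>(lborel :: (real ^ 'n) measure))"
  proof (rule nn_integral_dominated_convergence[where w = "\<lambda>\<xi>. ennreal ((cmod (riesz_symbol s x \<xi>))\<^sup>2)"])
    show "(\<integral>\<^sup>+\<xi>. ennreal ((cmod (riesz_symbol s x \<xi>))\<^sup>2) \<partial>lborel) < \<infinity>"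
      using m2 by (simp add: integrable_iff_bounded)
    show "AE \<xi> in lborel. ennreal (e n \<xi>) \<le> ennreal ((cmod (riesz_symbol s x \<xi>))\<^sup>2)" for n
    proof (intro AE_I2 ennreal_leI)
      fix \<xi> :: "real ^ 'n"
      have "(1 - exp (- (norm \<xi>)\<^sup>2 / (4 * real (Suc n))))\<^sup>2 \<le> 1"
        by (rule power_le_one) auto
      then show "e n \<xi> \<le> (cmod (riesz_symbol s x \<xi>))\<^sup>2"
        unfolding e_eq by (rule mult_left_le) simp
    qed
    show "AE \<xi> in lborel. (\<lambda>n. ennreal (e n \<xi>)) \<longlonglongrightarrow> 0"
    proof (rule AE_I2)
      fix \<xi> :: "real ^ 'n"
      have "(\<lambda>n. 1 / real (Suc n)) \<longlonglongrightarrow> 0" using LIMSEQ_inverse_real_of_nat by (simp add: inverse_eq_divide)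
      then have "(\<lambda>n. (cmod (riesz_symbol s x \<xi>))\<^sup>2 * (1 - exp (- (norm \<xi>)\<^sup>2 / 4 * (1 / real (Suc n))))\<^sup>2) \<longlonglongrightarrow> (cmod (riesz_symbol s x \<xi>))\<^sup>2 * (1 - exp (- (norm \<xi>)\<^sup>2 / 4 * 0))\<^sup>2"
        by (intro tendsto_intros)
      then have "(\<lambda>n. e n \<xi>) \<longlonglongrightarrow> 0"
        unfolding e_eq by simp
      then show "(\<lambda>n. ennreal (e n \<xi>)) \<longlonglongrightarrow> 0"
        using tendsto_ennrealI by fastforce
    qed
  qed auto
  then have "(\<lambda>n. \<integral>\<^sup>+\<xi>. ennreal (e n \<xi>) \<partial>lborel) \<longlonglongrightarrow> 0" by simp
  from order_tendstoD(2)[OF this, of "ennreal (\<epsilon>\<^sup>2)"] \<epsilon>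
  have "\<forall>\<^sub>F n in sequentially. (\<integral>\<^sup>+\<xi>. ennreal (e n \<xi>) \<partial>lborel) < ennreal (\<epsilon>\<^sup>2)" by simp
  then obtain n where "(\<integral>\<^sup>+\<xi>. ennreal (e n \<xi>) \<partial>lborel) < ennreal (\<epsilon>\<^sup>2)"
    by (auto simp: eventually_sequentially)
  then show "\<exists>\<phi>\<in>schwartz_vanishing (s - real CARD('n) / 2).
          (\<integral>\<^sup>+ \<xi>. ennreal ((norm \<xi> powr (- s) *
             cmod (fourier (\<lambda>x. complex_of_real (\<phi> x)) \<xi> - (iexp ((- x) \<bullet> \<xi>) - 1)))\<^sup>2) \<partial>lborel) < ennreal (\<epsilon>\<^sup>2)"
    unfolding e_def by (intro bexI[OF _ gV])
qed

section \<open>The field at differences of Dirac measures\<close>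

text \<open>In the constant, Gamma(s/2) comes from splitting |\<xi>|^(-s) into Gaussians,
  \<open>riesz_const\<close> from reassembling the heat kernels, and (2 pi)^d from the normalization
  of \<open>inverse_fourier\<close>.\<close>

lemma frac_laplacian_dirac_diff:
  fixes s :: real and x :: "real ^ 'n::finite"
  assumes s: "1 < s" "CARD('n) < 2 * s" "2 * s < real CARD('n) + 2" "s < CARD('n)"
  shows "represented_by (frac_laplacian (- s / 2) (\<lambda>\<psi>. dirac x \<psi> - dirac 0 \<psi>))
    (\<lambda>y. complex_of_real (riesz_const CARD('n) s / (Gamma (s / 2) * (2 * pi) ^ CARD('n)) * riesz_diff (CARD('n) - s) x y))"
    (is "represented_by (frac_laplacian _ ?u) (\<lambda>y. complex_of_real (?C * _ y))")
  unfolding represented_by_def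
proof (intro conjI ballI)
  show "(\<lambda>y. complex_of_real (?C * riesz_diff (CARD('n) - s) x y)) \<in> borel_measurable borel" by measurable
  fix \<psi> :: "real ^ 'n \<Rightarrow> complex" assume \<psi>: "\<psi> \<in> schwartz"
  note i = schwartz_integrable[OF \<psi>]
  note [measurable] = borel_measurable_integrable[OF i]
  define F where "F \<xi> = (CLINT y|lborel. iexp (y \<bullet> \<xi>) * \<psi> y)" for \<xi>
  have Fm[measurable]: "F \<in> borel_measurable borel" unfolding F_def by measurable
  have iA: "integrable lborel (\<lambda>y. \<psi> y * complex_of_real (riesz_const CARD('n) s * norm (y - w) powr (s - CARD('n))))" for w
    by (rule heat_pairing_subordination[OF \<psi>]) (use s in auto)
  have "complex_of_real (?C * riesz_diff (CARD('n) - s) x y) * \<psi> y = complex_of_real (1 / (Gamma (s / 2) * (2 * pi) ^ CARD('n))) *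
     (\<psi> y * complex_of_real (riesz_const CARD('n) s * norm (y - x) powr (s - CARD('n))) - \<psi> y * complex_of_real (riesz_const CARD('n) s * norm (y - 0) powr (s - CARD('n))))" for y
    by (simp add: riesz_diff_def diff_divide_distrib algebra_simps)
  then show "integrable lborel (\<lambda>y. complex_of_real (?C * riesz_diff (CARD('n) - s) x y) * \<psi> y)"
    using iA by (simp only:) (intro integrable_mult_right Bochner_Integration.integrable_diff)
  have rep: "represented_by (fourier_dist ?u) (fourier_density ?u)"
    unfolding fourier_density_def
    by (rule someI[of "represented_by (fourier_dist ?u)", OF represented_by_fourier_dirac_diff])
  then have [measurable]: "fourier_density ?u \<in> borel_measurable borel" by (simp add: represented_by_def)
  have inv: "inverse_fourier \<psi> \<xi> = F \<xi> / complex_of_real ((2 * pi) ^ CARD('n))" for \<xi>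
    by (simp add: inverse_fourier_def F_def inner_commute)
  have "frac_laplacian (- s / 2) ?u \<psi> = (CLINT \<xi>|lborel. complex_of_real (norm \<xi> powr (- s)) * fourier_density ?u \<xi> * (F \<xi> / complex_of_real ((2 * pi) ^ CARD('n))))"
    unfolding frac_laplacian_def inverse_fourier_dist_def dist_of_fun_def inv by simp
  \<comment> \<open>The chosen density equals e^(-i x.\<xi>) - 1 only almost everywhere, which is
    enough under the integral.\<close>
  also have "\<dots> = (CLINT \<xi>|lborel. riesz_symbol s x \<xi> * F \<xi> / complex_of_real ((2 * pi) ^ CARD('n)))"
  proof (rule integral_cong_AE)
    show "AE \<xi> in lborel. complex_of_real (norm \<xi> powr (- s)) * fourier_density ?u \<xi> * (F \<xi> / complex_of_real ((2 * pi) ^ CARD('n))) = riesz_symbol s x \<xi> * F \<xi> / complex_of_real ((2 * pi) ^ CARD('n))"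
      using represented_by_unique[OF rep represented_by_fourier_dirac_diff]
      by eventually_elim (simp add: riesz_symbol_def)
  qed measurable
  also have "\<dots> = (CLINT \<xi>|lborel. riesz_symbol s x \<xi> * F \<xi>) / complex_of_real ((2 * pi) ^ CARD('n))"
    by (rule integral_divide_zero)
  also have "(CLINT \<xi>|lborel. riesz_symbol s x \<xi> * F \<xi>) = complex_of_real (riesz_const CARD('n) s / Gamma (s / 2)) * (CLINT y|lborel. complex_of_real (riesz_diff (CARD('n) - s) x y) * \<psi> y)"
    using riesz_symbol_pairing[OF \<psi> s, of x] by (simp only: F_def)
  also have "\<dots> / complex_of_real ((2 * pi) ^ CARD('n)) = complex_of_real ?C * (CLINT y|lborel. complex_of_real (riesz_diff (CARD('n) - s) x y) * \<psi> y)"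
    by simp
  also have "\<dots> = (CLINT y|lborel. complex_of_real ?C * (complex_of_real (riesz_diff (CARD('n) - s) x y) * \<psi> y))"
    by (rule integral_mult_right_zero[symmetric])
  finally show "frac_laplacian (- s / 2) ?u \<psi> = dist_of_fun (\<lambda>y. complex_of_real (?C * riesz_diff (CARD('n) - s) x y)) \<psi>"
    unfolding dist_of_fun_def by (simp only: of_real_mult mult.assoc)
qed

text \<open>One explicit representative shows that the choice succeeds and, by uniqueness of
  densities, determines its outcome up to a null set.\<close>

lemma L2_representative_AE:
  assumes "g \<in> L2" "represented_by u (\<lambda>x. complex_of_real (g x))"
  shows "L2_representative u \<in> L2" and "AE x in lborel. L2_representative u x = g x"
proof -
  have *: "L2_representative u \<in> L2 \<and> represented_by u (\<lambda>x. complex_of_real (L2_representative u x))"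
    unfolding L2_representative_def by (rule someI[of _ g]) (use assms in simp)
  then show "L2_representative u \<in> L2" by simp
  show "AE x in lborel. L2_representative u x = g x"
    using represented_by_unique[OF conjunct2[OF *] assms(2)] by simp
qed

theorem lemma2p4:
  fixes s :: real
    and M :: "'w measure" and W :: "(real ^ 'n \<Rightarrow> real) \<Rightarrow> 'w \<Rightarrow> real"
    and h :: "'n::finite dist_functional \<Rightarrow> 'w \<Rightarrow> real"
    and N :: "'v measure" and B :: "real ^ 'n \<Rightarrow> 'v \<Rightarrow> real"
  assumes "CARD('n) \<in> {2, 3}"
    and "real CARD('n) / 2 < s" and "s < real CARD('n) / 2 + 1"
    and "white_noise M W"
    and "fractional_gaussian_field W s h"
    and "fractional_brownian_field N (s - real CARD('n) / 2) B"
  shows "\<exists>c>0. same_fin_dim_distributions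
           M (\<lambda>x. h (\<lambda>\<psi>. dirac x \<psi> - dirac 0 \<psi>))
           N (\<lambda>x \<omega>. c * B x \<omega>)"
proof -
  let ?d = "real CARD('n)"
  let ?u = "\<lambda>x \<psi>. dirac (x :: real ^ 'n) \<psi> - dirac 0 \<psi>"
  \<comment> \<open>Here d \<ge> 2 enters: it gives s > d/2 \<ge> 1 and s < d/2 + 1 \<le> d, so that
    the kernel exponent d - s is positive.\<close>
  have s: "1 < s" "?d < 2 * s" "2 * s < ?d + 2" "s < ?d"
    using assms(1-3) by auto
  define b where "b = ?d - s"
  have b: "0 < b" "2 * b < ?d" "?d < 2 * b + 2" using s by (auto simp: b_def)
  define C where "C = riesz_const ?d s / (Gamma (s / 2) * (2 * pi) ^ CARD('n))"
  have C: "C > 0"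
    using riesz_const_pos[OF s(4)] Gamma_real_pos[of "s / 2"] s by (simp add: C_def)
  \<comment> \<open>Any unit vector serves, by rotation invariance; it only normalizes the constant
    \<open>Q\<close>.\<close>
  define e :: "real ^ 'n" where "e = axis undefined 1"
  have e: "norm e = 1" by (simp add: e_def)
  then have "e \<noteq> 0" by auto
  define Q where "Q = (LINT z|lborel. (riesz_diff b e z)\<^sup>2)"
  have Q: "Q > 0"
    unfolding Q_def by (rule integral_riesz_diff_square_pos) (use b \<open>e \<noteq> 0\<close> in auto)
  define g where "g x = L2_representative (frac_laplacian (- s / 2) (?u x))" for x
  have L2: "(\<lambda>y. C * riesz_diff b x y) \<in> L2" for x :: "real ^ 'n"
    using integrable_riesz_diff_square[of b x] b by (auto simp: L2_def power_mult_distrib)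
  note rep = frac_laplacian_dirac_diff[OF s, folded C_def b_def]
  have gL2: "g x \<in> L2" and g: "AE y in lborel. g x y = C * riesz_diff b x y" for x
    unfolding g_def by (rule L2_representative_AE[OF L2 rep])+
  have [measurable]: "g x \<in> borel_measurable borel" for x using gL2 by (simp add: L2_def)
  have cov: "(LINT z|lborel. g x z * g y z) = (C * sqrt Q)\<^sup>2 *
      ((norm x powr (2 * (s - ?d / 2)) + norm y powr (2 * (s - ?d / 2)) - norm (x - y) powr (2 * (s - ?d / 2))) / 2)" for x y
  proof -
    have "AE z in lborel. g x z * g y z = C\<^sup>2 * (riesz_diff b x z * riesz_diff b y z)"
      using g[of x] g[of y] by eventually_elim (simp add: power2_eq_square)
    then have "(LINT z|lborel. g x z * g y z) = (LINT z|lborel. C\<^sup>2 * (riesz_diff b x z * riesz_diff b y z))"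
      by (intro integral_cong_AE) measurable
    also have "\<dots> = C\<^sup>2 * (Q * ((norm x powr (?d - 2 * b) + norm y powr (?d - 2 * b) - norm (x - y) powr (?d - 2 * b)) / 2))"
      using riesz_diff_covariance[OF b e, of x y] by (simp add: Q_def)
    \<comment> \<open>With b = d - s the exponent d - 2b is 2s - d, which is 2H.\<close>
    also have "?d - 2 * b = 2 * (s - ?d / 2)" by (simp add: b_def)
    finally show ?thesis using Q by (simp add: power_mult_distrib)
  qed
  have h: "h (?u x) = W (g x)" for x
    using assms(5) dirac_diff_in_fgf_test_space[OF s(1-3), of x]
    by (simp add: fractional_gaussian_field_def g_def)
  have "centered_gaussian_process M UNIV (\<lambda>x. W (g x)) (\<lambda>x y. LINT z|lborel. g x z * g y z)"
    by (rule centered_gaussian_process_reindex[OF assms(4)[unfolded white_noise_def] gL2])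
  then have X: "centered_gaussian_process M UNIV (\<lambda>x. h (?u x)) (\<lambda>x y. (C * sqrt Q)\<^sup>2 *
      ((norm x powr (2 * (s - ?d / 2)) + norm y powr (2 * (s - ?d / 2)) - norm (x - y) powr (2 * (s - ?d / 2))) / 2))"
    unfolding cov h .
  have Y: "centered_gaussian_process N UNIV (\<lambda>x \<omega>. (C * sqrt Q) * B x \<omega>) (\<lambda>x y. (C * sqrt Q)\<^sup>2 *
      ((norm x powr (2 * (s - ?d / 2)) + norm y powr (2 * (s - ?d / 2)) - norm (x - y) powr (2 * (s - ?d / 2))) / 2))"
    by (rule centered_gaussian_process_scale) (use assms(6) in \<open>simp add: fractional_brownian_field_def\<close>)
  have "C * sqrt Q > 0" using C Q by simp
  with centered_gaussian_processes_same_fin_dim_distributions[OF X Y] show ?thesis by blast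
qed

end
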